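(* Let $n\in\{3,4\}$, let $G$ and $G'$ be two of the labelled connected graphs on the vertex set $\{1,\dots,n\}$ listed in the context ($K_3,P_2$ for $n=3$; $C_4$ + diagonal, $C_4$, $P_3$, $K_3$ + tail, $Y$-shape for $n=4$), such that $G'$ is a subgraph of $G$ (i.e. $\mathcal E(G')\subset\mathcal E(G)$) and $$\min\{\delta(G),2\}>\delta(G').$$ Let $1\le p_1,\dots,p_n\le\infty$ and suppose that $\Lambda_G(p_1,\dots,p_n)\lesssim1$, where the operators act on functions on $\mathbb F_q^2$. Then $\Lambda_{G'}(p_1,\dots,p_n)\lesssim1$, except that in the case $G=C_4$ + diagonal and $G'=K_3$ + tail this conclusion is asserted for $(p_1,p_2,p_3,p_4)\neq(2,2,2,\infty)$, while $\Lambda_{K_3+\text{tail}}(2,2,2,\infty)\lessapprox1$.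
   Context: Conventions: $q$ ranges over powers of odd primes for which $3$ is a nonzero square in $\mathbb F_q$. For $x\in\mathbb F_q^2$ put $\|x\|=x_1^2+x_2^2$. For $t\in\mathbb F_q^*$, $S_t=\{x\in\mathbb F_q^2:\|x\|=t\}$, and $S_t(x)$ also denotes its indicator function. For $f:\mathbb F_q^2\to\mathbb R$: $\|f\|_p=(q^{-2}\sum_x|f(x)|^p)^{1/p}$ for $1\le p<\infty$ and $\|f\|_\infty=\max_x|f(x)|$. Exponents are extended real numbers. $\delta(G)$ is the minimum degree of a vertex of $G$. For each graph $G$ on $\{1,\dots,n\}$ below, with edge set $\mathcal E(G)$ and normalizing factor $\mathcal N(G)$, $$\Lambda_G(f_1,\dots,f_n)=\frac1{\mathcal N(G)}\sum_{x^1,\dots,x^n\in\mathbb F_q^2}\ \prod_{(i,j)\in\mathcal E(G)}S_t(x^i-x^j)\prod_{l=1}^nf_l(x^l).$$ Graphs: - $K_3$: edges $12,23,31$; $\mathcal N=q^2|S_t|$. - $P_2$: edges $12,23$; $\mathcal N=q^2|S_t|^2$. - $C_4$ + diagonal: edges $12,23,34,41,13$; $\mathcal N=q^2|S_t|$. - $C_4$: edges $12,23,34,41$; $\mathcal N=q^2|S_t|^2$. - $P_3$: edges $12,23,34$; $\mathcal N=q^2|S_t|^3$. - $K_3$ + tail: edges $12,23,34,31$; $\mathcal N=q^2|S_t|^2$. - $Y$-shape: edges $31,32,34$; $\mathcal N=q^2|S_t|^3$. $\Lambda_G(p_1,\dots,p_n)$ is the smallest constant such that $\Lambda_G(f_1,\dots,f_n)\le\Lambda_G(p_1,\dots,p_n)\prod_i\|f_i\|_{p_i}$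 for all non-negative real-valued $f_i$. $\Lambda_G(p_1,\dots,p_n)\lesssim1$ means there is $C\ge1$, independent of $q$ and $t$, with $\Lambda_G(p_1,\dots,p_n)\le C$ for all such $q$ and all $t\in\mathbb F_q^*$. $\Lambda_G(p_1,\dots,p_n)\lessapprox1$ means the corresponding inequality, with constant independent of $q,t$, holds whenever all $f_i$ are indicator functions of subsets of $\mathbb F_q^2$. *)

theory Defs
  imports "HOL-Algebra.Algebra" "HOL-Library.Extended_Real" "HOL-Library.Indicator_Function"
begin

section \<open>The plane over a finite field\<close>

definition admissible_field :: "('a, 'm) ring_scheme \<Rightarrow> bool" where
  "admissible_field R \<longleftrightarrow>
     field R \<and> finite (carrier R) \<and>
     (\<exists>p k :: nat. Factorial_Ring.prime p \<and> odd p \<and> k \<ge> 1 \<and> card (carrier R) = p ^ k) \<and>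
     (let three = \<one>\<^bsub>R\<^esub> \<oplus>\<^bsub>R\<^esub> \<one>\<^bsub>R\<^esub> \<oplus>\<^bsub>R\<^esub> \<one>\<^bsub>R\<^esub>
      in three \<noteq> \<zero>\<^bsub>R\<^esub> \<and> (\<exists>a\<in>carrier R. a \<otimes>\<^bsub>R\<^esub> a = three))"

definition plane :: "('a, 'm) ring_scheme \<Rightarrow> ('a \<times> 'a) set" where
  "plane R = carrier R \<times> carrier R"

definition plane_diff :: "('a, 'm) ring_scheme \<Rightarrow> 'a \<times> 'a \<Rightarrow> 'a \<times> 'a \<Rightarrow> 'a \<times> 'a" where
  "plane_diff R x y = (fst x \<ominus>\<^bsub>R\<^esub> fst y, snd x \<ominus>\<^bsub>R\<^esub> snd y)"

definition sqnorm :: "('a, 'm) ring_scheme \<Rightarrow> 'a \<times> 'a \<Rightarrow> 'a" where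
  "sqnorm R x = fst x \<otimes>\<^bsub>R\<^esub> fst x \<oplus>\<^bsub>R\<^esub> snd x \<otimes>\<^bsub>R\<^esub> snd x"

definition circle :: "('a, 'm) ring_scheme \<Rightarrow> 'a \<Rightarrow> ('a \<times> 'a) set" where
  "circle R t = {x \<in> plane R. sqnorm R x = t}"

text \<open>Normalized norms, with \<^term>\<open>(card (carrier R))\<^sup>2\<close> the number of points of the plane.
  Meant for \<^term>\<open>1 \<le> (p :: ereal)\<close>.\<close>

definition Lp_norm :: "('a, 'm) ring_scheme \<Rightarrow> ereal \<Rightarrow> ('a \<times> 'a \<Rightarrow> real) \<Rightarrow> real" where
  "Lp_norm R p f =
     (if p = \<infinity> then Max ((\<lambda>x. \<bar>f x\<bar>) ` plane R)
      else ((\<Sum>x\<in>plane R. \<bar>f x\<bar> powr real_of_ereal p) / (real (card (carrier R)))\<^sup>2)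
             powr (1 / real_of_ereal p))"


section \<open>The labelled graphs\<close>

datatype graph = K3 | P2 | C4_diag | C4 | P3 | K3_tail | Y_shape

fun nverts :: "graph \<Rightarrow> nat" where
  "nverts K3 = 3"
| "nverts P2 = 3"
| "nverts C4_diag = 4"
| "nverts C4 = 4"
| "nverts P3 = 4"
| "nverts K3_tail = 4"
| "nverts Y_shape = 4"

fun edges :: "graph \<Rightarrow> nat set set" where
  "edges K3 = {{1,2}, {2,3}, {3,1}}"
| "edges P2 = {{1,2}, {2,3}}"
| "edges C4_diag = {{1,2}, {2,3}, {3,4}, {4,1}, {1,3}}"
| "edges C4 = {{1,2}, {2,3}, {3,4}, {4,1}}"
| "edges P3 = {{1,2}, {2,3}, {3,4}}"
| "edges K3_tail = {{1,2}, {2,3}, {3,4}, {3,1}}"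
| "edges Y_shape = {{3,1}, {3,2}, {3,4}}"

text \<open>The normalizing factor of \<open>G\<close> is $q^2 |S_t|^k$ with \<open>k = circle_exponent G\<close>.\<close>

fun circle_exponent :: "graph \<Rightarrow> nat" where
  "circle_exponent K3 = 1"
| "circle_exponent P2 = 2"
| "circle_exponent C4_diag = 1"
| "circle_exponent C4 = 2"
| "circle_exponent P3 = 3"
| "circle_exponent K3_tail = 2"
| "circle_exponent Y_shape = 3"

definition vertices :: "graph \<Rightarrow> nat set" where
  "vertices G = {1..nverts G}"

definition vertex_degree :: "graph \<Rightarrow> nat \<Rightarrow> nat" where
  "vertex_degree G v = card {e \<in> edges G. v \<in> e}"

definition min_degree :: "graph \<Rightarrow> nat" where
  "min_degree G = Min (vertex_degree G ` vertices G)"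

definition normalizer :: "('a, 'm) ring_scheme \<Rightarrow> 'a \<Rightarrow> graph \<Rightarrow> real" where
  "normalizer R t G =
     (real (card (carrier R)))\<^sup>2 * real (card (circle R t)) ^ circle_exponent G"


section \<open>The multilinear forms and their best constants\<close>

text \<open>The tuples of points $(x^1, \dots, x^n)$ and of functions $(f_1, \dots, f_n)$ are indexed by
  the vertices. The product takes every undirected edge once, oriented from its smaller to its
  larger endpoint; the orientation is immaterial because circles are symmetric about the origin.\<close>

definition graph_form ::
  "('a, 'm) ring_scheme \<Rightarrow> 'a \<Rightarrow> graph \<Rightarrow> (nat \<Rightarrow> 'a \<times> 'a \<Rightarrow> real) \<Rightarrow> real" where
  "graph_form R t G f =
     (\<Sum>x \<in> vertices G \<rightarrow>\<^sub>E plane R.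
        (\<Prod>(i, j) \<in> {(i, j). i < j \<and> {i, j} \<in> edges G}.
            indicator (circle R t) (plane_diff R (x i) (x j)))
        * (\<Prod>l\<in>vertices G. f l (x l))) / normalizer R t G"

definition form_bounds ::
  "('a, 'm) ring_scheme \<Rightarrow> 'a \<Rightarrow> graph \<Rightarrow> (nat \<Rightarrow> ereal) \<Rightarrow> real set" where
  "form_bounds R t G p =
     {C. \<forall>f. (\<forall>l\<in>vertices G. \<forall>x\<in>plane R. 0 \<le> f l x) \<longrightarrow>
             graph_form R t G f \<le> C * (\<Prod>l\<in>vertices G. Lp_norm R (p l) (f l))}"

text \<open>The infimum is attained: see \<open>form_const_least\<close> below.\<close>

definition form_const ::
  "('a, 'm) ring_scheme \<Rightarrow> 'a \<Rightarrow> graph \<Rightarrow> (nat \<Rightarrow> ereal) \<Rightarrow> real" where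
  "form_const R t G p = Inf (form_bounds R t G p)"

text \<open>Every finite field is isomorphic to one whose carrier is a set of natural numbers (see
  \<open>admissible_field_nat_copy\<close> below), so letting \<open>R\<close> range over \<^typ>\<open>nat ring\<close> covers all \<open>q\<close>.\<close>

definition bounded_form :: "graph \<Rightarrow> (nat \<Rightarrow> ereal) \<Rightarrow> bool" where
  "bounded_form G p \<longleftrightarrow>
     (\<exists>C\<ge>1. \<forall>R :: nat ring. admissible_field R \<longrightarrow>
        (\<forall>t \<in> carrier R - {\<zero>\<^bsub>R\<^esub>}. form_const R t G p \<le> C))"

definition restricted_bounded_form :: "graph \<Rightarrow> (nat \<Rightarrow> ereal) \<Rightarrow> bool" where
  "restricted_bounded_form G p \<longleftrightarrow>
     (\<exists>C\<ge>1. \<forall>R :: nat ring. admissible_field R \<longrightarrow>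
        (\<forall>t \<in> carrier R - {\<zero>\<^bsub>R\<^esub>}. \<forall>E. (\<forall>l\<in>vertices G. E l \<subseteq> plane R) \<longrightarrow>
           graph_form R t G (\<lambda>l. indicator (E l))
             \<le> C * (\<Prod>l\<in>vertices G. Lp_norm R (p l) (indicator (E l)))))"


section \<open>Adequacy of the definitions\<close>

lemma admissible_field_nat_copy:
  fixes R :: "'a ring" (structure)
  assumes "admissible_field R"
  shows "\<exists>R' :: nat ring. admissible_field R' \<and> R \<simeq> R'"
proof -
  interpret field R using assms by (simp add: admissible_field_def)
  have fin: "finite (carrier R)" using assms by (simp add: admissible_field_def)
  then obtain h :: "'a \<Rightarrow> nat" where inj: "inj_on h (carrier R)"
    using finite_imp_inj_to_nat_seg by blast
  let ?R' = "image_ring h R"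
  have iso: "h \<in> ring_iso R ?R'" using inj by (rule inj_imp_image_ring_iso)
  have F: "field ?R'" using inj by (rule inj_imp_image_ring_is_field)
  have car: "carrier ?R' = h ` carrier R" by (rule image_ring_carrier)
  have hom: "h (x \<oplus> y) = h x \<oplus>\<^bsub>?R'\<^esub> h y" "h (x \<otimes> y) = h x \<otimes>\<^bsub>?R'\<^esub> h y"
    if "x \<in> carrier R" "y \<in> carrier R" for x y
    using iso that by (auto simp: ring_iso_def ring_hom_def)
  have one: "h \<one> = \<one>\<^bsub>?R'\<^esub>" and zero: "h \<zero> = \<zero>\<^bsub>?R'\<^esub>"
    by (simp_all add: image_ring_one image_ring_zero)
  have three: "h (\<one> \<oplus> \<one> \<oplus> \<one>) = \<one>\<^bsub>?R'\<^esub> \<oplus>\<^bsub>?R'\<^esub> \<one>\<^bsub>?R'\<^esub> \<oplus>\<^bsub>?R'\<^esub> \<one>\<^bsub>?R'\<^esub>"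
    by (simp add: hom one)
  obtain a where a: "a \<in> carrier R" "a \<otimes> a = \<one> \<oplus> \<one> \<oplus> \<one>" and nz: "\<one> \<oplus> \<one> \<oplus> \<one> \<noteq> \<zero>"
    using assms by (auto simp: admissible_field_def Let_def)
  have "h a \<otimes>\<^bsub>?R'\<^esub> h a = \<one>\<^bsub>?R'\<^esub> \<oplus>\<^bsub>?R'\<^esub> \<one>\<^bsub>?R'\<^esub> \<oplus>\<^bsub>?R'\<^esub> \<one>\<^bsub>?R'\<^esub>"
    using a three hom(2)[of a a] by simp
  moreover have "h a \<in> carrier ?R'" using a car by simp
  moreover have "\<one>\<^bsub>?R'\<^esub> \<oplus>\<^bsub>?R'\<^esub> \<one>\<^bsub>?R'\<^esub> \<oplus>\<^bsub>?R'\<^esub> \<one>\<^bsub>?R'\<^esub> \<noteq> \<zero>\<^bsub>?R'\<^esub>"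
    using nz inj_on_eq_iff[OF inj, of "\<one> \<oplus> \<one> \<oplus> \<one>" "\<zero>"] three zero by simp
  moreover have "card (carrier ?R') = card (carrier R)"
    unfolding car using inj by (rule card_image)
  moreover have "finite (carrier ?R')" unfolding car using fin by (rule finite_imageI)
  moreover have "\<exists>p k :: nat. Factorial_Ring.prime p \<and> odd p \<and> k \<ge> 1 \<and> card (carrier R) = p ^ k"
    using assms by (simp add: admissible_field_def)
  ultimately have "admissible_field ?R'"
    using F unfolding admissible_field_def Let_def by auto
  then show ?thesis using iso by (auto simp: is_ring_iso_def)
qed

lemma Lp_norm_nonneg:
  assumes "finite (carrier R)" "carrier R \<noteq> {}"
  shows "0 \<le> Lp_norm R p f"
proof (cases "p = \<infinity>")
  case True
  obtain a where "a \<in> plane R" using assms by (auto simp: plane_def)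
  moreover have "finite (plane R)" using assms by (simp add: plane_def)
  ultimately have "\<bar>f a\<bar> \<le> Max ((\<lambda>x. \<bar>f x\<bar>) ` plane R)" by simp
  then show ?thesis using True by (simp add: Lp_norm_def)
qed (simp add: Lp_norm_def)

lemma Lp_norm_one:
  fixes R :: "('a, 'm) ring_scheme"
  assumes "finite (carrier R)" "carrier R \<noteq> {}" "1 \<le> p"
  shows "Lp_norm R p (\<lambda>_. 1) = 1"
proof -
  have "card (carrier R) > 0" using assms by (simp add: card_gt_0_iff)
  moreover have "plane R \<noteq> {}" using assms by (auto simp: plane_def)
  moreover have "card (plane R) = (card (carrier R))\<^sup>2"
    by (simp add: plane_def card_cartesian_product power2_eq_square)
  moreover have "(\<lambda>x :: 'a \<times> 'a. \<bar>1 :: real\<bar>) ` plane R = {1}"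
    using \<open>plane R \<noteq> {}\<close> by auto
  ultimately show ?thesis by (simp add: Lp_norm_def)
qed

lemma value_le_Lp_norm:
  assumes "finite (carrier R)" "1 \<le> p" "x \<in> plane R"
  shows "\<bar>f x\<bar> \<le> (real (card (carrier R)))\<^sup>2 * Lp_norm R p f"
proof -
  have fin: "finite (plane R)" using assms by (simp add: plane_def)
  define Q where "Q = (real (card (carrier R)))\<^sup>2"
  have "carrier R \<noteq> {}" using assms by (auto simp: plane_def)
  then have "card (carrier R) \<ge> 1" using assms by (simp add: Suc_le_eq card_gt_0_iff)
  then have Q: "Q \<ge> 1" by (simp add: Q_def)
  show ?thesis
  proof (cases "p = \<infinity>")
    case True
    define M where "M = Max ((\<lambda>x. \<bar>f x\<bar>) ` plane R)"
    have m: "\<bar>f x\<bar> \<le> M" unfolding M_def using assms fin by (intro Max_ge) auto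
    then have "1 * M \<le> Q * M" using Q by (intro mult_right_mono) linarith+
    with m have "\<bar>f x\<bar> \<le> Q * M" by linarith
    moreover have "Lp_norm R p f = M" using True by (simp add: Lp_norm_def M_def)
    ultimately show ?thesis by (simp only: Q_def)
  next
    case False
    define r where "r = real_of_ereal p"
    have r: "r \<ge> 1" using assms(2) False unfolding r_def by (cases p) (auto simp: one_ereal_def)
    define T where "T = (\<Sum>x\<in>plane R. \<bar>f x\<bar> powr r)"
    have "\<bar>f x\<bar> powr r \<le> T"
      unfolding T_def using assms fin by (intro member_le_sum) auto
    then have "(\<bar>f x\<bar> powr r) powr (1/r) \<le> T powr (1/r)"
      using r by (intro powr_mono2) auto
    then have "\<bar>f x\<bar> \<le> T powr (1/r)" using r by (simp add: powr_powr)
    also have "\<dots> = Q powr (1/r) * (T / Q) powr (1/r)"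
      using Q by (simp add: powr_divide sum_nonneg T_def)
    also have "\<dots> \<le> Q powr 1 * (T / Q) powr (1/r)"
      using Q r by (intro mult_right_mono powr_mono) auto
    also have "\<dots> = Q * (T / Q) powr (1/r)" using Q by simp
    finally show ?thesis using False by (simp only: Lp_norm_def Q_def T_def r_def if_False)
  qed
qed

lemma form_const_least:
  fixes R :: "('a, 'm) ring_scheme"
  assumes fin: "finite (carrier R)" and ne: "carrier R \<noteq> {}"
    and p: "\<And>l. l \<in> vertices G \<Longrightarrow> 1 \<le> p l"
  shows "form_const R t G p \<in> form_bounds R t G p"
    and "C \<in> form_bounds R t G p \<Longrightarrow> form_const R t G p \<le> C"
proof -
  let ?V = "vertices G" and ?B = "form_bounds R t G p"
  let ?N = "\<lambda>f. \<Prod>l\<in>?V. Lp_norm R (p l) (f l)"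
  define K where "K = (\<lambda>x :: nat \<Rightarrow> 'a \<times> 'a. (\<Prod>(i, j) \<in> {(i, j). i < j \<and> {i, j} \<in> edges G}.
            indicator (circle R t) (plane_diff R (x i) (x j)) :: real))"
  have K: "0 \<le> K x" "K x \<le> 1" for x
    unfolding K_def by (auto intro!: prod_nonneg prod_le_1 simp: indicator_def)
  have N0: "0 \<le> normalizer R t G" by (simp add: normalizer_def)
  have Lam: "graph_form R t G f = (\<Sum>x \<in> ?V \<rightarrow>\<^sub>E plane R. K x * (\<Prod>l\<in>?V. f l (x l)))
      / normalizer R t G" for f
    by (simp add: graph_form_def K_def)
  have norm0: "0 \<le> ?N f" for f
    by (intro prod_nonneg) (auto intro: Lp_norm_nonneg[OF fin ne])
  have low: "0 \<le> C" if "C \<in> ?B" for C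
  proof -
    have "0 \<le> graph_form R t G (\<lambda>_ _. 1)"
      unfolding Lam using K N0 by (auto intro!: divide_nonneg_nonneg sum_nonneg)
    also have "\<dots> \<le> C * ?N (\<lambda>_ _. 1)"
      using that unfolding form_bounds_def by (auto dest!: spec[of _ "\<lambda>_ _. 1"])
    also have "?N (\<lambda>_ _. 1) = 1"
      by (intro prod.neutral) (auto intro: Lp_norm_one[OF fin ne p])
    finally show ?thesis by simp
  qed
  then have bdd: "bdd_below ?B" by (rule bdd_belowI)
  show "form_const R t G p \<le> C" if "C \<in> ?B"
    unfolding form_const_def by (rule cInf_lower[OF that bdd])
  define Q where "Q = (real (card (carrier R)))\<^sup>2"
  define C0 where
    "C0 = real (card (?V \<rightarrow>\<^sub>E plane R)) * Q ^ card ?V / normalizer R t G"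
  have "C0 \<in> ?B"
    unfolding form_bounds_def
  proof (intro CollectI allI impI)
    fix f :: "nat \<Rightarrow> 'a \<times> 'a \<Rightarrow> real"
    assume f: "\<forall>l\<in>?V. \<forall>x\<in>plane R. 0 \<le> f l x"
    have "K x * (\<Prod>l\<in>?V. f l (x l)) \<le> Q ^ card ?V * ?N f" if "x \<in> ?V \<rightarrow>\<^sub>E plane R" for x
    proof -
      have x: "x l \<in> plane R" if "l \<in> ?V" for l
        using that \<open>x \<in> ?V \<rightarrow>\<^sub>E plane R\<close> by auto
      have "K x * (\<Prod>l\<in>?V. f l (x l)) \<le> 1 * (\<Prod>l\<in>?V. f l (x l))"
        using K f x by (intro mult_right_mono prod_nonneg) auto
      also have "\<dots> \<le> (\<Prod>l\<in>?V. Q * Lp_norm R (p l) (f l))"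
        unfolding mult_1
      proof (intro prod_mono conjI)
        fix l assume l: "l \<in> ?V"
        show "0 \<le> f l (x l)" using f x l by blast
        show "f l (x l) \<le> Q * Lp_norm R (p l) (f l)"
          using value_le_Lp_norm[OF fin p[OF l] x[OF l], of "f l"] by (simp add: Q_def)
      qed
      also have "\<dots> = Q ^ card ?V * ?N f" by (simp add: prod.distrib)
      finally show ?thesis .
    qed
    then have "(\<Sum>x \<in> ?V \<rightarrow>\<^sub>E plane R. K x * (\<Prod>l\<in>?V. f l (x l)))
        \<le> real (card (?V \<rightarrow>\<^sub>E plane R)) * (Q ^ card ?V * ?N f)"
      by (rule sum_bounded_above)
    then show "graph_form R t G f \<le> C0 * ?N f"
      unfolding Lam C0_def using N0 by (simp add: divide_right_mono mult.assoc)
  qed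
  show "form_const R t G p \<in> ?B"
    unfolding form_bounds_def
  proof (intro CollectI allI impI)
    fix f :: "nat \<Rightarrow> 'a \<times> 'a \<Rightarrow> real"
    assume f: "\<forall>l\<in>?V. \<forall>x\<in>plane R. 0 \<le> f l x"
    have le: "graph_form R t G f \<le> C * ?N f" if "C \<in> ?B" for C
      using that f unfolding form_bounds_def by blast
    show "graph_form R t G f \<le> form_const R t G p * ?N f"
    proof (cases "?N f = 0")
      case True
      then show ?thesis using le[OF \<open>C0 \<in> ?B\<close>] by simp
    next
      case False
      then have pos: "?N f > 0" using norm0[of f] by simp
      have "graph_form R t G f / ?N f \<le> form_const R t G p"
        unfolding form_const_def using \<open>C0 \<in> ?B\<close> le pos
        by (intro cInf_greatest) (auto simp: pos_divide_le_eq)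
      then show ?thesis using pos by (simp add: pos_divide_le_eq)
    qed
  qed
qed

end

theory Submission
  imports Defs "HOL-Analysis.Convex" "HOL-Number_Theory.Residues"
begin

text \<open>Joining two points of the plane when their difference lies on the circle of radius \<open>t\<close>
  gives a regular graph of degree about $q$ on $q^2$ vertices. Two distinct circles of
  radius \<open>t\<close> meet in at most two points, and this is all that the upper bounds use. Splitting
  off the largest value of the function on each circle gives the bound $L^{3/2} \to L^3$ for the
  averaging operator \<open>A\<close>, and interpolation with the trivial bounds gives
  $L^{1/a} \to L^{1/b}$ with \<open>b = max (a / 2) (2 a - 1)\<close>. Together with Hoelder's inequality this
  settles every tree. For the triangle with a tail the tail is absorbed into the function at
  vertex 3, and the triangle form is bounded on the polytope with vertices \<open>0\<close>, $e_i$,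
  $\frac23 (e_i + e_j)$, $\frac12 (1,1,1)$. The last vertex holds in the strong sense, not only
  for indicator functions, so the exceptional exponent \<open>(2,2,2,\<infinity>)\<close> needs no separate treatment.

  The hypothesis on \<open>G\<close> is used through test functions: indicators of the origin and of a circle
  around it, chosen such that \<open>G\<close> has many copies with the prescribed vertices (for \<open>K\<^sub>3\<close> and
  \<open>C\<^sub>4\<close> + diagonal these come from equilateral triangles, which exist since 3 is a square).
  Letting \<open>q\<close> tend to infinity, they yield linear inequalities between the exponents \<open>1 / p\<^sub>i\<close>.\<close>

section \<open>Averages over the neighbourhoods of a graph with bounded codegrees\<close>

text \<open>Norms are traded for densities: a function \<open>f\<close> lies below
  \<open>2 * Lp_norm R p f\<close> times \<open>F powr (1/p)\<close> for a positive \<open>F\<close>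
  of mean at most 1. A product of powers of densities lies pointwise below a power of one density,
  by weighted AM-GM. So Hoelder's inequality and interpolation become pointwise estimates, bounds
  can be chained along a graph, and linear arithmetic in the exponents 1/p_i remains. The exponents
  3/2 and 3 are natural: up to constants, the indicators of a point and of a circle are both
  extremal for \<open>L^(3/2) -> L^3\<close>, and splitting off the largest value treats the two
  shapes separately. The degree condition leaves five pairs, with \<open>G\<close> among
  \<open>K3\<close>, \<open>C4\<close>, \<open>C4_diag\<close> and \<open>G'\<close> among
  \<open>P2\<close>, \<open>P3\<close>, \<open>Y_shape\<close>, \<open>K3_tail\<close>: upper bounds
  concern graphs with a leaf, which is removed by averaging, and lower bounds concern graphs of
  minimum degree 2. There the number of copies of \<open>G\<close> is at least the power of |S_t| in
  the normalizer, so the form is at least q^-2 and is compared with the norms of the test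
  functions.\<close>

lemma weighted_am_gm:
  fixes u v \<theta> :: real
  assumes "0 \<le> \<theta>" "\<theta> \<le> 1" "0 \<le> u" "0 \<le> v"
  shows "u powr (1 - \<theta>) * v powr \<theta> \<le> (1 - \<theta>) * u + \<theta> * v"
  using Youngs_inequality_0[of "1 - \<theta>" \<theta> u v] assms by (cases "u = 0 \<or> v = 0") auto

text \<open>Hoelder's inequality for the exponents 1/(1 - \<theta>) and 1/\<theta>, endpoints
  included: divided by their total sums, both families have sum 1, and weighted AM-GM can be summed
  term by term.\<close>

lemma sum_powr_log_convex:
  fixes u v :: "'i \<Rightarrow> real"
  assumes "finite Y" "Y \<noteq> {}" "0 \<le> \<theta>" "\<theta> \<le> 1"
    and u: "\<And>y. y \<in> Y \<Longrightarrow> 0 < u y" and v: "\<And>y. y \<in> Y \<Longrightarrow> 0 < v y"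
  shows "(\<Sum>y\<in>Y. u y powr (1 - \<theta>) * v y powr \<theta>) \<le> sum u Y powr (1 - \<theta>) * sum v Y powr \<theta>"
proof -
  let ?U = "sum u Y" and ?V = "sum v Y"
  have U: "0 < ?U" and V: "0 < ?V"
    using assms by (auto intro!: sum_pos)
  let ?K = "?U powr (1 - \<theta>) * ?V powr \<theta>"
  have "u y powr (1 - \<theta>) * v y powr \<theta> \<le> ?K * ((1 - \<theta>) * (u y / ?U) + \<theta> * (v y / ?V))"
    if "y \<in> Y" for y
  proof -
    have "u y powr (1 - \<theta>) * v y powr \<theta>
        = ?K * ((u y / ?U) powr (1 - \<theta>) * (v y / ?V) powr \<theta>)"
      using u[OF that] v[OF that] U V by (simp add: powr_divide)
    also have "\<dots> \<le> ?K * ((1 - \<theta>) * (u y / ?U) + \<theta> * (v y / ?V))"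
      using u[OF that] v[OF that] U V assms
      by (intro mult_left_mono weighted_am_gm) auto
    finally show ?thesis .
  qed
  then have "(\<Sum>y\<in>Y. u y powr (1 - \<theta>) * v y powr \<theta>)
      \<le> (\<Sum>y\<in>Y. ?K * ((1 - \<theta>) * (u y / ?U) + \<theta> * (v y / ?V)))"
    by (rule sum_mono)
  also have "\<dots> = ?K * ((1 - \<theta>) * (?U / ?U) + \<theta> * (?V / ?V))"
    by (simp only: sum.distrib sum_distrib_left[symmetric] sum_divide_distrib[symmetric])
  also have "\<dots> = ?K" using U V by simp
  finally show ?thesis .
qed

lemma add_cube_le:
  fixes a b :: real
  assumes "0 \<le> a" "0 \<le> b"
  shows "(a + b)^3 \<le> 4 * (a^3 + b^3)"
proof -
  have "4 * (a^3 + b^3) - (a + b)^3 = 3 * ((a + b) * (a - b)\<^sup>2)"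
    by (simp add: power2_eq_square power3_eq_cube algebra_simps)
  moreover have "0 \<le> (a + b) * (a - b)\<^sup>2" using assms by simp
  ultimately show ?thesis by linarith
qed

text \<open>Split off a point \<open>y0\<close> carrying the largest value \<open>M\<close>: the
  cube of M^(2/3) is M^2, a diagonal term, while for the other points power means give
  \<open>card Y\<close> times the square of their sum \<open>S\<close>. The weights 1 and
  \<open>card Y\<close> fit the later count over circles: a point lies on d of them, a pair of
  distinct points on at most two.\<close>

lemma cube_sum_powr_le:
  fixes F :: "'i \<Rightarrow> real"
  assumes fin: "finite Y" and F: "\<And>y. y \<in> Y \<Longrightarrow> 0 < F y"
  shows "(\<Sum>y\<in>Y. F y powr (2/3))^3
      \<le> 4 * (\<Sum>y\<in>Y. (F y)\<^sup>2) + 4 * real (card Y) * (\<Sum>y\<in>Y. \<Sum>z\<in>Y - {y}. F y * F z)"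
proof (cases "Y = {}")
  case False
  define M where "M = Max (F ` Y)"
  have "M \<in> F ` Y" unfolding M_def using fin False by (intro Max_in) auto
  then obtain y0 where y0: "y0 \<in> Y" "F y0 = M" by auto
  have le_M: "F y \<le> M" if "y \<in> Y" for y unfolding M_def using fin that by auto
  have M: "0 < M" using y0 F by auto
  have F0: "0 \<le> F y" if "y \<in> Y" for y using F[OF that] by simp
  let ?Z = "Y - {y0}"
  define S where "S = sum F ?Z"
  define D where "D = (\<Sum>y\<in>Y. \<Sum>z\<in>Y - {y}. F y * F z)"
  have rest: "(\<Sum>y\<in>?Z. F y powr (2/3))^3 \<le> real (card Y) * S\<^sup>2"
  proof (cases "?Z = {}")
    case True
    then show ?thesis unfolding True by simp
  next
    case False
    have "(\<Sum>y\<in>?Z. F y powr (2/3)) = (\<Sum>y\<in>?Z. 1 powr (1 - 2/3) * F y powr (2/3))" by simp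
    also have "\<dots> \<le> sum (\<lambda>_. 1) ?Z powr (1 - 2/3) * sum F ?Z powr (2/3)"
      using fin False F by (intro sum_powr_log_convex) auto
    also have "\<dots> = real (card ?Z) powr (1/3) * S powr (2/3)" by (simp add: S_def)
    finally have "(\<Sum>y\<in>?Z. F y powr (2/3))^3 \<le> (real (card ?Z) powr (1/3) * S powr (2/3))^3"
      by (intro power_mono sum_nonneg) auto
    also have "\<dots> = real (card ?Z) * S\<^sup>2"
    proof -
      have "0 < S" unfolding S_def using fin False F by (intro sum_pos) auto
      moreover have "0 < real (card ?Z)" using fin False by (simp only: of_nat_0_less_iff card_gt_0_iff) auto
      ultimately show ?thesis by (simp add: power_mult_distrib powr_power)
    qed
    also have "\<dots> \<le> real (card Y) * S\<^sup>2"
      using fin by (intro mult_right_mono) (auto intro: card_mono)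
    finally show ?thesis .
  qed
  have "S\<^sup>2 = (\<Sum>y\<in>?Z. F y * S)" by (simp add: S_def power2_eq_square sum_distrib_right)
  also have "\<dots> \<le> (\<Sum>y\<in>?Z. \<Sum>z\<in>Y - {y}. F y * F z)"
  proof (rule sum_mono)
    fix y assume y: "y \<in> ?Z"
    have "S = F y + sum F (?Z - {y})" unfolding S_def using fin y by (simp add: sum.remove)
    \<comment> \<open>Exchanging \<open>F y\<close> for the larger \<open>F y0\<close> turns the
      diagonal term of \<open>S * S\<close> into an off-diagonal pair; this is why the largest value
      was removed.\<close>
    also have "\<dots> \<le> F y0 + sum F (?Z - {y})" using le_M y y0 by simp
    also have "\<dots> = sum F (Y - {y})"
    proof -
      have "?Z - {y} = Y - {y} - {y0}" by auto
      moreover have "sum F (Y - {y}) = F y0 + sum F (Y - {y} - {y0})"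
        using fin y y0 by (intro sum.remove) auto
      ultimately show ?thesis by simp
    qed
    finally show "F y * S \<le> (\<Sum>z\<in>Y - {y}. F y * F z)"
      using F[of y] y by (simp add: sum_distrib_left[symmetric])
  qed
  also have "\<dots> \<le> D"
    unfolding D_def using fin F0
    by (intro sum_mono2) (auto intro!: sum_nonneg mult_nonneg_nonneg)
  finally have SD: "S\<^sup>2 \<le> D" .
  have "(\<Sum>y\<in>Y. F y powr (2/3))^3 = (M powr (2/3) + (\<Sum>y\<in>?Z. F y powr (2/3)))^3"
    using fin y0 by (simp add: sum.remove[of Y y0])
  also have "\<dots> \<le> 4 * ((M powr (2/3))^3 + (\<Sum>y\<in>?Z. F y powr (2/3))^3)"
    by (intro add_cube_le sum_nonneg) auto
  also have "(M powr (2/3))^3 = M\<^sup>2" using M by (simp add: powr_power)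
  also have "M\<^sup>2 \<le> (\<Sum>y\<in>Y. (F y)\<^sup>2)"
    using fin y0 by (intro order_trans[OF _ member_le_sum[of y0 Y]]) auto
  also have "(\<Sum>y\<in>?Z. F y powr (2/3))^3 \<le> real (card Y) * D"
    using rest SD by (meson mult_left_mono of_nat_0_le_iff order_trans)
  finally show ?thesis by (simp add: D_def algebra_simps)
qed simp

text \<open>The two regimes \<open>a / 2\<close> and \<open>2 a - 1\<close> come from interpolating the bound
  $L^{3/2} \to L^3$ with $L^\infty \to L^\infty$ and with $L^1 \to L^1$.\<close>

definition gain :: "real \<Rightarrow> real" where
  "gain a = max (a / 2) (2 * a - 1)"

lemma gain_nonneg: "0 \<le> a \<Longrightarrow> 0 \<le> gain a"
  by (simp add: gain_def)

section \<open>Graphs with codegrees at most two, and densities on them\<close>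

locale codegree_graph =
  fixes V :: "'b set" and adj :: "'b \<Rightarrow> 'b \<Rightarrow> bool" and d :: nat
  assumes finite_V: "finite V"
    and adj_sym: "\<lbrakk>x \<in> V; y \<in> V\<rbrakk> \<Longrightarrow> adj x y \<longleftrightarrow> adj y x"
    and adj_irrefl: "x \<in> V \<Longrightarrow> \<not> adj x x"
    and degree: "x \<in> V \<Longrightarrow> card {y\<in>V. adj x y} = d"
    and codegree: "\<lbrakk>x \<in> V; y \<in> V; x \<noteq> y\<rbrakk> \<Longrightarrow> card {z\<in>V. adj x z \<and> adj y z} \<le> 2"
    and degree_pos: "0 < d"
    and card_le_degree: "card V \<le> 9 * d\<^sup>2"
begin

definition nbr :: "'b \<Rightarrow> 'b set" where
  "nbr x = {y\<in>V. adj x y}"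

definition avg :: "('b \<Rightarrow> real) \<Rightarrow> 'b \<Rightarrow> real" where
  "avg f x = (\<Sum>y\<in>nbr x. f y) / real d"

text \<open>Takes the place of |f|^p normalised to mean 1. Strict positivity gives
  \<open>F x powr 0 = 1\<close>, so that p = infinity is the exponent 0 like any other. Mean at most
  1, instead of equal to 1, leaves room for scaling majorants down.\<close>

definition density :: "('b \<Rightarrow> real) \<Rightarrow> bool" where
  "density F \<longleftrightarrow> (\<forall>x\<in>V. 0 < F x) \<and> sum F V \<le> real (card V)"

lemma real_card_le: "real (card V) \<le> 9 * (real d)\<^sup>2"
  using of_nat_mono[OF card_le_degree, where 'a = real] by simp

lemma density_pos: "\<lbrakk>density F; x \<in> V\<rbrakk> \<Longrightarrow> 0 < F x"
  and density_sum: "density F \<Longrightarrow> sum F V \<le> real (card V)"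
  by (auto simp: density_def)

lemma density_nonneg: "\<lbrakk>density F; x \<in> V\<rbrakk> \<Longrightarrow> 0 \<le> F x"
  by (simp add: density_pos less_imp_le)

lemma density_one: "density (\<lambda>_. 1)"
  by (simp add: density_def)

lemma nbr_subset: "nbr x \<subseteq> V"
  by (auto simp: nbr_def)

lemma nbrD: "y \<in> nbr x \<Longrightarrow> y \<in> V"
  by (auto simp: nbr_def)

lemma finite_nbr [simp]: "finite (nbr x)"
  using finite_V nbr_subset by (rule finite_subset[rotated])

lemma card_nbr: "x \<in> V \<Longrightarrow> card (nbr x) = d"
  by (simp add: nbr_def degree)

lemma nbr_nonempty: "x \<in> V \<Longrightarrow> nbr x \<noteq> {}"
  using card_nbr degree_pos by fastforce

lemma card_common_nbr: "\<lbrakk>x \<in> V; y \<in> V; x \<noteq> y\<rbrakk> \<Longrightarrow> card (nbr x \<inter> nbr y) \<le> 2"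
  using codegree[of x y] by (simp add: nbr_def Collect_conj_eq[symmetric] Int_def conj_ac cong: conj_cong)

lemma nbr_irrefl: "x \<in> V \<Longrightarrow> x \<notin> nbr x"
  by (simp add: nbr_def adj_irrefl)

lemma sum_nbr_swap:
  "(\<Sum>x\<in>V. \<Sum>y\<in>nbr x. h x y) = (\<Sum>y\<in>V. \<Sum>x\<in>nbr y. h x y)"
proof -
  have "(\<Sum>x\<in>V. \<Sum>y\<in>nbr x. h x y) = (\<Sum>x\<in>V. \<Sum>y\<in>{y. y \<in> V \<and> adj x y}. h x y)"
    by (simp add: nbr_def)
  also have "\<dots> = (\<Sum>y\<in>V. \<Sum>x\<in>{x. x \<in> V \<and> adj x y}. h x y)"
    using finite_V by (rule sum.swap_restrict[OF finite_V])
  also have "\<dots> = (\<Sum>y\<in>V. \<Sum>x\<in>nbr y. h x y)"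
    by (intro sum.cong refl) (auto simp: nbr_def adj_sym)
  finally show ?thesis .
qed

lemma sum_nbr:
  fixes h :: "'b \<Rightarrow> real"
  shows "(\<Sum>x\<in>V. \<Sum>y\<in>nbr x. h y) = real d * sum h V"
proof -
  have "(\<Sum>x\<in>V. \<Sum>y\<in>nbr x. h y) = (\<Sum>y\<in>V. real d * h y)"
    by (subst sum_nbr_swap) (simp add: card_nbr)
  then show ?thesis by (simp add: sum_distrib_left)
qed

text \<open>Paths x, z, y are counted by their ends instead of their midpoint \<open>z\<close>, and
  distinct ends have at most two common neighbours. The diagonal is left out because equal ends have
  \<open>d\<close> of them.\<close>

lemma sum_nbr_pairs_le:
  fixes F G :: "'b \<Rightarrow> real"
  assumes "density F" "density G"
  shows "(\<Sum>z\<in>V. \<Sum>x\<in>nbr z. \<Sum>y\<in>nbr z - {x}. F x * G y) \<le> 2 * (real (card V))\<^sup>2"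
proof -
  have "(\<Sum>z\<in>V. \<Sum>x\<in>nbr z. \<Sum>y\<in>nbr z - {x}. F x * G y)
      = (\<Sum>x\<in>V. \<Sum>z\<in>nbr x. \<Sum>y\<in>nbr z - {x}. F x * G y)"
    by (rule sum_nbr_swap)
  also have "\<dots> = (\<Sum>x\<in>V. \<Sum>y\<in>V - {x}. \<Sum>z\<in>nbr x \<inter> nbr y. F x * G y)"
  proof (rule sum.cong[OF refl])
    fix x assume x: "x \<in> V"
    have "(\<Sum>z\<in>nbr x. \<Sum>y\<in>nbr z - {x}. F x * G y)
        = (\<Sum>z\<in>nbr x. \<Sum>y\<in>{y. y \<in> V - {x} \<and> z \<in> nbr y}. F x * G y)"
      by (intro sum.cong refl) (auto simp: nbr_def adj_sym)
    also have "\<dots> = (\<Sum>y\<in>V - {x}. \<Sum>z\<in>{z. z \<in> nbr x \<and> z \<in> nbr y}. F x * G y)"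
      using finite_V by (intro sum.swap_restrict) auto
    finally show "(\<Sum>z\<in>nbr x. \<Sum>y\<in>nbr z - {x}. F x * G y)
        = (\<Sum>y\<in>V - {x}. \<Sum>z\<in>nbr x \<inter> nbr y. F x * G y)"
      by (simp add: Int_def)
  qed
  also have "\<dots> \<le> (\<Sum>x\<in>V. \<Sum>y\<in>V - {x}. 2 * (F x * G y))"
  proof (intro sum_mono)
    fix x y assume xy: "x \<in> V" "y \<in> V - {x}"
    then have "real (card (nbr x \<inter> nbr y)) \<le> 2" using card_common_nbr[of x y] by auto
    then show "(\<Sum>z\<in>nbr x \<inter> nbr y. F x * G y) \<le> 2 * (F x * G y)"
      using xy assms by (auto intro!: mult_right_mono mult_nonneg_nonneg simp: density_nonneg)
  qed
  also have "\<dots> \<le> (\<Sum>x\<in>V. \<Sum>y\<in>V. 2 * (F x * G y))"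
    using finite_V assms
    by (intro sum_mono sum_mono2) (auto intro!: mult_nonneg_nonneg simp: density_nonneg)
  also have "\<dots> = 2 * (sum F V * sum G V)"
    by (subst sum_product) (simp only: sum_distrib_left)
  also have "\<dots> \<le> 2 * (real (card V) * real (card V))"
    using assms density_nonneg
    by (intro mult_left_mono mult_mono density_sum sum_nonneg) auto
  finally show ?thesis by (simp add: power2_eq_square)
qed

lemma sum_square_density_le:
  assumes "density F"
  shows "(\<Sum>x\<in>V. (F x)\<^sup>2) \<le> (real (card V))\<^sup>2"
proof -
  have "(\<Sum>x\<in>V. (F x)\<^sup>2) \<le> (\<Sum>x\<in>V. F x * sum F V)"
    unfolding power2_eq_square using assms finite_V density_nonneg
    by (intro sum_mono mult_left_mono member_le_sum) auto
  also have "\<dots> = (sum F V)\<^sup>2" by (simp add: sum_distrib_right power2_eq_square)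
  also have "\<dots> \<le> (real (card V))\<^sup>2"
    using assms density_nonneg by (intro power_mono density_sum sum_nonneg) auto
  finally show ?thesis .
qed

section \<open>The averaging operator and pointwise interpolation\<close>

lemma avg_pos:
  assumes "\<And>y. y \<in> V \<Longrightarrow> 0 < f y" "x \<in> V"
  shows "0 < avg f x"
  unfolding avg_def using assms nbr_nonempty[of x] degree_pos
  by (intro divide_pos_pos sum_pos) (auto simp: nbrD)

lemma avg_mono:
  assumes "\<And>y. y \<in> V \<Longrightarrow> f y \<le> g y"
  shows "avg f x \<le> avg g x"
  unfolding avg_def using assms by (intro divide_right_mono sum_mono) (auto simp: nbrD)

lemma avg_cmult: "avg (\<lambda>y. c * f y) x = c * avg f x"
  by (simp add: avg_def sum_distrib_left)

lemma avg_one: "x \<in> V \<Longrightarrow> avg (\<lambda>_. 1) x = 1"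
  using degree_pos by (simp add: avg_def card_nbr)

lemma density_avg:
  assumes "density F"
  shows "density (avg F)"
proof -
  have "sum (avg F) V = sum F V"
    using sum_nbr[of F] degree_pos by (simp add: avg_def sum_divide_distrib[symmetric])
  then show ?thesis using assms by (auto simp: density_def intro: avg_pos)
qed

lemma density_mix:
  assumes "density F" "density G" "0 \<le> \<theta>" "\<theta> \<le> 1"
  shows "density (\<lambda>x. (1 - \<theta>) * F x + \<theta> * G x)"
proof -
  have "0 < (1 - \<theta>) * F x + \<theta> * G x" if "x \<in> V" for x
  proof (cases "\<theta> = 1")
    case False
    then have "0 < (1 - \<theta>) * F x" using assms that by (simp add: density_pos)
    moreover have "0 \<le> \<theta> * G x" using assms that by (simp add: density_nonneg)
    ultimately show ?thesis by linarith
  qed (use assms that in \<open>simp add: density_pos\<close>)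
  moreover have "(\<Sum>x\<in>V. (1 - \<theta>) * F x + \<theta> * G x)
      \<le> (1 - \<theta>) * real (card V) + \<theta> * real (card V)"
    unfolding sum.distrib sum_distrib_left[symmetric] using assms
    by (intro add_mono mult_left_mono density_sum) auto
  ultimately show ?thesis by (simp add: density_def algebra_simps)
qed

text \<open>Hoelder's inequality for products in pointwise form: with \<theta> = \<beta> / (\<alpha>
  + \<beta>) the geometric mean F^(1 - \<theta>) G^\<theta> lies below the mixture (1 - \<theta>) F
  + \<theta> G, which is again a density.\<close>

lemma powr_mult_le_density:
  assumes "density F" "density G" "0 \<le> \<alpha>" "0 \<le> \<beta>"
  obtains H where "density H"
    "\<And>x. x \<in> V \<Longrightarrow> F x powr \<alpha> * G x powr \<beta> \<le> H x powr (\<alpha> + \<beta>)"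
proof (cases "\<alpha> + \<beta> = 0")
  case True
  then have "\<alpha> = 0" "\<beta> = 0" using assms by auto
  then show ?thesis using assms by (intro that[of F]) (auto simp: density_pos)
next
  case False
  then have s: "0 < \<alpha> + \<beta>" using assms by linarith
  define \<theta> where "\<theta> = \<beta> / (\<alpha> + \<beta>)"
  have th: "0 \<le> \<theta>" "\<theta> \<le> 1" using s assms by (auto simp: \<theta>_def)
  have ab: "\<alpha> = (1 - \<theta>) * (\<alpha> + \<beta>)" "\<beta> = \<theta> * (\<alpha> + \<beta>)"
    using s by (simp_all add: \<theta>_def field_simps)
  show ?thesis
  proof (rule that[OF density_mix[OF assms(1,2) th]])
    fix x assume x: "x \<in> V"
    have "F x powr \<alpha> * G x powr \<beta> = (F x powr (1 - \<theta>) * G x powr \<theta>) powr (\<alpha> + \<beta>)"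
      using assms x by (simp add: powr_mult powr_powr ab[symmetric])
    also have "\<dots> \<le> ((1 - \<theta>) * F x + \<theta> * G x) powr (\<alpha> + \<beta>)"
      using assms x th s by (intro powr_mono2 weighted_am_gm) (auto simp: density_nonneg)
    finally show "F x powr \<alpha> * G x powr \<beta> \<le> ((1 - \<theta>) * F x + \<theta> * G x) powr (\<alpha> + \<beta>)" .
  qed
qed

text \<open>Jensen's inequality: \<open>F powr \<alpha>\<close> lies below the mixture of the
  densities 1 and \<open>F\<close> with weights 1 - \<alpha> and \<alpha>.\<close>

lemma sum_powr_le_card:
  assumes "density F" "0 \<le> \<alpha>" "\<alpha> \<le> 1"
  shows "(\<Sum>x\<in>V. F x powr \<alpha>) \<le> real (card V)"
proof -
  have "F x powr \<alpha> \<le> (1 - \<alpha>) * 1 + \<alpha> * F x" if "x \<in> V" for x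
    using weighted_am_gm[of \<alpha> 1 "F x"] assms that by (simp add: density_nonneg)
  then have "(\<Sum>x\<in>V. F x powr \<alpha>) \<le> (\<Sum>x\<in>V. (1 - \<alpha>) * 1 + \<alpha> * F x)" by (rule sum_mono)
  also have "\<dots> \<le> real (card V)"
    using density_sum[OF density_mix[OF density_one assms]] by simp
  finally show ?thesis .
qed

lemma avg_log_convex:
  assumes "density F" "0 \<le> \<theta>" "\<theta> \<le> 1" "x \<in> V"
  shows "avg (\<lambda>y. F y powr ((1 - \<theta>) * \<alpha> + \<theta> * \<beta>)) x
      \<le> avg (\<lambda>y. F y powr \<alpha>) x powr (1 - \<theta>) * avg (\<lambda>y. F y powr \<beta>) x powr \<theta>"
proof -
  let ?u = "\<lambda>y. F y powr \<alpha>" and ?v = "\<lambda>y. F y powr \<beta>"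
  have "(\<Sum>y\<in>nbr x. F y powr ((1 - \<theta>) * \<alpha> + \<theta> * \<beta>))
      = (\<Sum>y\<in>nbr x. ?u y powr (1 - \<theta>) * ?v y powr \<theta>)"
    by (simp add: powr_powr powr_add mult.commute)
  also have "\<dots> \<le> sum ?u (nbr x) powr (1 - \<theta>) * sum ?v (nbr x) powr \<theta>"
    using assms nbr_nonempty by (intro sum_powr_log_convex) (auto dest!: nbrD simp: density_pos less_imp_neq[symmetric] order.strict_implies_not_eq)
  finally have "avg (\<lambda>y. F y powr ((1 - \<theta>) * \<alpha> + \<theta> * \<beta>)) x
      \<le> sum ?u (nbr x) powr (1 - \<theta>) * sum ?v (nbr x) powr \<theta> / real d"
    unfolding avg_def by (intro divide_right_mono) auto
  also have "\<dots> = avg ?u x powr (1 - \<theta>) * avg ?v x powr \<theta>"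
    using degree_pos by (simp add: avg_def powr_divide sum_nonneg powr_add[symmetric])
  finally show ?thesis .
qed

text \<open>The estimate \<open>L^(3/2) -> L^3\<close> for f = F^(2/3). With N =
  \<open>card V\<close>, the diagonal terms contribute 4 d N^2 and the off-diagonal ones 8 d N^2;
  division by d^3 and N <= 9 d^2 leave 12 * 9 = 108 times N.\<close>

lemma sum_cube_avg_le:
  assumes F: "density F"
  shows "(\<Sum>x\<in>V. (avg (\<lambda>y. F y powr (2/3)) x)^3) \<le> 108 * real (card V)"
proof -
  let ?N = "real (card V)" and ?D = "\<lambda>x. \<Sum>y\<in>nbr x. \<Sum>z\<in>nbr x - {y}. F y * F z"
  have "(\<Sum>x\<in>V. (avg (\<lambda>y. F y powr (2/3)) x)^3)
      = (\<Sum>x\<in>V. (\<Sum>y\<in>nbr x. F y powr (2/3))^3) / real d ^ 3"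
    by (simp add: avg_def power_divide flip: sum_divide_distrib)
  also have "(\<Sum>x\<in>V. (\<Sum>y\<in>nbr x. F y powr (2/3))^3)
      \<le> (\<Sum>x\<in>V. 4 * (\<Sum>y\<in>nbr x. (F y)\<^sup>2) + 4 * real d * ?D x)"
  proof (rule sum_mono)
    fix x assume x: "x \<in> V"
    show "(\<Sum>y\<in>nbr x. F y powr (2/3))^3 \<le> 4 * (\<Sum>y\<in>nbr x. (F y)\<^sup>2) + 4 * real d * ?D x"
      using cube_sum_powr_le[of "nbr x" F] density_pos[OF F nbrD] card_nbr[OF x] by auto
  qed
  also have "\<dots> = 4 * (real d * (\<Sum>x\<in>V. (F x)\<^sup>2)) + 4 * real d * (\<Sum>x\<in>V. ?D x)"
    by (simp only: sum.distrib sum_distrib_left[symmetric] sum_nbr)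
  also have "\<dots> \<le> 4 * (real d * ?N\<^sup>2) + 4 * real d * (2 * ?N\<^sup>2)"
    by (intro add_mono mult_left_mono sum_square_density_le sum_nbr_pairs_le F) auto
  also have "\<dots> = 12 * real d * ?N * ?N" by (simp add: power2_eq_square)
  also have "\<dots> \<le> 12 * real d * ?N * (9 * (real d)\<^sup>2)"
    by (intro mult_left_mono real_card_le) auto
  also have "\<dots> = 108 * ?N * real d ^ 3" by (simp add: power2_eq_square power3_eq_cube)
  finally show ?thesis using degree_pos by (simp add: divide_right_mono pos_divide_le_eq)
qed

text \<open>The majorant is a power of a density rather than a norm, so that it can be multiplied
  with others and averaged again. Log-convexity connects the three exponents whose majorant is
  known: 0, where the average is 1; 2/3, where it is 5 G^(1/3); and 1, where \<open>avg F\<close> is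
  itself a density.\<close>

lemma avg_powr_le_density:
  assumes F: "density F" and a: "0 \<le> a" "a \<le> 1"
  obtains G where "density G"
    "\<And>x. x \<in> V \<Longrightarrow> avg (\<lambda>y. F y powr a) x \<le> 5 * G x powr gain a"
proof -
  let ?A = "avg (\<lambda>y. F y powr (2/3))"
  \<comment> \<open>Since 5^3 = 125 exceeds the constant 108 of \<open>sum_cube_avg_le\<close>,
    \<open>G\<close> has mean at most 1.\<close>
  define G where "G x = (?A x / 5)^3" for x
  have A: "0 < ?A x" if "x \<in> V" for x
    using F that by (intro avg_pos) (auto simp: density_pos less_imp_neq[symmetric] order.strict_implies_not_eq)
  have "sum G V = (\<Sum>x\<in>V. (?A x)^3) / 125" by (simp add: G_def power_divide sum_divide_distrib)
  also have "\<dots> \<le> 108 * real (card V) / 125"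
    using sum_cube_avg_le[OF F] by (intro divide_right_mono) auto
  also have "\<dots> \<le> real (card V)" by simp
  finally have G: "density G" using A by (auto simp: density_def G_def)
  have AG: "?A x = 5 * G x powr (1/3)" if "x \<in> V" for x
    using A[OF that] by (simp add: G_def powr_powr powr_numeral[symmetric] del: powr_numeral)
  have five: "5 powr s \<le> (5::real)" if "s \<le> 1" for s
    using powr_mono[OF that, of "5::real"] by simp
  show ?thesis
  proof (cases "a \<le> 2/3")
    case True
    define \<theta> where "\<theta> = 3 * a / 2"
    have th: "0 \<le> \<theta>" "\<theta> \<le> 1" "a = (1 - \<theta>) * 0 + \<theta> * (2/3)" using True a by (auto simp: \<theta>_def)
    have g: "gain a = a / 2" using True by (simp add: gain_def)
    show ?thesis
    proof (rule that[OF G])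
      fix x assume x: "x \<in> V"
      \<comment> \<open>Densities are positive, so the exponent 0 really gives the constant 1 here,
        and not \<open>0 powr 0 = 0\<close>.\<close>
      have "avg (\<lambda>y. F y powr 0) x = avg (\<lambda>_. 1) x"
        unfolding avg_def using F by (intro arg_cong2[where f = "(/)"] sum.cong) (auto dest!: nbrD density_pos)
      then have "avg (\<lambda>y. F y powr a) x \<le> ?A x powr \<theta>"
        using avg_log_convex[OF F th(1,2) x, of 0 "2/3", folded th(3)] x by (simp only: avg_one) simp
      also have "\<dots> = 5 powr \<theta> * G x powr gain a"
        using AG[OF x] density_pos[OF G x] by (simp add: powr_mult powr_powr \<theta>_def g)
      also have "\<dots> \<le> 5 * G x powr gain a" using th by (intro mult_right_mono five) auto
      finally show "avg (\<lambda>y. F y powr a) x \<le> 5 * G x powr gain a" .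
    qed
  next
    case False
    define \<theta> where "\<theta> = 3 * a - 2"
    have th: "0 \<le> \<theta>" "\<theta> \<le> 1" "a = (1 - \<theta>) * (2/3) + \<theta> * 1"
      using False a by (auto simp: \<theta>_def algebra_simps)
    have g: "gain a = (1 - \<theta>) / 3 + \<theta>" using False by (simp add: gain_def \<theta>_def field_simps)
    obtain H where H: "density H"
      "\<And>x. x \<in> V \<Longrightarrow> G x powr ((1 - \<theta>) / 3) * avg F x powr \<theta> \<le> H x powr gain a"
      using powr_mult_le_density[OF G density_avg[OF F], of "(1 - \<theta>) / 3" \<theta>] th unfolding g by auto
    show ?thesis
    proof (rule that[OF H(1)])
      fix x assume x: "x \<in> V"
      have "avg (\<lambda>y. F y powr 1) x = avg F x"
        unfolding avg_def using F by (intro arg_cong2[where f = "(/)"] sum.cong) (auto dest!: nbrD simp: density_nonneg)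
      then have "avg (\<lambda>y. F y powr a) x \<le> ?A x powr (1 - \<theta>) * avg F x powr \<theta>"
        using avg_log_convex[OF F th(1,2) x, of "2/3" 1] th(3) by simp
      also have "\<dots> = 5 powr (1 - \<theta>) * (G x powr ((1 - \<theta>) / 3) * avg F x powr \<theta>)"
        using AG[OF x] density_pos[OF G x] by (simp add: powr_mult powr_powr)
      also have "\<dots> \<le> 5 * H x powr gain a"
        using th by (intro mult_mono five H x) auto
      finally show "avg (\<lambda>y. F y powr a) x \<le> 5 * H x powr gain a" .
    qed
  qed
qed

section \<open>Forms on trees\<close>

lemma sum_powr_mult_le_card:
  assumes "density F" "density G" "density H" "0 \<le> \<alpha>" "0 \<le> \<beta>" "0 \<le> \<gamma>" "\<alpha> + \<beta> + \<gamma> \<le> 1"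
  shows "(\<Sum>x\<in>V. F x powr \<alpha> * G x powr \<beta> * H x powr \<gamma>) \<le> real (card V)"
proof -
  obtain K where K: "density K" "\<And>x. x \<in> V \<Longrightarrow> F x powr \<alpha> * G x powr \<beta> \<le> K x powr (\<alpha> + \<beta>)"
    using powr_mult_le_density[of F G \<alpha> \<beta>] assms by blast
  obtain L where L: "density L"
    "\<And>x. x \<in> V \<Longrightarrow> K x powr (\<alpha> + \<beta>) * H x powr \<gamma> \<le> L x powr (\<alpha> + \<beta> + \<gamma>)"
    using powr_mult_le_density[of K H "\<alpha> + \<beta>" \<gamma>] assms K(1) by (metis add_nonneg_nonneg)
  have "(\<Sum>x\<in>V. F x powr \<alpha> * G x powr \<beta> * H x powr \<gamma>) \<le> (\<Sum>x\<in>V. L x powr (\<alpha> + \<beta> + \<gamma>))"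
    using K(2) L(2) by (intro sum_mono) (meson mult_right_mono order_trans powr_ge_zero)
  also have "\<dots> \<le> real (card V)" using L(1) assms by (intro sum_powr_le_card) auto
  finally show ?thesis .
qed

lemma avg_nonneg: "(\<And>y. y \<in> V \<Longrightarrow> 0 \<le> f y) \<Longrightarrow> 0 \<le> avg f x"
  unfolding avg_def by (intro divide_nonneg_nonneg sum_nonneg) (auto dest: nbrD)

text \<open>Both ends are averaged onto the middle vertex, where the three exponents add up; each
  average costs a factor 5.\<close>

lemma path2_bound:
  assumes F: "density F1" "density F2" "density F3"
    and a: "0 \<le> a1" "a1 \<le> 1" "0 \<le> a2" "0 \<le> a3" "a3 \<le> 1"
    and le: "a2 + gain a1 + gain a3 \<le> 1"
  shows "(\<Sum>x\<in>V. F2 x powr a2 * avg (\<lambda>y. F1 y powr a1) x * avg (\<lambda>y. F3 y powr a3) x)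
      \<le> 25 * real (card V)"
proof -
  obtain G1 where G1: "density G1"
    "\<And>x. x \<in> V \<Longrightarrow> avg (\<lambda>y. F1 y powr a1) x \<le> 5 * G1 x powr gain a1"
    using avg_powr_le_density F a by blast
  obtain G3 where G3: "density G3"
    "\<And>x. x \<in> V \<Longrightarrow> avg (\<lambda>y. F3 y powr a3) x \<le> 5 * G3 x powr gain a3"
    using avg_powr_le_density F a by blast
  have "(\<Sum>x\<in>V. F2 x powr a2 * avg (\<lambda>y. F1 y powr a1) x * avg (\<lambda>y. F3 y powr a3) x)
      \<le> (\<Sum>x\<in>V. F2 x powr a2 * (5 * G1 x powr gain a1) * (5 * G3 x powr gain a3))"
    by (intro sum_mono mult_mono G1 G3 avg_nonneg mult_nonneg_nonneg) auto
  also have "\<dots> = 25 * (\<Sum>x\<in>V. F2 x powr a2 * G1 x powr gain a1 * G3 x powr gain a3)"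
    by (simp add: sum_distrib_left mult_ac)
  also have "\<dots> \<le> 25 * real (card V)"
    using F G1(1) G3(1) a le by (intro mult_left_mono sum_powr_mult_le_card gain_nonneg) auto
  finally show ?thesis .
qed

lemma star_bound:
  assumes F: "density F1" "density F2" "density F3" "density F4"
    and a: "0 \<le> a1" "a1 \<le> 1" "0 \<le> a2" "a2 \<le> 1" "0 \<le> a3" "0 \<le> a4" "a4 \<le> 1"
    and le: "a3 + gain a1 + gain a2 + gain a4 \<le> 1"
  shows "(\<Sum>x\<in>V. F3 x powr a3 * avg (\<lambda>y. F1 y powr a1) x * avg (\<lambda>y. F2 y powr a2) x
            * avg (\<lambda>y. F4 y powr a4) x) \<le> 125 * real (card V)"
proof -
  obtain G1 where G1: "density G1"
    "\<And>x. x \<in> V \<Longrightarrow> avg (\<lambda>y. F1 y powr a1) x \<le> 5 * G1 x powr gain a1"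
    using avg_powr_le_density F a by blast
  obtain G2 where G2: "density G2"
    "\<And>x. x \<in> V \<Longrightarrow> avg (\<lambda>y. F2 y powr a2) x \<le> 5 * G2 x powr gain a2"
    using avg_powr_le_density F a by blast
  obtain G4 where G4: "density G4"
    "\<And>x. x \<in> V \<Longrightarrow> avg (\<lambda>y. F4 y powr a4) x \<le> 5 * G4 x powr gain a4"
    using avg_powr_le_density F a by blast
  \<comment> \<open>Two leaves are merged into one density to fit the three factors of
    \<open>sum_powr_mult_le_card\<close>.\<close>
  obtain H where H: "density H"
    "\<And>x. x \<in> V \<Longrightarrow> G1 x powr gain a1 * G2 x powr gain a2 \<le> H x powr (gain a1 + gain a2)"
    using powr_mult_le_density[OF G1(1) G2(1)] gain_nonneg a by metis
  have "(\<Sum>x\<in>V. F3 x powr a3 * avg (\<lambda>y. F1 y powr a1) x * avg (\<lambda>y. F2 y powr a2) x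
            * avg (\<lambda>y. F4 y powr a4) x)
      \<le> (\<Sum>x\<in>V. F3 x powr a3 * (5 * G1 x powr gain a1) * (5 * G2 x powr gain a2)
            * (5 * G4 x powr gain a4))"
    by (intro sum_mono mult_mono G1 G2 G4 avg_nonneg mult_nonneg_nonneg) auto
  also have "\<dots> = (\<Sum>x\<in>V. 125 * (F3 x powr a3 * (G1 x powr gain a1 * G2 x powr gain a2)
            * G4 x powr gain a4))"
    by (intro sum.cong refl) (simp add: mult_ac)
  also have "\<dots> \<le> (\<Sum>x\<in>V. 125 * (F3 x powr a3 * H x powr (gain a1 + gain a2) * G4 x powr gain a4))"
    by (intro sum_mono mult_left_mono mult_right_mono H) auto
  also have "\<dots> = 125 * (\<Sum>x\<in>V. F3 x powr a3 * H x powr (gain a1 + gain a2) * G4 x powr gain a4)"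
    by (simp add: sum_distrib_left)
  also have "\<dots> \<le> 125 * real (card V)"
    using F H(1) G4(1) a le
    by (intro mult_left_mono sum_powr_mult_le_card) (auto intro!: gain_nonneg add_nonneg_nonneg)
  finally show ?thesis .
qed

text \<open>Pruning: a leaf of exponent \<open>b\<close> attached to a vertex of exponent
  \<open>a\<close> is absorbed there, raising the exponent to \<open>a + gain b\<close>. This
  reduces \<open>P3\<close> to \<open>P2\<close> and the triangle with a tail to the
  triangle.\<close>

lemma powr_mult_avg_le_density:
  assumes F: "density F" "density G" and a: "0 \<le> a" "0 \<le> b" "b \<le> 1"
  obtains H where "density H"
    "\<And>x. x \<in> V \<Longrightarrow> F x powr a * avg (\<lambda>y. G y powr b) x \<le> 5 * H x powr (a + gain b)"
proof -
  obtain K where K: "density K"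
    "\<And>x. x \<in> V \<Longrightarrow> avg (\<lambda>y. G y powr b) x \<le> 5 * K x powr gain b"
    using avg_powr_le_density F a by blast
  obtain H where H: "density H"
    "\<And>x. x \<in> V \<Longrightarrow> F x powr a * K x powr gain b \<le> H x powr (a + gain b)"
    using powr_mult_le_density[OF F(1) K(1)] gain_nonneg a by metis
  show ?thesis
  proof (rule that[OF H(1)])
    fix x assume x: "x \<in> V"
    have "F x powr a * avg (\<lambda>y. G y powr b) x \<le> F x powr a * (5 * K x powr gain b)"
      by (intro mult_left_mono K x) auto
    also have "\<dots> \<le> 5 * H x powr (a + gain b)" using H(2)[OF x] by simp
    finally show "F x powr a * avg (\<lambda>y. G y powr b) x \<le> 5 * H x powr (a + gain b)" .
  qed
qed

text \<open>Once vertex 4 is pruned, vertex 3 is the end of a two-edge path and has exponent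
  \<open>a3 + gain a4\<close>; the first inequality keeps that exponent within [0, 1], the range of
  the averaging estimate.\<close>

lemma path3_bound:
  assumes F: "density F1" "density F2" "density F3" "density F4"
    and a: "0 \<le> a1" "a1 \<le> 1" "0 \<le> a2" "0 \<le> a3" "0 \<le> a4" "a4 \<le> 1"
    and le: "a3 + gain a4 \<le> 1" "a2 + gain a1 + gain (a3 + gain a4) \<le> 1"
  shows "(\<Sum>x\<in>V. F2 x powr a2 * avg (\<lambda>y. F1 y powr a1) x
            * avg (\<lambda>y. F3 y powr a3 * avg (\<lambda>z. F4 z powr a4) y) x) \<le> 125 * real (card V)"
proof -
  obtain H where H: "density H"
    "\<And>x. x \<in> V \<Longrightarrow> F3 x powr a3 * avg (\<lambda>z. F4 z powr a4) x \<le> 5 * H x powr (a3 + gain a4)"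
    using powr_mult_avg_le_density F a by blast
  have "(\<Sum>x\<in>V. F2 x powr a2 * avg (\<lambda>y. F1 y powr a1) x
            * avg (\<lambda>y. F3 y powr a3 * avg (\<lambda>z. F4 z powr a4) y) x)
      \<le> (\<Sum>x\<in>V. F2 x powr a2 * avg (\<lambda>y. F1 y powr a1) x
            * avg (\<lambda>y. 5 * H y powr (a3 + gain a4)) x)"
    by (intro sum_mono mult_left_mono avg_mono H mult_nonneg_nonneg avg_nonneg) auto
  also have "\<dots> = 5 * (\<Sum>x\<in>V. F2 x powr a2 * avg (\<lambda>y. F1 y powr a1) x
            * avg (\<lambda>y. H y powr (a3 + gain a4)) x)"
    by (simp add: avg_cmult sum_distrib_left mult_ac)
  also have "\<dots> \<le> 5 * (25 * real (card V))"
    using F H(1) a le by (intro mult_left_mono path2_bound) (auto simp: gain_nonneg)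
  finally show ?thesis by simp
qed

section \<open>Sums over triangles\<close>

text \<open>Triangles are ordered. Every edge lies in at most two of them, so there are at most 2 d
  N, N being \<open>card V\<close>; d N is the scale of all bounds for these sums.\<close>

definition triangle_sum :: "('b \<Rightarrow> 'b \<Rightarrow> 'b \<Rightarrow> real) \<Rightarrow> real" where
  "triangle_sum h = (\<Sum>z\<in>V. \<Sum>x\<in>nbr z. \<Sum>y\<in>nbr z \<inter> nbr x. h z x y)"

lemma triangle_sum_inner_swap:
  assumes "z \<in> V"
  shows "(\<Sum>x\<in>nbr z. \<Sum>y\<in>nbr z \<inter> nbr x. h x y) = (\<Sum>y\<in>nbr z. \<Sum>x\<in>nbr z \<inter> nbr y. h x y)"
proof -
  have "(\<Sum>x\<in>nbr z. \<Sum>y\<in>{y. y \<in> nbr z \<and> y \<in> nbr x}. h x y)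
      = (\<Sum>y\<in>nbr z. \<Sum>x\<in>{x. x \<in> nbr z \<and> y \<in> nbr x}. h x y)"
    by (rule sum.swap_restrict) auto
  moreover have "{x. x \<in> nbr z \<and> y \<in> nbr x} = nbr z \<inter> nbr y" if "y \<in> nbr z" for y
    using that by (auto simp: nbr_def adj_sym)
  ultimately show ?thesis by (simp add: Int_def)
qed

lemma triangle_sum_swap23: "triangle_sum h = triangle_sum (\<lambda>z x y. h z y x)"
  unfolding triangle_sum_def by (rule sum.cong[OF refl]) (rule triangle_sum_inner_swap)

lemma triangle_sum_swap12: "triangle_sum h = triangle_sum (\<lambda>z x y. h x z y)"
  unfolding triangle_sum_def by (subst sum_nbr_swap) (simp add: Int_commute)

lemma triangle_sum_mono:
  assumes "\<And>z x y. \<lbrakk>z \<in> V; x \<in> V; y \<in> V\<rbrakk> \<Longrightarrow> h z x y \<le> k z x y"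
  shows "triangle_sum h \<le> triangle_sum k"
  unfolding triangle_sum_def using assms by (intro sum_mono) (auto dest: nbrD)

lemma card_triangles: "\<lbrakk>z \<in> V; x \<in> nbr z\<rbrakk> \<Longrightarrow> card (nbr z \<inter> nbr x) \<le> 2"
  using nbr_irrefl by (intro card_common_nbr) (auto dest: nbrD)

lemma triangle_sum_two_le:
  assumes "\<And>z x. \<lbrakk>z \<in> V; x \<in> V\<rbrakk> \<Longrightarrow> 0 \<le> h z x"
  shows "triangle_sum (\<lambda>z x y. h z x) \<le> 2 * (\<Sum>z\<in>V. \<Sum>x\<in>nbr z. h z x)"
proof -
  have "real (card (nbr z \<inter> nbr x)) * h z x \<le> 2 * h z x" if "z \<in> V" "x \<in> nbr z" for z x
    using card_triangles[OF that] assms[of z x] that by (intro mult_right_mono) (auto dest: nbrD)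
  then show ?thesis
    unfolding triangle_sum_def sum_distrib_left by (auto intro!: sum_mono)
qed

lemma triangle_sum_one_le:
  assumes "density F"
  shows "triangle_sum (\<lambda>z x y. F z) \<le> 2 * real d * real (card V)"
proof -
  have "triangle_sum (\<lambda>z x y. F z) \<le> 2 * (\<Sum>z\<in>V. \<Sum>x\<in>nbr z. F z)"
    using assms by (intro triangle_sum_two_le) (auto simp: density_nonneg)
  also have "(\<Sum>z\<in>V. \<Sum>x\<in>nbr z. F z) = real d * sum F V" by (subst sum_nbr_swap) (rule sum_nbr)
  also have "2 * (real d * sum F V) \<le> 2 * (real d * real (card V))"
    using assms by (intro mult_left_mono density_sum) auto
  finally show ?thesis by simp
qed

text \<open>Dropping the third vertex costs a factor 2 and leaves an edge, seen as a path with a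
  constant third function. The exponents are critical there, as 2/3 + gain (2/3) = 1.\<close>

lemma triangle_sum_pair_le:
  assumes "density F" "density G"
  shows "triangle_sum (\<lambda>z x y. F z powr (2/3) * G x powr (2/3)) \<le> 50 * real d * real (card V)"
proof -
  have "triangle_sum (\<lambda>z x y. F z powr (2/3) * G x powr (2/3))
      \<le> 2 * (\<Sum>z\<in>V. \<Sum>x\<in>nbr z. F z powr (2/3) * G x powr (2/3))"
    by (intro triangle_sum_two_le) auto
  also have "(\<Sum>z\<in>V. \<Sum>x\<in>nbr z. F z powr (2/3) * G x powr (2/3))
      = (\<Sum>z\<in>V. real d * (F z powr (2/3) * avg (\<lambda>y. G y powr (2/3)) z * avg (\<lambda>_. 1) z))"
    using degree_pos by (intro sum.cong refl) (simp add: avg_one, simp add: avg_def flip: sum_distrib_left)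
  also have "\<dots> = real d * (\<Sum>z\<in>V. F z powr (2/3) * avg (\<lambda>y. G y powr (2/3)) z * avg (\<lambda>_. 1 powr 0) z)"
    by (simp add: sum_distrib_left)
  also have "\<dots> \<le> real d * (25 * real (card V))"
    using assms by (intro mult_left_mono path2_bound density_one) (auto simp: gain_def)
  finally show ?thesis by simp
qed

text \<open>Pairing each edge of the neighbourhood of \<open>z\<close> with another one, the product of the four values
  is split by AM-GM between the endpoints of two different edges, unless these coincide.\<close>

lemma square_sum_nbr_edges_le:
  fixes f g :: "'b \<Rightarrow> real"
  assumes z: "z \<in> V" and f: "\<And>x. x \<in> V \<Longrightarrow> 0 \<le> f x" and g: "\<And>x. x \<in> V \<Longrightarrow> 0 \<le> g x"
  shows "(\<Sum>x\<in>nbr z. \<Sum>y\<in>nbr z \<inter> nbr x. f x * g y)\<^sup>2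
      \<le> 8 * (\<Sum>x\<in>nbr z. \<Sum>y\<in>nbr z - {x}. (f x)\<^sup>2 * (g y)\<^sup>2)"
proof -
  let ?Y = "nbr z" and ?N = "\<lambda>x. nbr z \<inter> nbr x"
  define L where "L h = (\<Sum>x\<in>?Y. \<Sum>y\<in>?N x. h x y)" for h :: "'b \<Rightarrow> 'b \<Rightarrow> real"
  define w where "w x y = (f x)\<^sup>2 * (g y)\<^sup>2" for x y
  define B where "B = (\<Sum>x\<in>?Y. \<Sum>y\<in>?Y - {x}. w x y)"
  \<comment> \<open>The crossed term \<open>w x y'\<close> with x = y' would be diagonal, and
    \<open>B\<close> contains no diagonal terms; in that case the two edges keep their own
    endpoints, which are distinct.\<close>
  define k where "k x y x' y' = (if x \<noteq> y' then w x y' else w x y + w x' y')" for x y x' y'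
  have w0: "0 \<le> w x y" for x y by (simp add: w_def)
  have swap: "L h = L (\<lambda>x y. h y x)" for h
    unfolding L_def using z by (rule triangle_sum_inner_swap)
  have mono: "L h \<le> L h'" if "\<And>x y. h x y \<le> h' x y" for h h'
    unfolding L_def using that by (intro sum_mono)
  have add: "L (\<lambda>x y. h x y + h' x y) = L h + L h'" for h h'
    by (simp add: L_def sum.distrib)
  have fst_le: "L (\<lambda>x y. \<phi> x) \<le> 2 * sum \<phi> ?Y" if "\<And>x. 0 \<le> \<phi> x" for \<phi>
  proof -
    have "real (card (?N x)) * \<phi> x \<le> 2 * \<phi> x" if "x \<in> ?Y" for x
      using card_triangles[OF z that] \<open>0 \<le> \<phi> x\<close> by (intro mult_right_mono) auto
    then show ?thesis by (auto simp: L_def sum_distrib_left intro: sum_mono)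
  qed
  have L_commute: "L (\<lambda>x y. L (\<lambda>x' y'. h x y x' y')) = L (\<lambda>x' y'. L (\<lambda>x y. h x y x' y'))" for h
  proof -
    have L: "L h = (\<Sum>(x, y)\<in>Sigma ?Y ?N. h x y)" for h
      unfolding L_def by (rule sum.Sigma) auto
    show ?thesis unfolding L
      using sum.swap[of "\<lambda>e e'. h (fst e) (snd e) (fst e') (snd e')" "Sigma ?Y ?N" "Sigma ?Y ?N"]
      by (simp add: case_prod_unfold)
  qed
  have edges: "L w \<le> B"
    unfolding L_def B_def using w0 z
    by (intro sum_mono sum_mono2) (auto dest: nbr_irrefl nbrD)
  have ind_le: "L (\<lambda>x y. if c = x then u else 0) \<le> 2 * u" if "0 \<le> u" for c u
  proof -
    have "L (\<lambda>x y. if c = x then u else 0) \<le> 2 * (\<Sum>x\<in>?Y. if c = x then u else 0)"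
      using that by (intro fst_le) auto
    also have "\<dots> \<le> 2 * u" using that by (simp add: sum.delta)
    finally show ?thesis .
  qed
  have point: "(f x' * g y') * (f x * g y) \<le> (k x y x' y' + k x' y' x y) / 2" for x y x' y'
  proof (cases "x \<noteq> y' \<and> x' \<noteq> y")
    case True
    have "0 \<le> (f x * g y' - f x' * g y)\<^sup>2" by simp
    then show ?thesis using True
      by (simp add: k_def w_def power2_eq_square algebra_simps)
  next
    case False
    have "0 \<le> (f x * g y - f x' * g y')\<^sup>2" by simp
    then have "(f x' * g y') * (f x * g y) \<le> (w x y + w x' y') / 2"
      by (simp add: w_def power2_eq_square algebra_simps)
    also have "\<dots> \<le> (k x y x' y' + k x' y' x y) / 2"
      using False w0 by (intro divide_right_mono) (auto simp: k_def add_increasing add_increasing2)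
    finally show ?thesis .
  qed
  have "(L (\<lambda>x y. f x * g y))\<^sup>2 = L (\<lambda>x y. L (\<lambda>x' y'. (f x' * g y') * (f x * g y)))"
    by (simp add: L_def power2_eq_square sum_distrib_left sum_distrib_right)
  also have "\<dots> \<le> L (\<lambda>x y. L (\<lambda>x' y'. (k x y x' y' + k x' y' x y) / 2))"
    by (intro mono point)
  also have "\<dots> = (L (\<lambda>x y. L (\<lambda>x' y'. k x y x' y')) + L (\<lambda>x y. L (\<lambda>x' y'. k x' y' x y))) / 2"
    unfolding add[symmetric] by (simp add: L_def sum_divide_distrib)
  also have "\<dots> = L (\<lambda>x y. L (\<lambda>x' y'. k x y x' y'))"
    by (subst (2) L_commute) simp
  \<comment> \<open>The final 8 is 4 + 2 + 2: given a crossed pair, \<open>y\<close> and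
    \<open>x'\<close> have at most two values each; if x = y', one edge determines the other up to
    two choices of its free end.\<close>
  also have "\<dots> = L (\<lambda>x y. L (\<lambda>x' y'. if x \<noteq> y' then w x y' else 0))
      + (L (\<lambda>x y. L (\<lambda>x' y'. if x = y' then w x y else 0))
      + L (\<lambda>x y. L (\<lambda>x' y'. if x = y' then w x' y' else 0)))"
    unfolding add[symmetric] by (intro arg_cong[where f = L] ext) (auto simp: k_def)
  also have "L (\<lambda>x y. L (\<lambda>x' y'. if x \<noteq> y' then w x y' else 0)) \<le> 4 * B"
  proof -
    have "L (\<lambda>x y. L (\<lambda>x' y'. if x \<noteq> y' then w x y' else 0))
        \<le> L (\<lambda>x y. 2 * (\<Sum>y'\<in>?Y. if x \<noteq> y' then w x y' else 0))"
      using w0 by (intro mono) (subst swap, intro fst_le, auto)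
    also have "\<dots> \<le> 2 * (\<Sum>x\<in>?Y. 2 * (\<Sum>y'\<in>?Y. if x \<noteq> y' then w x y' else 0))"
      using w0 by (intro fst_le) (auto intro: sum_nonneg)
    also have "\<dots> = 4 * (\<Sum>x\<in>?Y. \<Sum>y'\<in>?Y. if x \<noteq> y' then w x y' else 0)"
      by (simp add: sum_distrib_left)
    also have "(\<Sum>x\<in>?Y. \<Sum>y'\<in>?Y. if x \<noteq> y' then w x y' else 0) = B"
      unfolding B_def by (intro sum.cong refl sum.mono_neutral_cong_right) auto
    finally show ?thesis .
  qed
  also have "L (\<lambda>x y. L (\<lambda>x' y'. if x = y' then w x y else 0)) \<le> 2 * B"
  proof -
    have "L (\<lambda>x y. L (\<lambda>x' y'. if x = y' then w x y else 0)) \<le> L (\<lambda>x y. 2 * w x y)"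
      using w0 by (intro mono) (subst swap, intro ind_le, auto)
    then show ?thesis using edges by (simp add: L_def sum_distrib_left[symmetric])
  qed
  also have "L (\<lambda>x y. L (\<lambda>x' y'. if x = y' then w x' y' else 0)) \<le> 2 * B"
  proof -
    have "L (\<lambda>x y. L (\<lambda>x' y'. if x = y' then w x' y' else 0)) \<le> L (\<lambda>x' y'. 2 * w x' y')"
      using w0 ind_le by (subst L_commute, intro mono) (auto simp: eq_commute)
    then show ?thesis using edges by (simp add: L_def sum_distrib_left[symmetric])
  qed
  finally show ?thesis by (simp add: L_def B_def w_def)
qed

text \<open>Cauchy-Schwarz over the vertex \<open>z\<close>: the other two functions enter through
  their edge sums \<open>P z\<close>, whose squares have total at most 16 N^2 <= 144 d^2 N.\<close>

lemma triangle_sum_half_le: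
  assumes F: "density F1" "density F2" "density F3"
  shows "triangle_sum (\<lambda>z x y. F1 z powr (1/2) * F2 x powr (1/2) * F3 y powr (1/2))
      \<le> 73 * real d * real (card V)"
proof -
  let ?N = "real (card V)" and ?d = "real d"
  define P where "P z = (\<Sum>x\<in>nbr z. \<Sum>y\<in>nbr z \<inter> nbr x. F2 x powr (1/2) * F3 y powr (1/2))" for z
  have half_sq: "(F x powr (1/2))\<^sup>2 = F x" if "density F" "x \<in> V" for F x
    using that density_nonneg[of F x] by (simp add: powr_half_sqrt)
  have d: "0 < ?d" using degree_pos by simp
  have "(P z)\<^sup>2 \<le> 8 * (\<Sum>x\<in>nbr z. \<Sum>y\<in>nbr z - {x}. F2 x * F3 y)" if "z \<in> V" for z
  proof -
    have "(P z)\<^sup>2 \<le> 8 * (\<Sum>x\<in>nbr z. \<Sum>y\<in>nbr z - {x}. (F2 x powr (1/2))\<^sup>2 * (F3 y powr (1/2))\<^sup>2)"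
      unfolding P_def using that by (intro square_sum_nbr_edges_le) auto
    also have "(\<Sum>x\<in>nbr z. \<Sum>y\<in>nbr z - {x}. (F2 x powr (1/2))\<^sup>2 * (F3 y powr (1/2))\<^sup>2)
        = (\<Sum>x\<in>nbr z. \<Sum>y\<in>nbr z - {x}. F2 x * F3 y)"
      using F by (intro sum.cong refl) (auto dest!: nbrD simp only: half_sq)
    finally show ?thesis .
  qed
  then have "(\<Sum>z\<in>V. (P z)\<^sup>2) \<le> (\<Sum>z\<in>V. 8 * (\<Sum>x\<in>nbr z. \<Sum>y\<in>nbr z - {x}. F2 x * F3 y))"
    by (rule sum_mono)
  also have "\<dots> \<le> 8 * (2 * ?N\<^sup>2)"
    unfolding sum_distrib_left[of 8, symmetric] by (intro mult_left_mono sum_nbr_pairs_le F) auto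
  also have "\<dots> \<le> 16 * (?N * (9 * ?d\<^sup>2))"
    using mult_left_mono[OF real_card_le, of ?N] unfolding power2_eq_square[of ?N] by linarith
  also have "\<dots> = 144 * ?d * ?N * ?d" by (simp add: power2_eq_square)
  finally have P2: "(\<Sum>z\<in>V. (P z)\<^sup>2) \<le> 144 * ?d * ?N * ?d" .
  have "triangle_sum (\<lambda>z x y. F1 z powr (1/2) * F2 x powr (1/2) * F3 y powr (1/2))
      = (\<Sum>z\<in>V. F1 z powr (1/2) * P z)"
    by (simp add: triangle_sum_def P_def sum_distrib_left mult_ac)
  \<comment> \<open>AM-GM with weight d balances the totals, N for \<open>F1\<close> and 144 d^2 N
    for the squares of \<open>P\<close>; half of 1 + 144 is below 73.\<close>
  also have "\<dots> \<le> (\<Sum>z\<in>V. (?d * F1 z + (P z)\<^sup>2 / ?d) / 2)"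
  proof (rule sum_mono)
    fix z assume z: "z \<in> V"
    have "0 \<le> (?d * F1 z powr (1/2) - P z)\<^sup>2 / ?d" using d by simp
    also have "\<dots> = ?d * (F1 z powr (1/2))\<^sup>2 - 2 * (F1 z powr (1/2) * P z) + (P z)\<^sup>2 / ?d"
      using d by (simp add: power2_eq_square field_simps)
    finally show "F1 z powr (1/2) * P z \<le> (?d * F1 z + (P z)\<^sup>2 / ?d) / 2"
      using half_sq[OF F(1) z] by simp
  qed
  also have "\<dots> = (?d * sum F1 V + (\<Sum>z\<in>V. (P z)\<^sup>2) / ?d) / 2"
    by (simp only: sum_divide_distrib[symmetric] sum.distrib sum_distrib_left)
  also have "\<dots> \<le> (?d * ?N + (144 * ?d * ?N * ?d) / ?d) / 2"
    using F d P2 by (intro divide_right_mono add_mono mult_left_mono density_sum) auto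
  also have "\<dots> \<le> 73 * ?d * ?N" using d by simp
  finally show ?thesis .
qed

end

section \<open>Monomials bounded by the vertices of the exponent polytope\<close>

text \<open>For a >= b >= c the point (a, b, c) is (a - b) times (1, 0, 0), plus 3/2 (b - c) times
  (2/3, 2/3, 0), plus 2 c times (1/2, 1/2, 1/2). The weights add up to a + (b + c) / 2, at most 1 by
  hypothesis; the missing weight belongs to the vertex 0, that is, to the summand 1.\<close>

lemma powr_mult3_le_sorted:
  fixes u v w a b c :: real
  assumes pos: "0 < u" "0 < v" "0 < w" and srt: "0 \<le> c" "c \<le> b" "b \<le> a" "2 * a + b + c \<le> 2"
  shows "u powr a * v powr b * w powr c
      \<le> 1 + u + u powr (2/3) * v powr (2/3) + u powr (1/2) * v powr (1/2) * w powr (1/2)"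
proof -
  let ?e = "u powr (2/3) * v powr (2/3)" and ?t = "u powr (1/2) * v powr (1/2) * w powr (1/2)"
  let ?m = "1 + u + ?e + ?t"
  have "u powr a * v powr b * w powr c = u powr (a - b) * ?e powr (3/2 * (b - c)) * ?t powr (2 * c)"
  proof -
    have "a = (a - b) + (2/3) * (3/2 * (b - c)) + (1/2) * (2 * c)"
      "b = (2/3) * (3/2 * (b - c)) + (1/2) * (2 * c)" "c = (1/2) * (2 * c)" by (simp_all add: algebra_simps diff_divide_distrib)
    then have "u powr a = u powr (a - b) * u powr ((2/3) * (3/2 * (b - c))) * u powr ((1/2) * (2 * c))"
      "v powr b = v powr ((2/3) * (3/2 * (b - c))) * v powr ((1/2) * (2 * c))"
      by (metis powr_add)+
    then show ?thesis using pos by (simp add: powr_mult powr_powr)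
  qed
  \<comment> \<open>Each monomial is at most \<open>?m\<close>. As \<open>?m\<close> is at least 1,
    a total weight of at most 1 then gives at most \<open>?m\<close>.\<close>
  also have "\<dots> \<le> ?m powr (a - b) * ?m powr (3/2 * (b - c)) * ?m powr (2 * c)"
    using pos srt by (intro mult_mono powr_mono2) (auto intro!: add_nonneg_nonneg)
  also have "\<dots> = ?m powr (a - b + 3/2 * (b - c) + 2 * c)" by (simp add: powr_add)
  also have "\<dots> \<le> ?m powr 1"
  proof (rule powr_mono)
    show "a - b + 3/2 * (b - c) + 2 * c \<le> 1" using srt by argo
  qed (use pos in \<open>auto intro!: add_nonneg_nonneg\<close>)
  also have "\<dots> = ?m" using pos by (simp add: add_nonneg_nonneg)
  finally show ?thesis .
qed

text \<open>The right-hand side lists the vertices of the polytope of admissible exponents.\<close>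

lemma powr_mult3_le:
  fixes u v w a b c :: real
  assumes pos: "0 < u" "0 < v" "0 < w" and nn: "0 \<le> a" "0 \<le> b" "0 \<le> c"
    and le: "2 * a + b + c \<le> 2" "a + 2 * b + c \<le> 2" "a + b + 2 * c \<le> 2"
  shows "u powr a * v powr b * w powr c
      \<le> 1 + u + v + w + u powr (2/3) * v powr (2/3) + u powr (2/3) * w powr (2/3)
        + v powr (2/3) * w powr (2/3) + u powr (1/2) * v powr (1/2) * w powr (1/2)"
proof -
  define E where "E s t = s powr (2/3) * t powr (2/3)" for s t :: real
  define T where "T = u powr (1/2) * v powr (1/2) * w powr (1/2)"
  define S where "S = u powr a * v powr b * w powr c"
  note srt = powr_mult3_le_sorted[folded E_def]
  have nn_terms: "0 \<le> E u v" "0 \<le> E u w" "0 \<le> E v w" and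
    comm: "E v u = E u v" "E w u = E u w" "E w v = E v w" by (auto simp: E_def)
  consider "c \<le> b" "b \<le> a" | "b \<le> c" "c \<le> a" | "c \<le> a" "a \<le> b" | "a \<le> c" "c \<le> b"
    | "b \<le> a" "a \<le> c" | "a \<le> b" "b \<le> c" by linarith
  then have "S \<le> 1 + u + v + w + E u v + E u w + E v w + T"
  proof cases
    case 1
    have "S = u powr a * v powr b * w powr c"
      "T = u powr (1/2) * v powr (1/2) * w powr (1/2)" by (simp_all add: S_def T_def)
    then show ?thesis
      using 1 srt[of u v w c b a] pos nn le nn_terms comm by linarith
  next
    case 2
    have "S = u powr a * w powr c * v powr b"
      "T = u powr (1/2) * w powr (1/2) * v powr (1/2)" by (simp_all add: S_def T_def)
    then show ?thesis
      using 2 srt[of u w v b c a] pos nn le nn_terms comm by linarith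
  next
    case 3
    have "S = v powr b * u powr a * w powr c"
      "T = v powr (1/2) * u powr (1/2) * w powr (1/2)" by (simp_all add: S_def T_def)
    then show ?thesis
      using 3 srt[of v u w c a b] pos nn le nn_terms comm by linarith
  next
    case 4
    have "S = v powr b * w powr c * u powr a"
      "T = v powr (1/2) * w powr (1/2) * u powr (1/2)" by (simp_all add: S_def T_def)
    then show ?thesis
      using 4 srt[of v w u a c b] pos nn le nn_terms comm by linarith
  next
    case 5
    have "S = w powr c * u powr a * v powr b"
      "T = w powr (1/2) * u powr (1/2) * v powr (1/2)" by (simp_all add: S_def T_def)
    then show ?thesis
      using 5 srt[of w u v b a c] pos nn le nn_terms comm by linarith
  next
    case 6
    have "S = w powr c * v powr b * u powr a"
      "T = w powr (1/2) * v powr (1/2) * u powr (1/2)" by (simp_all add: S_def T_def)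
    then show ?thesis
      using 6 srt[of w v u a b c] pos nn le nn_terms comm by linarith
  qed
  then show ?thesis by (simp add: E_def S_def T_def)
qed

context codegree_graph
begin

text \<open>The eight vertex monomials are summed separately: 2 for the constant and for each single
  density, 50 for each pair, 73 for the triple, in total 231. Swapping arguments brings each pair
  and each single density into the position already treated.\<close>

lemma triangle_bound:
  assumes F: "density F1" "density F2" "density F3" and a: "0 \<le> a1" "0 \<le> a2" "0 \<le> a3"
    and le: "2 * a1 + a2 + a3 \<le> 2" "a1 + 2 * a2 + a3 \<le> 2" "a1 + a2 + 2 * a3 \<le> 2"
  shows "triangle_sum (\<lambda>z x y. F1 z powr a1 * F2 x powr a2 * F3 y powr a3)
      \<le> 231 * real d * real (card V)"
proof -
  let ?E = "\<lambda>s t. s powr (2/3) * t powr (2/3)"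
  let ?K = "real d * real (card V)"
  note swap12 = triangle_sum_swap12 and swap23 = triangle_sum_swap23
  have one: "triangle_sum (\<lambda>z x y. F z) \<le> 2 * ?K" "triangle_sum (\<lambda>z x y. F x) \<le> 2 * ?K"
    "triangle_sum (\<lambda>z x y. F y) \<le> 2 * ?K" if "density F" for F
    using triangle_sum_one_le[OF that] swap12[of "\<lambda>z x y. F z"] swap23[of "\<lambda>z x y. F x"] by simp_all
  have two: "triangle_sum (\<lambda>z x y. ?E (F z) (G x)) \<le> 50 * ?K"
    "triangle_sum (\<lambda>z x y. ?E (F z) (G y)) \<le> 50 * ?K"
    "triangle_sum (\<lambda>z x y. ?E (F x) (G y)) \<le> 50 * ?K" if "density F" "density G" for F G
    using triangle_sum_pair_le[OF that] swap23[of "\<lambda>z x y. ?E (F z) (G x)"]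
      swap12[of "\<lambda>z x y. ?E (F z) (G y)"] by simp_all
  have add: "triangle_sum (\<lambda>z x y. h z x y + h' z x y) = triangle_sum h + triangle_sum h'" for h h'
    by (simp add: triangle_sum_def sum.distrib)
  have "triangle_sum (\<lambda>z x y. F1 z powr a1 * F2 x powr a2 * F3 y powr a3)
      \<le> triangle_sum (\<lambda>z x y. 1 + F1 z + F2 x + F3 y + ?E (F1 z) (F2 x) + ?E (F1 z) (F3 y)
          + ?E (F2 x) (F3 y) + F1 z powr (1/2) * F2 x powr (1/2) * F3 y powr (1/2))"
    using F by (intro triangle_sum_mono powr_mult3_le a le) (simp_all add: density_pos)
  also have "\<dots> \<le> 2 * ?K + 2 * ?K + 2 * ?K + 2 * ?K + 50 * ?K + 50 * ?K + 50 * ?K + 73 * ?K"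
    unfolding add using triangle_sum_half_le[OF F] F
    by (intro add_mono one two one(1)[OF density_one]) auto
  finally show ?thesis by simp
qed

lemma triangle_tail_bound:
  assumes F: "density F1" "density F2" "density F3" "density F4"
    and a: "0 \<le> a1" "0 \<le> a2" "0 \<le> a3" "0 \<le> a4" "a4 \<le> 1"
    and le: "2 * a1 + a2 + (a3 + gain a4) \<le> 2" "a1 + 2 * a2 + (a3 + gain a4) \<le> 2"
      "a1 + a2 + 2 * (a3 + gain a4) \<le> 2"
  shows "triangle_sum (\<lambda>z x y. F3 z powr a3 * avg (\<lambda>u. F4 u powr a4) z * F1 x powr a1 * F2 y powr a2)
      \<le> 1155 * real d * real (card V)"
proof -
  obtain H where H: "density H"
    "\<And>x. x \<in> V \<Longrightarrow> F3 x powr a3 * avg (\<lambda>z. F4 z powr a4) x \<le> 5 * H x powr (a3 + gain a4)"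
    using powr_mult_avg_le_density F a by blast
  have "triangle_sum (\<lambda>z x y. F3 z powr a3 * avg (\<lambda>u. F4 u powr a4) z * F1 x powr a1 * F2 y powr a2)
      \<le> triangle_sum (\<lambda>z x y. 5 * H z powr (a3 + gain a4) * F1 x powr a1 * F2 y powr a2)"
    by (intro triangle_sum_mono mult_right_mono H) auto
  also have "\<dots> = 5 * triangle_sum (\<lambda>z x y. H z powr (a3 + gain a4) * F1 x powr a1 * F2 y powr a2)"
    by (simp add: triangle_sum_def sum_distrib_left mult.assoc)
  also have "\<dots> \<le> 5 * (231 * real d * real (card V))"
    using F H(1) a le gain_nonneg[of a4] by (intro mult_left_mono triangle_bound) auto
  finally show ?thesis by simp
qed

end

section \<open>Circles over a finite field\<close>

lemma card_le_2I:
  assumes "\<And>u v v'. \<lbrakk>u \<in> A; v \<in> A; v' \<in> A; u \<noteq> v; u \<noteq> v'\<rbrakk> \<Longrightarrow> v = v'"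
  shows "card A \<le> 2"
proof (cases "A = {}")
  case False
  then obtain u where u: "u \<in> A" by blast
  have "\<exists>v. A \<subseteq> {u, v}" using assms[OF u] by blast
  then obtain v where "A \<subseteq> {u, v}" by blast
  then have "card A \<le> card {u, v}" by (intro card_mono) auto
  also have "\<dots> \<le> 2" by (simp add: card_insert_if)
  finally show ?thesis .
qed simp

lemma card_le_mult_card_image:
  assumes "finite A" "\<And>y. y \<in> f ` A \<Longrightarrow> card {x\<in>A. f x = y} \<le> k"
  shows "card A \<le> k * card (f ` A)"
proof -
  have "A = (\<Union>y\<in>f ` A. {x\<in>A. f x = y})" by auto
  then have "card A \<le> (\<Sum>y\<in>f ` A. card {x\<in>A. f x = y})"
    using card_UN_le[of "f ` A" "\<lambda>y. {x\<in>A. f x = y}"] assms by simp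
  also have "\<dots> \<le> card (f ` A) * k" using assms by (intro sum_bounded_above[THEN order_trans]) auto
  finally show ?thesis by (simp add: mult.commute)
qed

section \<open>Square roots and plane geometry over a field of odd order\<close>

locale odd_finite_field = field +
  assumes finite_carrier: "finite (carrier R)"
    and odd_card: "odd (card (carrier R))"
begin

text \<open>In the additive group q times 1 is 0 by Lagrange's theorem, but if 1 + 1 = 0 and q is
  odd, it is 1.\<close>

lemma two_nonzero: "\<one> \<oplus> \<one> \<noteq> \<zero>"
proof
  assume two: "\<one> \<oplus> \<one> = \<zero>"
  obtain k where k: "card (carrier R) = 2 * k + 1" using odd_card by (auto elim: oddE)
  have "add_pow R (card (carrier R)) \<one> = \<zero>"
    using add.pow_order_eq_1[of \<one>] by (simp add: order_def)
  moreover have "add_pow R (2 * k) \<one> = \<zero>"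
  proof -
    have "add_pow R (2 :: nat) \<one> = \<zero>" using two by (simp add: numeral_2_eq_2)
    then show ?thesis using add.nat_pow_pow[of \<one> k 2] by simp
  qed
  ultimately show False unfolding k by simp
qed

lemma card_carrier_ge: "3 \<le> card (carrier R)"
proof -
  have "card {\<zero>, \<one>} \<le> card (carrier R)" using finite_carrier by (intro card_mono) auto
  then have "2 \<le> card (carrier R)" by simp
  then show ?thesis using odd_card by (cases "card (carrier R) = 2") auto
qed

lemma double_eq_iff:
  assumes "x \<in> carrier R" "y \<in> carrier R"
  shows "(\<one> \<oplus> \<one>) \<otimes> x = (\<one> \<oplus> \<one>) \<otimes> y \<longleftrightarrow> x = y"
  using assms two_nonzero by (simp add: m_lcancel)

lemma square_eqD:
  assumes "x \<in> carrier R" "y \<in> carrier R" "x \<otimes> x = y \<otimes> y"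
  shows "x = y \<or> x = \<ominus> y"
proof -
  have "(x \<ominus> y) \<otimes> (x \<oplus> y) = x \<otimes> x \<ominus> y \<otimes> y" using assms(1,2) by algebra
  then have "(x \<ominus> y) \<otimes> (x \<oplus> y) = \<zero>" using assms by simp
  then have "x \<ominus> y = \<zero> \<or> x \<oplus> y = \<zero>" using assms(1,2) by (metis integral minus_closed a_closed)
  then show ?thesis using assms by (metis minus_equality a_comm r_right_minus_eq)
qed

lemma card_square_roots_le: "card {x\<in>carrier R. x \<otimes> x = c} \<le> 2"
proof (rule card_le_2I)
  fix u v v' assume "u \<in> {x\<in>carrier R. x \<otimes> x = c}" "v \<in> {x\<in>carrier R. x \<otimes> x = c}"
    "v' \<in> {x\<in>carrier R. x \<otimes> x = c}" "u \<noteq> v" "u \<noteq> v'"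
  then show "v = v'" using square_eqD[of v u] square_eqD[of v' u] by auto
qed

text \<open>In the plane the orthogonal complement of a nonzero \<open>w\<close> is the line spanned
  by (-w2, w1). This includes isotropic \<open>w\<close>, which exist when -1 is a square.\<close>

lemma orthogonal_obtain:
  assumes car: "w1 \<in> carrier R" "w2 \<in> carrier R" "d1 \<in> carrier R" "d2 \<in> carrier R"
    and w: "w1 \<noteq> \<zero> \<or> w2 \<noteq> \<zero>" and orth: "d1 \<otimes> w1 \<oplus> d2 \<otimes> w2 = \<zero>"
  obtains l where "l \<in> carrier R" "d1 = \<ominus> (l \<otimes> w2)" "d2 = l \<otimes> w1"
proof (cases "w1 = \<zero>")
  case False
  define l where "l = d2 \<otimes> inv w1"
  have l: "l \<in> carrier R" and lw: "l \<otimes> w1 = d2"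
    using car False by (simp_all add: l_def field_Units m_assoc)
  have "w1 \<otimes> d1 = (d1 \<otimes> w1 \<oplus> d2 \<otimes> w2) \<ominus> d2 \<otimes> w2" using car by algebra
  also have "\<dots> = \<ominus> (d2 \<otimes> w2)" unfolding orth using car by (simp add: minus_eq)
  also have "\<dots> = w1 \<otimes> \<ominus> (l \<otimes> w2)" unfolding lw[symmetric] using car l by algebra
  finally show ?thesis using that[OF l] lw car l False by (simp add: m_lcancel)
next
  case True
  then have w2: "w2 \<noteq> \<zero>" using w by simp
  define l where "l = \<ominus> d1 \<otimes> inv w2"
  have l: "l \<in> carrier R" and lw: "l \<otimes> w2 = \<ominus> d1"
    using car w2 by (simp_all add: l_def field_Units m_assoc)
  have "d2 \<otimes> w2 = \<zero>" using orth True car by simp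
  then have "d2 = \<zero>" using w2 car integral by blast
  then show ?thesis using that[OF l] lw car l True by simp
qed

lemma circle_intersection_unique:
  assumes car: "w1 \<in> carrier R" "w2 \<in> carrier R" "u1 \<in> carrier R" "u2 \<in> carrier R"
      "v1 \<in> carrier R" "v2 \<in> carrier R" "z1 \<in> carrier R" "z2 \<in> carrier R" "t \<in> carrier R"
    and w: "w1 \<noteq> \<zero> \<or> w2 \<noteq> \<zero>" and t: "t \<noteq> \<zero>"
    and u: "u1 \<otimes> u1 \<oplus> u2 \<otimes> u2 = t" "(u1 \<ominus> w1) \<otimes> (u1 \<ominus> w1) \<oplus> (u2 \<ominus> w2) \<otimes> (u2 \<ominus> w2) = t"
    and v: "v1 \<otimes> v1 \<oplus> v2 \<otimes> v2 = t" "(v1 \<ominus> w1) \<otimes> (v1 \<ominus> w1) \<oplus> (v2 \<ominus> w2) \<otimes> (v2 \<ominus> w2) = t"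
    and z: "z1 \<otimes> z1 \<oplus> z2 \<otimes> z2 = t" "(z1 \<ominus> w1) \<otimes> (z1 \<ominus> w1) \<oplus> (z2 \<ominus> w2) \<otimes> (z2 \<ominus> w2) = t"
    and ne: "u1 \<noteq> v1 \<or> u2 \<noteq> v2" "u1 \<noteq> z1 \<or> u2 \<noteq> z2"
  shows "v1 = z1 \<and> v2 = z2"
proof -
  let ?two = "\<one> \<oplus> \<one>"
  have dot: "?two \<otimes> (x1 \<otimes> w1 \<oplus> x2 \<otimes> w2) = w1 \<otimes> w1 \<oplus> w2 \<otimes> w2"
    if x: "x1 \<in> carrier R" "x2 \<in> carrier R" and e: "x1 \<otimes> x1 \<oplus> x2 \<otimes> x2 = t"
      "(x1 \<ominus> w1) \<otimes> (x1 \<ominus> w1) \<oplus> (x2 \<ominus> w2) \<otimes> (x2 \<ominus> w2) = t" for x1 x2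
  proof -
    have "?two \<otimes> (x1 \<otimes> w1 \<oplus> x2 \<otimes> w2) = (w1 \<otimes> w1 \<oplus> w2 \<otimes> w2) \<oplus> ((x1 \<otimes> x1 \<oplus> x2 \<otimes> x2)
        \<ominus> ((x1 \<ominus> w1) \<otimes> (x1 \<ominus> w1) \<oplus> (x2 \<ominus> w2) \<otimes> (x2 \<ominus> w2)))"
      using x car by algebra
    also have "\<dots> = (w1 \<otimes> w1 \<oplus> w2 \<otimes> w2) \<oplus> (t \<ominus> t)" unfolding e ..
    finally show ?thesis using car by (simp add: r_neg minus_eq)
  qed
  \<comment> \<open>For isotropic \<open>w\<close> a common point \<open>u\<close> would be
    orthogonal to \<open>w\<close>, hence a multiple of (-w2, w1), which is isotropic too; but |u|^2
    = t is nonzero.\<close>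
  have W: "w1 \<otimes> w1 \<oplus> w2 \<otimes> w2 \<noteq> \<zero>"
  proof
    assume W0: "w1 \<otimes> w1 \<oplus> w2 \<otimes> w2 = \<zero>"
    then have "?two \<otimes> (u1 \<otimes> w1 \<oplus> u2 \<otimes> w2) = \<zero>" using dot[OF car(3,4) u] by simp
    then have o: "u1 \<otimes> w1 \<oplus> u2 \<otimes> w2 = \<zero>" using integral[of ?two] car two_nonzero by blast
    obtain l where l: "l \<in> carrier R" "u1 = \<ominus> (l \<otimes> w2)" "u2 = l \<otimes> w1"
      using orthogonal_obtain[OF car(1-4) w o] by blast
    have "t = l \<otimes> l \<otimes> (w1 \<otimes> w1 \<oplus> w2 \<otimes> w2)"
      unfolding u(1)[symmetric] l(2,3) using l(1) car by algebra
    then show False using W0 l(1) t by simp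
  qed
  have key: "\<exists>l\<in>carrier R. x1 = u1 \<oplus> \<ominus> (l \<otimes> w2) \<and> x2 = u2 \<oplus> l \<otimes> w1
      \<and> l \<otimes> (w1 \<otimes> w1 \<oplus> w2 \<otimes> w2) = ?two \<otimes> (u1 \<otimes> w2 \<ominus> u2 \<otimes> w1)"
    if x: "x1 \<in> carrier R" "x2 \<in> carrier R" and e: "x1 \<otimes> x1 \<oplus> x2 \<otimes> x2 = t"
      "(x1 \<ominus> w1) \<otimes> (x1 \<ominus> w1) \<oplus> (x2 \<ominus> w2) \<otimes> (x2 \<ominus> w2) = t"
      and nx: "u1 \<noteq> x1 \<or> u2 \<noteq> x2" for x1 x2
  proof -
    have "?two \<otimes> (x1 \<otimes> w1 \<oplus> x2 \<otimes> w2) = ?two \<otimes> (u1 \<otimes> w1 \<oplus> u2 \<otimes> w2)"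
      using dot[OF x e] dot[OF car(3,4) u] by simp
    then have eq: "x1 \<otimes> w1 \<oplus> x2 \<otimes> w2 = u1 \<otimes> w1 \<oplus> u2 \<otimes> w2"
      using x car by (simp only: double_eq_iff a_closed m_closed)
    have "(x1 \<ominus> u1) \<otimes> w1 \<oplus> (x2 \<ominus> u2) \<otimes> w2
        = (x1 \<otimes> w1 \<oplus> x2 \<otimes> w2) \<ominus> (u1 \<otimes> w1 \<oplus> u2 \<otimes> w2)" using x car by algebra
    also have "\<dots> = \<zero>" unfolding eq using car by (simp add: r_neg minus_eq)
    finally obtain l where l: "l \<in> carrier R" "x1 \<ominus> u1 = \<ominus> (l \<otimes> w2)" "x2 \<ominus> u2 = l \<otimes> w1"
      using orthogonal_obtain[OF car(1,2) _ _ w, of "x1 \<ominus> u1" "x2 \<ominus> u2"] x car by auto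
    have "x1 = u1 \<oplus> (x1 \<ominus> u1)" "x2 = u2 \<oplus> (x2 \<ominus> u2)" using x car by (algebra, algebra)
    then have xl: "x1 = u1 \<oplus> \<ominus> (l \<otimes> w2)" "x2 = u2 \<oplus> l \<otimes> w1" unfolding l(2,3) .
    have "l \<noteq> \<zero>" using nx xl l(1) car by auto
    have "l \<otimes> (l \<otimes> (w1 \<otimes> w1 \<oplus> w2 \<otimes> w2) \<ominus> ?two \<otimes> (u1 \<otimes> w2 \<ominus> u2 \<otimes> w1))
        = (x1 \<otimes> x1 \<oplus> x2 \<otimes> x2) \<ominus> (u1 \<otimes> u1 \<oplus> u2 \<otimes> u2)"
      unfolding xl using l(1) car by algebra
    also have "\<dots> = \<zero>" unfolding e u using car by (simp add: r_neg minus_eq)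
    finally have "l \<otimes> (w1 \<otimes> w1 \<oplus> w2 \<otimes> w2) \<ominus> ?two \<otimes> (u1 \<otimes> w2 \<ominus> u2 \<otimes> w1) = \<zero>"
      using integral[OF _ l(1)] \<open>l \<noteq> \<zero>\<close> l(1) car by (simp del: r_right_minus_eq)
    then have "l \<otimes> (w1 \<otimes> w1 \<oplus> w2 \<otimes> w2) = ?two \<otimes> (u1 \<otimes> w2 \<ominus> u2 \<otimes> w1)"
      using l(1) car by (subst (asm) r_right_minus_eq) auto
    then show ?thesis using l(1) xl by blast
  qed
  obtain l where l: "l \<in> carrier R" "v1 = u1 \<oplus> \<ominus> (l \<otimes> w2)" "v2 = u2 \<oplus> l \<otimes> w1"
    "l \<otimes> (w1 \<otimes> w1 \<oplus> w2 \<otimes> w2) = ?two \<otimes> (u1 \<otimes> w2 \<ominus> u2 \<otimes> w1)"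
    using key[OF car(5,6) v ne(1)] by blast
  obtain m where m: "m \<in> carrier R" "z1 = u1 \<oplus> \<ominus> (m \<otimes> w2)" "z2 = u2 \<oplus> m \<otimes> w1"
    "m \<otimes> (w1 \<otimes> w1 \<oplus> w2 \<otimes> w2) = ?two \<otimes> (u1 \<otimes> w2 \<ominus> u2 \<otimes> w1)"
    using key[OF car(7,8) z ne(2)] by blast
  have "l \<otimes> (w1 \<otimes> w1 \<oplus> w2 \<otimes> w2) = m \<otimes> (w1 \<otimes> w1 \<oplus> w2 \<otimes> w2)" using l(4) m(4) by simp
  then have "l = m" using W l(1) m(1) car by (simp add: m_rcancel)
  then show ?thesis using l(2,3) m(2,3) by simp
qed

section \<open>Circles: symmetry, intersections and cardinalities\<close>

lemma finite_plane: "finite (plane R)"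
  using finite_carrier by (simp add: plane_def)

lemma card_plane: "card (plane R) = (card (carrier R))\<^sup>2"
  by (simp add: plane_def card_cartesian_product numeral_2_eq_2)

lemma plane_diff_closed: "\<lbrakk>x \<in> plane R; y \<in> plane R\<rbrakk> \<Longrightarrow> plane_diff R x y \<in> plane R"
  by (auto simp: plane_def plane_diff_def)

lemma circle_subset_plane: "circle R t \<subseteq> plane R"
  by (auto simp: circle_def)

lemma finite_circle: "finite (circle R t)"
  using finite_plane circle_subset_plane by (rule finite_subset[rotated])

lemma plane_diff_circle_iff:
  assumes "x \<in> plane R" "y \<in> plane R"
  shows "plane_diff R x y \<in> circle R t \<longleftrightarrow> sqnorm R (plane_diff R x y) = t"
  using plane_diff_closed[OF assms] by (simp add: circle_def)

lemma plane_diff_circle_sym: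
  assumes "x \<in> plane R" "y \<in> plane R"
  shows "plane_diff R x y \<in> circle R t \<longleftrightarrow> plane_diff R y x \<in> circle R t"
proof -
  obtain x1 x2 y1 y2 where xy: "x = (x1, x2)" "y = (y1, y2)" by fastforce
  have car: "x1 \<in> carrier R" "x2 \<in> carrier R" "y1 \<in> carrier R" "y2 \<in> carrier R"
    using assms by (auto simp: xy plane_def)
  have "(x1 \<ominus> y1) \<otimes> (x1 \<ominus> y1) \<oplus> (x2 \<ominus> y2) \<otimes> (x2 \<ominus> y2)
      = (y1 \<ominus> x1) \<otimes> (y1 \<ominus> x1) \<oplus> (y2 \<ominus> x2) \<otimes> (y2 \<ominus> x2)" using car by algebra
  then show ?thesis
    using assms by (simp add: plane_diff_circle_iff) (simp add: xy sqnorm_def plane_diff_def)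
qed

lemma plane_diff_circle_irrefl:
  assumes "x \<in> plane R" "t \<noteq> \<zero>"
  shows "plane_diff R x x \<notin> circle R t"
  using assms by (auto simp: plane_diff_def circle_def sqnorm_def plane_def r_neg minus_eq)

lemma card_circle_around:
  assumes "x \<in> plane R"
  shows "card {y\<in>plane R. plane_diff R x y \<in> circle R t} = card (circle R t)"
proof -
  obtain x1 x2 where x: "x = (x1, x2)" "x1 \<in> carrier R" "x2 \<in> carrier R"
    using assms by (auto simp: plane_def)
  have cancel: "a \<ominus> (a \<ominus> b) = b" if "a \<in> carrier R" "b \<in> carrier R" for a b
    using that by algebra
  have "bij_betw (plane_diff R x) {y\<in>plane R. plane_diff R x y \<in> circle R t} (circle R t)"
    by (rule bij_betw_byWitness[where f' = "plane_diff R x"])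
      (use assms x cancel circle_subset_plane plane_diff_closed in
        \<open>auto simp: plane_def plane_diff_def subset_iff circle_def\<close>)
  then show ?thesis by (rule bij_betw_same_card)
qed

lemma card_circles_intersection:
  assumes "a \<in> plane R" "b \<in> plane R" "a \<noteq> b" "t \<in> carrier R" "t \<noteq> \<zero>"
  shows "card {z\<in>plane R. plane_diff R a z \<in> circle R t \<and> plane_diff R b z \<in> circle R t} \<le> 2"
proof (rule card_le_2I)
  fix u v z
  let ?C = "{z\<in>plane R. plane_diff R a z \<in> circle R t \<and> plane_diff R b z \<in> circle R t}"
  assume C: "u \<in> ?C" "v \<in> ?C" "z \<in> ?C" and ne: "u \<noteq> v" "u \<noteq> z"
  obtain a1 a2 b1 b2 where ab: "a = (a1, a2)" "b = (b1, b2)" by fastforce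
  obtain u1 u2 v1 v2 z1 z2 where uvz: "u = (u1, u2)" "v = (v1, v2)" "z = (z1, z2)" by (metis surj_pair)
  have car: "a1 \<in> carrier R" "a2 \<in> carrier R" "b1 \<in> carrier R" "b2 \<in> carrier R"
    "u1 \<in> carrier R" "u2 \<in> carrier R" "v1 \<in> carrier R" "v2 \<in> carrier R"
    "z1 \<in> carrier R" "z2 \<in> carrier R"
    using assms C by (auto simp: ab uvz plane_def)
  have cancel: "x \<ominus> p = y \<ominus> p \<longleftrightarrow> x = y"
    if "x \<in> carrier R" "y \<in> carrier R" "p \<in> carrier R" for x y p
    using that by (simp add: minus_eq)
  have eqs: "(x1 \<ominus> a1) \<otimes> (x1 \<ominus> a1) \<oplus> (x2 \<ominus> a2) \<otimes> (x2 \<ominus> a2) = t \<and>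
    ((x1 \<ominus> a1) \<ominus> (b1 \<ominus> a1)) \<otimes> ((x1 \<ominus> a1) \<ominus> (b1 \<ominus> a1))
    \<oplus> ((x2 \<ominus> a2) \<ominus> (b2 \<ominus> a2)) \<otimes> ((x2 \<ominus> a2) \<ominus> (b2 \<ominus> a2)) = t"
    if x: "(x1, x2) \<in> ?C" for x1 x2
  proof -
    have xc: "x1 \<in> carrier R" "x2 \<in> carrier R" using x by (auto simp: plane_def)
    have "(a1 \<ominus> x1) \<otimes> (a1 \<ominus> x1) \<oplus> (a2 \<ominus> x2) \<otimes> (a2 \<ominus> x2) = t"
      "(b1 \<ominus> x1) \<otimes> (b1 \<ominus> x1) \<oplus> (b2 \<ominus> x2) \<otimes> (b2 \<ominus> x2) = t"
      using x by (auto simp: ab circle_def sqnorm_def plane_diff_def)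
    moreover have "(x1 \<ominus> a1) \<otimes> (x1 \<ominus> a1) \<oplus> (x2 \<ominus> a2) \<otimes> (x2 \<ominus> a2)
        = (a1 \<ominus> x1) \<otimes> (a1 \<ominus> x1) \<oplus> (a2 \<ominus> x2) \<otimes> (a2 \<ominus> x2)" using xc car by algebra
    moreover have "((x1 \<ominus> a1) \<ominus> (b1 \<ominus> a1)) \<otimes> ((x1 \<ominus> a1) \<ominus> (b1 \<ominus> a1))
        \<oplus> ((x2 \<ominus> a2) \<ominus> (b2 \<ominus> a2)) \<otimes> ((x2 \<ominus> a2) \<ominus> (b2 \<ominus> a2))
        = (b1 \<ominus> x1) \<otimes> (b1 \<ominus> x1) \<oplus> (b2 \<ominus> x2) \<otimes> (b2 \<ominus> x2)" using xc car by algebra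
    ultimately show ?thesis by simp
  qed
  \<comment> \<open>Subtracting \<open>a\<close> moves the two centres to 0 and b - a.\<close>
  have "v1 \<ominus> a1 = z1 \<ominus> a1 \<and> v2 \<ominus> a2 = z2 \<ominus> a2"
  proof (rule circle_intersection_unique[of "b1 \<ominus> a1" "b2 \<ominus> a2" "u1 \<ominus> a1" "u2 \<ominus> a2"
        "v1 \<ominus> a1" "v2 \<ominus> a2" "z1 \<ominus> a1" "z2 \<ominus> a2" t])
    show "b1 \<ominus> a1 \<noteq> \<zero> \<or> b2 \<ominus> a2 \<noteq> \<zero>"
      using assms(3) car by (auto simp: ab)
  qed (use car assms C ne eqs in \<open>auto simp: uvz cancel\<close>)
  then show "v = z" using car by (simp add: cancel uvz)
qed

text \<open>Pigeonhole: the set \<open>Q\<close> of squares and its reflection t - Q both have at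
  least q/2 elements, hence more than q/2 as q is odd, so they meet.\<close>

lemma circle_nonempty:
  assumes t: "t \<in> carrier R"
  shows "circle R t \<noteq> {}"
proof -
  define Q where "Q = (\<lambda>x. x \<otimes> x) ` carrier R"
  define Q' where "Q' = (\<lambda>x. t \<ominus> x) ` Q"
  have sub: "Q \<subseteq> carrier R" "Q' \<subseteq> carrier R" using t by (auto simp: Q_def Q'_def)
  have fin: "finite Q" "finite Q'" using finite_carrier by (auto simp: Q_def Q'_def)
  have "inj_on (\<lambda>x. t \<ominus> x) Q"
  proof (rule inj_onI)
    fix x y assume xy: "x \<in> Q" "y \<in> Q" "t \<ominus> x = t \<ominus> y"
    then have "x \<in> carrier R" "y \<in> carrier R" using sub by auto
    then show "x = y" using xy(3) t by (simp add: minus_eq) (metis minus_minus)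
  qed
  then have card_eq: "card Q' = card Q" unfolding Q'_def by (rule card_image)
  have "card (carrier R) \<le> 2 * card Q"
    unfolding Q_def using finite_carrier card_square_roots_le by (rule card_le_mult_card_image)
  have "Q \<inter> Q' \<noteq> {}"
  proof
    assume "Q \<inter> Q' = {}"
    then have "card Q + card Q' = card (Q \<union> Q')" using fin by (simp add: card_Un_disjoint)
    also have "\<dots> \<le> card (carrier R)" using sub finite_carrier by (intro card_mono) auto
    finally have "card (carrier R) = 2 * card Q" using card_eq \<open>card (carrier R) \<le> 2 * card Q\<close> by simp
    then show False using odd_card by simp
  qed
  then obtain x y where xy: "x \<in> carrier R" "y \<in> carrier R" "x \<otimes> x = t \<ominus> y \<otimes> y"
    unfolding Q_def Q'_def by auto
  have "x \<otimes> x \<oplus> y \<otimes> y = (t \<ominus> y \<otimes> y) \<oplus> y \<otimes> y" using xy(3) by simp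
  also have "\<dots> = t" using xy t by algebra
  finally have "(x, y) \<in> circle R t" using xy by (simp add: circle_def plane_def sqnorm_def)
  then show ?thesis by blast
qed

text \<open>One point of the circle is moved around by the unit vectors
  $((1 - m^2) / (1 + m^2), 2 m / (1 + m^2))$, acting as complex numbers of norm one.\<close>

lemma card_circle_ge:
  assumes t: "t \<in> carrier R" "t \<noteq> \<zero>"
  shows "card (carrier R) \<le> card (circle R t) + 2"
proof -
  let ?two = "\<one> \<oplus> \<one>"
  obtain z1 z2 where z: "z1 \<in> carrier R" "z2 \<in> carrier R" "z1 \<otimes> z1 \<oplus> z2 \<otimes> z2 = t"
    using circle_nonempty[OF t(1)] by (auto simp: circle_def plane_def sqnorm_def)
  define M where "M = {m\<in>carrier R. \<one> \<oplus> m \<otimes> m \<noteq> \<zero>}"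
  \<comment> \<open>The coordinates of the unit vector are n - 1 and n m, so its norm follows from n
    (1 + m^2) = 2 alone.\<close>
  define n where "n m = ?two \<otimes> inv (\<one> \<oplus> m \<otimes> m)" for m
  define w1 where "w1 m = n m \<ominus> \<one>" for m
  define w2 where "w2 m = n m \<otimes> m" for m
  define \<phi> where "\<phi> m = (z1 \<otimes> w1 m \<ominus> z2 \<otimes> w2 m, z1 \<otimes> w2 m \<oplus> z2 \<otimes> w1 m)" for m
  have n: "n m \<in> carrier R" "n m \<otimes> (\<one> \<oplus> m \<otimes> m) = ?two" "n m \<noteq> \<zero>" "m \<in> carrier R"
    if "m \<in> M" for m
  proof -
    have u: "\<one> \<oplus> m \<otimes> m \<in> Units R" and m: "m \<in> carrier R" using that by (auto simp: M_def field_Units)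
    then show "n m \<in> carrier R" "n m \<otimes> (\<one> \<oplus> m \<otimes> m) = ?two" "m \<in> carrier R" by (auto simp: n_def m_assoc)
    then show "n m \<noteq> \<zero>" using m two_nonzero by auto
  qed
  have wc: "w1 m \<in> carrier R" "w2 m \<in> carrier R" if "m \<in> M" for m
    using n[OF that] by (simp_all add: w1_def w2_def)
  have on_circle: "\<phi> m \<in> circle R t" if m: "m \<in> M" for m
  proof -
    have unit: "w1 m \<otimes> w1 m \<oplus> w2 m \<otimes> w2 m = \<one>"
    proof -
      obtain k where k: "k = n m" by blast
      note nk = n[OF m, folded k]
      have "w1 m \<otimes> w1 m \<oplus> w2 m \<otimes> w2 m = k \<otimes> (k \<otimes> (\<one> \<oplus> m \<otimes> m)) \<ominus> ?two \<otimes> k \<oplus> \<one>"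
        unfolding w1_def w2_def k[symmetric] using nk(1,4) by algebra
      also have "\<dots> = k \<otimes> ?two \<ominus> ?two \<otimes> k \<oplus> \<one>" unfolding nk(2) ..
      also have "\<dots> = \<one>" using nk(1) by algebra
      finally show ?thesis .
    qed
    obtain a b where ab: "a = w1 m" "b = w2 m" by blast
    have "(z1 \<otimes> a \<ominus> z2 \<otimes> b) \<otimes> (z1 \<otimes> a \<ominus> z2 \<otimes> b) \<oplus> (z1 \<otimes> b \<oplus> z2 \<otimes> a) \<otimes> (z1 \<otimes> b \<oplus> z2 \<otimes> a)
        = (z1 \<otimes> z1 \<oplus> z2 \<otimes> z2) \<otimes> (a \<otimes> a \<oplus> b \<otimes> b)"
      using z(1,2) wc[OF m, folded ab] by algebra
    then show ?thesis
      using z wc[OF m] t unit by (simp add: ab \<phi>_def circle_def plane_def sqnorm_def)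
  qed
  \<comment> \<open>Multiplication by the conjugate of \<open>z\<close> undoes the one by
    \<open>z\<close> up to the factor t, which is nonzero; hence the map is injective.\<close>
  have recover: "z1 \<otimes> fst (\<phi> m) \<oplus> z2 \<otimes> snd (\<phi> m) = t \<otimes> w1 m"
    "z1 \<otimes> snd (\<phi> m) \<ominus> z2 \<otimes> fst (\<phi> m) = t \<otimes> w2 m" if m: "m \<in> M" for m
  proof -
    obtain a b where ab: "a = w1 m" "b = w2 m" by blast
    have "z1 \<otimes> (z1 \<otimes> a \<ominus> z2 \<otimes> b) \<oplus> z2 \<otimes> (z1 \<otimes> b \<oplus> z2 \<otimes> a) = (z1 \<otimes> z1 \<oplus> z2 \<otimes> z2) \<otimes> a"
      using z(1,2) wc[OF m, folded ab] by algebra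
    then show "z1 \<otimes> fst (\<phi> m) \<oplus> z2 \<otimes> snd (\<phi> m) = t \<otimes> w1 m" using z(3) by (simp add: \<phi>_def ab)
    have "z1 \<otimes> (z1 \<otimes> b \<oplus> z2 \<otimes> a) \<ominus> z2 \<otimes> (z1 \<otimes> a \<ominus> z2 \<otimes> b) = (z1 \<otimes> z1 \<oplus> z2 \<otimes> z2) \<otimes> b"
      using z(1,2) wc[OF m, folded ab] by algebra
    then show "z1 \<otimes> snd (\<phi> m) \<ominus> z2 \<otimes> fst (\<phi> m) = t \<otimes> w2 m" using z(3) by (simp add: \<phi>_def ab)
  qed
  have "inj_on \<phi> M"
  proof (rule inj_onI)
    fix m m' assume m: "m \<in> M" "m' \<in> M" and eq: "\<phi> m = \<phi> m'"
    have "t \<otimes> w1 m = t \<otimes> w1 m'" "t \<otimes> w2 m = t \<otimes> w2 m'"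
      using recover[OF m(1)] recover[OF m(2)] eq by simp_all
    then have w: "w1 m = w1 m'" "w2 m = w2 m'" using wc m t by (simp_all add: m_lcancel)
    from w(1) have nn: "n m = n m'"
      using n[OF m(1)] n[OF m(2)] by (simp add: w1_def minus_eq)
    from w(2) show "m = m'" using nn n[OF m(1)] n[OF m(2)] by (simp add: w2_def m_lcancel)
  qed
  then have "card M \<le> card (circle R t)"
    using on_circle finite_circle by (intro card_inj_on_le[of \<phi>]) auto
  moreover have "card (carrier R) \<le> card M + card {m\<in>carrier R. m \<otimes> m = \<ominus> \<one>}"
  proof -
    have "carrier R \<subseteq> M \<union> {m\<in>carrier R. m \<otimes> m = \<ominus> \<one>}"
    proof
      fix m assume m: "m \<in> carrier R"
      show "m \<in> M \<union> {m\<in>carrier R. m \<otimes> m = \<ominus> \<one>}"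
        using m minus_equality[of "m \<otimes> m" \<one>] by (auto simp: M_def a_comm)
    qed
    then have "card (carrier R) \<le> card (M \<union> {m\<in>carrier R. m \<otimes> m = \<ominus> \<one>})"
      using finite_carrier by (intro card_mono) (auto simp: M_def)
    then show ?thesis using card_Un_le order_trans by blast
  qed
  \<comment> \<open>The parameters lost are the square roots of -1, at most two.\<close>
  ultimately show ?thesis using card_square_roots_le[of "\<ominus> \<one>"] by linarith
qed

lemma card_circle_le:
  assumes "t \<in> carrier R"
  shows "card (circle R t) \<le> 2 * card (carrier R)"
proof -
  have "card (circle R t) \<le> 2 * card (fst ` circle R t)"
  proof (rule card_le_mult_card_image[OF finite_circle])
    fix y assume "y \<in> fst ` circle R t"
    then have y: "y \<in> carrier R" by (auto simp: circle_def plane_def)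
    have "snd x \<otimes> snd x = t \<ominus> y \<otimes> y" if x: "x \<in> circle R t" "fst x = y" for x
    proof -
      obtain b where b: "b \<in> carrier R" "snd x = b" "y \<otimes> y \<oplus> b \<otimes> b = t"
        using x by (auto simp: circle_def plane_def sqnorm_def)
      have "b \<otimes> b = (y \<otimes> y \<oplus> b \<otimes> b) \<ominus> y \<otimes> y" using b(1) y by algebra
      then show ?thesis using b by simp
    qed
    then have "card {x\<in>circle R t. fst x = y} \<le> card {b\<in>carrier R. b \<otimes> b = t \<ominus> y \<otimes> y}"
      using finite_carrier
      by (intro card_inj_on_le[of snd]) (auto simp: inj_on_def circle_def plane_def)
    then show "card {x\<in>circle R t. fst x = y} \<le> 2" using card_square_roots_le le_trans by blast
  qed
  also have "card (fst ` circle R t) \<le> card (carrier R)"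
    using finite_carrier by (intro card_mono) (auto simp: circle_def plane_def)
  finally show ?thesis by simp
qed

text \<open>The map is the rotation by 60 degrees, so that \<open>0\<close>, \<open>s\<close> and \<open>\<rho> s\<close> form an equilateral triangle.\<close>

lemma equilateral_obtain:
  assumes c: "c \<in> carrier R" "c \<otimes> c = \<one> \<oplus> \<one> \<oplus> \<one>"
  obtains \<rho> where "\<And>s. s \<in> circle R t \<Longrightarrow> \<rho> s \<in> circle R t"
    "\<And>s. s \<in> circle R t \<Longrightarrow> plane_diff R s (\<rho> s) \<in> circle R t"
proof -
  let ?two = "\<one> \<oplus> \<one>"
  define h where "h = inv ?two"
  have h: "h \<in> carrier R" "h \<otimes> ?two = \<one>"
    using two_nonzero by (simp_all add: h_def field_Units)
  \<comment> \<open>The elements h = 1/2 and h c are cosine and sine of 60 degrees. Both \<rho> s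
    and s - \<rho> s have norm (1 + c^2) / 4 times that of s, and 1 + c^2 = 4.\<close>
  define \<rho> where "\<rho> s = (h \<otimes> (fst s \<ominus> c \<otimes> snd s), h \<otimes> (c \<otimes> fst s \<oplus> snd s))" for s
  have one_c: "\<one> \<oplus> c \<otimes> c = ?two \<otimes> ?two" unfolding c(2) by algebra
  have scale: "h \<otimes> h \<otimes> (?two \<otimes> ?two) \<otimes> r = r" if "r \<in> carrier R" for r
  proof -
    have "h \<otimes> h \<otimes> (?two \<otimes> ?two) \<otimes> r = (h \<otimes> ?two) \<otimes> (h \<otimes> ?two) \<otimes> r"
      using h(1) that by algebra
    then show ?thesis unfolding h(2) using that by simp
  qed
  have minus_half: "r \<ominus> h \<otimes> r' = h \<otimes> (?two \<otimes> r \<ominus> r')" if "r \<in> carrier R" "r' \<in> carrier R" for r r'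
  proof -
    have "h \<otimes> (?two \<otimes> r \<ominus> r') = (h \<otimes> ?two) \<otimes> r \<ominus> h \<otimes> r'" using h(1) that by algebra
    then show ?thesis unfolding h(2) using that by simp
  qed
  show ?thesis
  proof (rule that[of \<rho>])
    fix s assume "s \<in> circle R t"
    then obtain a b where s: "s = (a, b)" "a \<in> carrier R" "b \<in> carrier R" "a \<otimes> a \<oplus> b \<otimes> b = t"
      by (auto simp: circle_def plane_def sqnorm_def)
    then have t: "t \<in> carrier R" by auto
    have "(h \<otimes> (a \<ominus> c \<otimes> b)) \<otimes> (h \<otimes> (a \<ominus> c \<otimes> b)) \<oplus> (h \<otimes> (c \<otimes> a \<oplus> b)) \<otimes> (h \<otimes> (c \<otimes> a \<oplus> b))
        = h \<otimes> h \<otimes> (\<one> \<oplus> c \<otimes> c) \<otimes> (a \<otimes> a \<oplus> b \<otimes> b)"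
      using s(2,3) h(1) c(1) by algebra
    then show "\<rho> s \<in> circle R t"
      using s h(1) c(1) t by (simp add: circle_def plane_def sqnorm_def \<rho>_def one_c scale)
    have d: "a \<ominus> h \<otimes> (a \<ominus> c \<otimes> b) = h \<otimes> (?two \<otimes> a \<ominus> (a \<ominus> c \<otimes> b))"
      "b \<ominus> h \<otimes> (c \<otimes> a \<oplus> b) = h \<otimes> (?two \<otimes> b \<ominus> (c \<otimes> a \<oplus> b))"
      using s(2,3) c(1) by (simp_all add: minus_half)
    have "(h \<otimes> (?two \<otimes> a \<ominus> (a \<ominus> c \<otimes> b))) \<otimes> (h \<otimes> (?two \<otimes> a \<ominus> (a \<ominus> c \<otimes> b)))
        \<oplus> (h \<otimes> (?two \<otimes> b \<ominus> (c \<otimes> a \<oplus> b))) \<otimes> (h \<otimes> (?two \<otimes> b \<ominus> (c \<otimes> a \<oplus> b)))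
        = h \<otimes> h \<otimes> (\<one> \<oplus> c \<otimes> c) \<otimes> (a \<otimes> a \<oplus> b \<otimes> b)"
      using s(2,3) h(1) c(1) by algebra
    then show "plane_diff R s (\<rho> s) \<in> circle R t"
      unfolding circle_def plane_def sqnorm_def plane_diff_def \<rho>_def s(1) fst_conv snd_conv d
      using s h(1) c(1) t by (simp add: one_c scale)
  qed
qed

end

section \<open>Upper bounds for the forms\<close>

lemma admissible_imp_odd_finite_field: "admissible_field R \<Longrightarrow> odd_finite_field R"
  unfolding admissible_field_def odd_finite_field_def odd_finite_field_axioms_def by auto

lemma (in odd_finite_field) codegree_graph_circle:
  assumes "t \<in> carrier R" "t \<noteq> \<zero>"
  shows "codegree_graph (plane R) (\<lambda>x y. plane_diff R x y \<in> circle R t) (card (circle R t))"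
proof
  show pos: "0 < card (circle R t)"
    using circle_nonempty[OF assms(1)] finite_circle by (simp add: card_gt_0_iff)
  \<comment> \<open>With d >= 1 the bound q <= d + 2 becomes q <= 3 d, valid even for the smallest
    fields; its square is the source of the 9.\<close>
  have "card (carrier R) \<le> 3 * card (circle R t)" using card_circle_ge[OF assms] pos by linarith
  then have "(card (carrier R))\<^sup>2 \<le> (3 * card (circle R t))\<^sup>2" by (rule power_mono) simp
  then show "card (plane R) \<le> 9 * (card (circle R t))\<^sup>2" by (simp add: card_plane power_mult_distrib)
qed (use assms in \<open>simp_all add: finite_plane plane_diff_circle_irrefl card_circle_around
    card_circles_intersection plane_diff_circle_sym[where t = t]\<close>)

section \<open>The forms as iterated averages\<close>

lemma sum_PiE_insert:
  assumes "i \<notin> I"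
  shows "(\<Sum>x\<in>insert i I \<rightarrow>\<^sub>E B. h x) = (\<Sum>a\<in>B. \<Sum>x\<in>I \<rightarrow>\<^sub>E B. h (x(i := a)))"
proof -
  have "(\<Sum>x\<in>insert i I \<rightarrow>\<^sub>E B. h x) = (\<Sum>(a, x)\<in>B \<times> (I \<rightarrow>\<^sub>E B). h (x(i := a)))"
    unfolding PiE_insert_eq by (subst sum.reindex[OF inj_combinator[OF assms]]) (simp add: case_prod_unfold)
  then show ?thesis by (simp add: sum.cartesian_product)
qed

definition edge_pairs :: "graph \<Rightarrow> (nat \<times> nat) set" where
  "edge_pairs G = {(i, j). i < j \<and> {i, j} \<in> edges G}"

lemma edge_pairs_simps:
  "edge_pairs P2 = {(1, 2), (2, 3)}"
  "edge_pairs P3 = {(1, 2), (2, 3), (3, 4)}"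
  "edge_pairs K3_tail = {(1, 2), (2, 3), (3, 4), (1, 3)}"
  "edge_pairs Y_shape = {(1, 3), (2, 3), (3, 4)}"
  "edge_pairs K3 = {(1, 2), (2, 3), (1, 3)}"
  "edge_pairs C4 = {(1, 2), (2, 3), (3, 4), (1, 4)}"
  "edge_pairs C4_diag = {(1, 2), (2, 3), (3, 4), (1, 4), (1, 3)}"
  by (auto simp: edge_pairs_def doubleton_eq_iff)

lemma vertices_simps:
  "nverts G = 3 \<Longrightarrow> vertices G = {1, 2, 3}" "nverts G = 4 \<Longrightarrow> vertices G = {1, 2, 3, 4}"
  by (auto simp: vertices_def)

definition circle_kernel :: "('a, 'm) ring_scheme \<Rightarrow> 'a \<Rightarrow> 'a \<times> 'a \<Rightarrow> 'a \<times> 'a \<Rightarrow> real" where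
  "circle_kernel R t x y = indicator (circle R t) (plane_diff R x y)"

lemma circle_kernel_nonneg [simp]: "0 \<le> circle_kernel R t x y"
  by (simp add: circle_kernel_def)

lemma graph_form_eq:
  "graph_form R t G f = (\<Sum>x \<in> vertices G \<rightarrow>\<^sub>E plane R.
      (\<Prod>(i, j) \<in> edge_pairs G. circle_kernel R t (x i) (x j)) * (\<Prod>l\<in>vertices G. f l (x l))) / normalizer R t G"
  by (simp add: graph_form_def edge_pairs_def circle_kernel_def)

lemma graph_form_P2:
  "graph_form R t P2 f = (\<Sum>a\<in>plane R. \<Sum>b\<in>plane R. \<Sum>c\<in>plane R.
      (circle_kernel R t a b * circle_kernel R t b c) * (f 1 a * f 2 b * f 3 c)) / normalizer R t P2"
  unfolding graph_form_eq by (simp add: vertices_simps edge_pairs_simps sum_PiE_insert mult.assoc)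

lemma graph_form_P3:
  "graph_form R t P3 f = (\<Sum>a\<in>plane R. \<Sum>b\<in>plane R. \<Sum>c\<in>plane R. \<Sum>e\<in>plane R.
      (circle_kernel R t a b * circle_kernel R t b c * circle_kernel R t c e) * (f 1 a * f 2 b * f 3 c * f 4 e)) / normalizer R t P3"
  unfolding graph_form_eq by (simp add: vertices_simps edge_pairs_simps sum_PiE_insert mult.assoc)

lemma graph_form_Y_shape:
  "graph_form R t Y_shape f = (\<Sum>a\<in>plane R. \<Sum>b\<in>plane R. \<Sum>c\<in>plane R. \<Sum>e\<in>plane R.
      (circle_kernel R t a c * circle_kernel R t b c * circle_kernel R t c e) * (f 1 a * f 2 b * f 3 c * f 4 e)) / normalizer R t Y_shape"
  unfolding graph_form_eq by (simp add: vertices_simps edge_pairs_simps sum_PiE_insert mult.assoc)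

lemma graph_form_K3_tail:
  "graph_form R t K3_tail f = (\<Sum>a\<in>plane R. \<Sum>b\<in>plane R. \<Sum>c\<in>plane R. \<Sum>e\<in>plane R.
      (circle_kernel R t a b * circle_kernel R t b c * circle_kernel R t c e * circle_kernel R t a c) * (f 1 a * f 2 b * f 3 c * f 4 e))
      / normalizer R t K3_tail"
  unfolding graph_form_eq by (simp add: vertices_simps edge_pairs_simps sum_PiE_insert mult.assoc)

lemma sum_rotate3: "(\<Sum>a\<in>A. \<Sum>b\<in>B. \<Sum>c\<in>C. h a b c) = (\<Sum>c\<in>C. \<Sum>a\<in>A. \<Sum>b\<in>B. h a b c)"
proof -
  have "(\<Sum>a\<in>A. \<Sum>b\<in>B. \<Sum>c\<in>C. h a b c) = (\<Sum>a\<in>A. \<Sum>c\<in>C. \<Sum>b\<in>B. h a b c)"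
    by (rule sum.cong[OF refl]) (rule sum.swap)
  also have "\<dots> = (\<Sum>c\<in>C. \<Sum>a\<in>A. \<Sum>b\<in>B. h a b c)" by (rule sum.swap)
  finally show ?thesis .
qed

text \<open>The value at \<open>\<infinity>\<close> is \<open>1 / 0 = 0\<close>, as it should be.\<close>

definition inv_exp :: "ereal \<Rightarrow> real" where
  "inv_exp p = 1 / real_of_ereal p"

lemma inv_exp_bounds:
  assumes "1 \<le> p"
  shows "0 \<le> inv_exp p" "inv_exp p \<le> 1"
  unfolding inv_exp_def using assms by (cases p; auto simp: one_ereal_def)+

locale circle_graph = odd_finite_field +
  fixes t
  assumes t: "t \<in> carrier R" "t \<noteq> \<zero>"

sublocale circle_graph \<subseteq> gr: codegree_graph "plane R" "\<lambda>x y. plane_diff R x y \<in> circle R t" "card (circle R t)"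
  using t by (rule codegree_graph_circle)

context circle_graph
begin

lemma circle_kernel_sym: "\<lbrakk>x \<in> plane R; y \<in> plane R\<rbrakk> \<Longrightarrow> circle_kernel R t x y = circle_kernel R t y x"
  using plane_diff_circle_sym[of x y t] by (simp add: circle_kernel_def indicator_def)

lemma sum_kernel: "(\<Sum>y\<in>plane R. circle_kernel R t x y * f y) = sum f (gr.nbr x)"
  unfolding gr.nbr_def circle_kernel_def using finite_plane
  by (intro sum.mono_neutral_cong_right) (auto simp: indicator_def)

lemma sum_kernel': "x \<in> plane R \<Longrightarrow> (\<Sum>y\<in>plane R. circle_kernel R t y x * f y) = sum f (gr.nbr x)"
  unfolding sum_kernel[symmetric] by (intro sum.cong refl) (simp add: circle_kernel_sym)

lemma sum_nbr_eq_avg: "sum f (gr.nbr x) = real (card (circle R t)) * gr.avg f x"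
  using gr.degree_pos by (simp add: gr.avg_def)

lemma graph_form_P2_eq:
  "graph_form R t P2 f = (\<Sum>b\<in>plane R. f 2 b * gr.avg (f 1) b * gr.avg (f 3) b) / real (card (plane R))"
proof -
  let ?d = "real (card (circle R t))"
  have "(\<Sum>a\<in>plane R. \<Sum>b\<in>plane R. \<Sum>c\<in>plane R.
      (circle_kernel R t a b * circle_kernel R t b c) * (f 1 a * f 2 b * f 3 c))
    = (\<Sum>b\<in>plane R. f 2 b * (\<Sum>a\<in>plane R. circle_kernel R t a b * f 1 a) * (\<Sum>c\<in>plane R. circle_kernel R t b c * f 3 c))"
    by (subst sum.swap) (simp add: sum_distrib_left sum_distrib_right mult_ac)
  also have "\<dots> = (\<Sum>b\<in>plane R. ?d\<^sup>2 * (f 2 b * gr.avg (f 1) b * gr.avg (f 3) b))"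
    by (intro sum.cong refl) (simp add: sum_kernel sum_kernel' sum_nbr_eq_avg power2_eq_square)
  finally show ?thesis
    using gr.degree_pos
    by (simp add: graph_form_P2 normalizer_def card_plane flip: sum_distrib_left)
qed

lemma graph_form_P3_eq:
  "graph_form R t P3 f = (\<Sum>b\<in>plane R. f 2 b * gr.avg (f 1) b * gr.avg (\<lambda>c. f 3 c * gr.avg (f 4) c) b)
      / real (card (plane R))"
proof -
  let ?d = "real (card (circle R t))"
  have inner: "(\<Sum>c\<in>plane R. \<Sum>e\<in>plane R.
      (circle_kernel R t a b * circle_kernel R t b c * circle_kernel R t c e) * (f 1 a * f 2 b * f 3 c * f 4 e))
    = (circle_kernel R t a b * f 1 a)
        * (f 2 b * (\<Sum>c\<in>plane R. circle_kernel R t b c * (f 3 c * (\<Sum>e\<in>plane R. circle_kernel R t c e * f 4 e))))" for a b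
    unfolding sum_distrib_left by (intro sum.cong refl) (simp add: mult_ac)
  have "(\<Sum>a\<in>plane R. \<Sum>b\<in>plane R. \<Sum>c\<in>plane R. \<Sum>e\<in>plane R.
      (circle_kernel R t a b * circle_kernel R t b c * circle_kernel R t c e) * (f 1 a * f 2 b * f 3 c * f 4 e))
    = (\<Sum>b\<in>plane R. \<Sum>a\<in>plane R. (circle_kernel R t a b * f 1 a)
        * (f 2 b * (\<Sum>c\<in>plane R. circle_kernel R t b c * (f 3 c * (\<Sum>e\<in>plane R. circle_kernel R t c e * f 4 e)))))"
    unfolding inner by (rule sum.swap)
  also have "\<dots> = (\<Sum>b\<in>plane R. ?d ^ 3 * (f 2 b * gr.avg (f 1) b * gr.avg (\<lambda>c. f 3 c * gr.avg (f 4) c) b))"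
  proof (rule sum.cong[OF refl])
    fix b assume b: "b \<in> plane R"
    have "gr.avg (\<lambda>c. f 3 c * (?d * gr.avg (f 4) c)) b = ?d * gr.avg (\<lambda>c. f 3 c * gr.avg (f 4) c) b"
      by (simp add: mult.left_commute flip: gr.avg_cmult)
    then show "(\<Sum>a\<in>plane R. (circle_kernel R t a b * f 1 a)
        * (f 2 b * (\<Sum>c\<in>plane R. circle_kernel R t b c * (f 3 c * (\<Sum>e\<in>plane R. circle_kernel R t c e * f 4 e)))))
      = ?d ^ 3 * (f 2 b * gr.avg (f 1) b * gr.avg (\<lambda>c. f 3 c * gr.avg (f 4) c) b)"
      unfolding sum_distrib_right[symmetric] sum_kernel'[OF b] sum_kernel sum_nbr_eq_avg
      by (simp add: power3_eq_cube)
  qed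
  finally show ?thesis
    using gr.degree_pos
    by (simp add: graph_form_P3 normalizer_def card_plane flip: sum_distrib_left)
qed

lemma graph_form_Y_shape_eq:
  "graph_form R t Y_shape f = (\<Sum>c\<in>plane R. f 3 c * gr.avg (f 1) c * gr.avg (f 2) c * gr.avg (f 4) c)
      / real (card (plane R))"
proof -
  let ?d = "real (card (circle R t))"
  have "(\<Sum>a\<in>plane R. \<Sum>b\<in>plane R. \<Sum>c\<in>plane R. \<Sum>e\<in>plane R.
      (circle_kernel R t a c * circle_kernel R t b c * circle_kernel R t c e) * (f 1 a * f 2 b * f 3 c * f 4 e))
    = (\<Sum>c\<in>plane R. f 3 c * (\<Sum>a\<in>plane R. circle_kernel R t a c * f 1 a) * (\<Sum>b\<in>plane R. circle_kernel R t b c * f 2 b)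
        * (\<Sum>e\<in>plane R. circle_kernel R t c e * f 4 e))"
    by (subst sum_rotate3) (simp add: sum_distrib_left sum_distrib_right mult_ac)
  also have "\<dots> = (\<Sum>c\<in>plane R. ?d ^ 3 * (f 3 c * gr.avg (f 1) c * gr.avg (f 2) c * gr.avg (f 4) c))"
    by (intro sum.cong refl)
      (simp add: sum_kernel sum_kernel' sum_nbr_eq_avg power3_eq_cube)
  finally show ?thesis
    using gr.degree_pos
    by (simp add: graph_form_Y_shape normalizer_def card_plane flip: sum_distrib_left)
qed

text \<open>The tail average absorbs one of the two factors |S_t| of the normalizer; the other one
  stays, matching the d in the triangle bounds. Vertex 3 comes first because it carries the
  tail.\<close>

lemma graph_form_K3_tail_eq:
  "graph_form R t K3_tail f = gr.triangle_sum (\<lambda>c a b. f 3 c * gr.avg (f 4) c * f 1 a * f 2 b)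
      / (real (card (circle R t)) * real (card (plane R)))"
proof -
  let ?d = "real (card (circle R t))"
  have "(\<Sum>a\<in>plane R. \<Sum>b\<in>plane R. \<Sum>c\<in>plane R. \<Sum>e\<in>plane R.
      (circle_kernel R t a b * circle_kernel R t b c * circle_kernel R t c e * circle_kernel R t a c) * (f 1 a * f 2 b * f 3 c * f 4 e))
    = (\<Sum>c\<in>plane R. \<Sum>a\<in>plane R. circle_kernel R t a c * (\<Sum>b\<in>plane R. circle_kernel R t a b * (circle_kernel R t b c
        * (f 3 c * (\<Sum>e\<in>plane R. circle_kernel R t c e * f 4 e) * f 1 a * f 2 b))))"
    by (subst sum_rotate3) (simp add: sum_distrib_left sum_distrib_right mult_ac)
  also have "\<dots> = (\<Sum>c\<in>plane R. \<Sum>a\<in>gr.nbr c. \<Sum>b\<in>gr.nbr c \<inter> gr.nbr a.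
      f 3 c * (?d * gr.avg (f 4) c) * f 1 a * f 2 b)"
  proof (rule sum.cong[OF refl])
    fix c assume c: "c \<in> plane R"
    have "(\<Sum>b\<in>gr.nbr a. circle_kernel R t b c * h b) = (\<Sum>b\<in>gr.nbr c \<inter> gr.nbr a. h b)" for a and h :: "'a \<times> 'a \<Rightarrow> real"
    proof -
      have "(\<Sum>b\<in>gr.nbr a. circle_kernel R t b c * h b) = (\<Sum>b\<in>gr.nbr a. if b \<in> gr.nbr c then h b else 0)"
        using c by (intro sum.cong refl) (auto simp: gr.nbr_def circle_kernel_def plane_diff_circle_sym[of _ c])
      then show ?thesis by (simp add: sum.If_cases Int_commute)
    qed
    then show "(\<Sum>a\<in>plane R. circle_kernel R t a c * (\<Sum>b\<in>plane R. circle_kernel R t a b * (circle_kernel R t b c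
        * (f 3 c * (\<Sum>e\<in>plane R. circle_kernel R t c e * f 4 e) * f 1 a * f 2 b))))
      = (\<Sum>a\<in>gr.nbr c. \<Sum>b\<in>gr.nbr c \<inter> gr.nbr a. f 3 c * (?d * gr.avg (f 4) c) * f 1 a * f 2 b)"
      using c by (simp only: sum_kernel' sum_kernel[of c "f 4"]  sum_kernel sum_nbr_eq_avg[of "f 4"])
  qed
  also have "\<dots> = ?d * gr.triangle_sum (\<lambda>c a b. f 3 c * gr.avg (f 4) c * f 1 a * f 2 b)"
    by (simp add: gr.triangle_sum_def sum_distrib_left mult_ac)
  finally show ?thesis
    using gr.degree_pos
    by (simp add: graph_form_K3_tail normalizer_def card_plane power2_eq_square)
qed

section \<open>From arbitrary functions to densities\<close>

text \<open>For finite p the natural density (f / L)^p, L being the norm, may vanish, so it is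
  averaged with the constant 1; this costs a factor 2^(1/p) <= 2. For p = infinity the exponent is 0
  and the constant density serves.\<close>

lemma density_majorant:
  assumes p: "1 \<le> p" and f: "\<And>x. x \<in> plane R \<Longrightarrow> 0 \<le> f x"
  obtains F where "gr.density F"
    "\<And>x. x \<in> plane R \<Longrightarrow> f x \<le> 2 * Lp_norm R p f * F x powr (inv_exp p)"
proof -
  let ?L = "Lp_norm R p f" and ?N = "real (card (plane R))"
  have ne: "carrier R \<noteq> {}" using zero_closed by blast
  have L0: "0 \<le> ?L" using Lp_norm_nonneg[OF finite_carrier ne] .
  have bound: "f x \<le> (real (card (carrier R)))\<^sup>2 * ?L" if "x \<in> plane R" for x
    using value_le_Lp_norm[OF finite_carrier p that, of f] by simp
  consider "?L = 0" | "0 < ?L" "p = \<infinity>" | "0 < ?L" "p \<noteq> \<infinity>" using L0 by linarith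
  then show ?thesis
  proof cases
    case 1
    then show ?thesis using that[OF gr.density_one] bound by fastforce
  next
    case 2
    have inf: "inv_exp p = 0" using 2 by (simp add: inv_exp_def)
    have "f x \<le> 2 * ?L" if "x \<in> plane R" for x
    proof -
      have "\<bar>f x\<bar> \<le> ?L"
        unfolding Lp_norm_def using 2 finite_plane that by (auto intro: Max_ge)
      then show ?thesis using L0 by linarith
    qed
    then show ?thesis using that[OF gr.density_one] by (simp add: inf)
  next
    case 3
    define r where "r = real_of_ereal p"
    have r: "1 \<le> r" using p 3 unfolding r_def by (cases p) (auto simp: one_ereal_def)
    define F where "F x = ((f x / ?L) powr r + 1) / 2" for x
    have N: "0 < ?N" using finite_plane zero_closed by (auto simp: card_gt_0_iff plane_def)
    have "?L = ((\<Sum>x\<in>plane R. f x powr r) / ?N) powr (1 / r)"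
      using 3 f by (simp add: Lp_norm_def r_def card_plane cong: sum.cong)
    then have "?L powr r = (\<Sum>x\<in>plane R. f x powr r) / ?N"
      using r N by (simp add: powr_powr sum_nonneg)
    then have "(\<Sum>x\<in>plane R. f x powr r) = ?N * ?L powr r" using N by (simp add: field_simps)
    moreover have "(\<Sum>x\<in>plane R. (f x / ?L) powr r) = (\<Sum>x\<in>plane R. f x powr r) / ?L powr r"
      using f 3(1) by (simp add: powr_divide sum_divide_distrib)
    ultimately have "(\<Sum>x\<in>plane R. (f x / ?L) powr r) = ?N" using 3(1) by simp
    then have "sum F (plane R) = ?N"
      by (simp add: F_def sum.distrib flip: sum_divide_distrib)
    then have "gr.density F" by (auto simp: gr.density_def F_def intro: add_nonneg_pos)
    moreover have "f x \<le> 2 * ?L * F x powr (inv_exp p)" if "x \<in> plane R" for x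
    proof -
      have F0: "0 \<le> F x" by (simp add: F_def)
      have "f x / ?L = ((f x / ?L) powr r) powr (1 / r)"
        using r f[OF that] 3(1) by (simp add: powr_powr)
      also have "\<dots> \<le> (2 * F x) powr (1 / r)" using r by (intro powr_mono2) (auto simp: F_def)
      also have "\<dots> = 2 powr (1 / r) * F x powr (1 / r)" using F0 by (simp add: powr_mult)
      also have "\<dots> \<le> 2 powr 1 * F x powr (1 / r)" using r by (intro mult_right_mono powr_mono) auto
      finally show ?thesis using 3(1) by (simp add: inv_exp_def r_def field_simps)
    qed
    ultimately show ?thesis by (rule that)
  qed
qed

end

lemma graph_form_mono:
  assumes "\<And>l x. \<lbrakk>l \<in> vertices G; x \<in> plane R\<rbrakk> \<Longrightarrow> 0 \<le> f l x \<and> f l x \<le> g l x"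
  shows "graph_form R t G f \<le> graph_form R t G g"
proof -
  have "(\<Prod>l\<in>vertices G. f l (x l)) \<le> (\<Prod>l\<in>vertices G. g l (x l))"
    if "x \<in> vertices G \<rightarrow>\<^sub>E plane R" for x
    using assms that by (intro prod_mono) (auto simp: PiE_def Pi_def)
  then show ?thesis
    unfolding graph_form_eq
    by (intro divide_right_mono sum_mono mult_left_mono) (auto intro!: prod_nonneg simp: normalizer_def)
qed

lemma graph_form_scale:
  "graph_form R t G (\<lambda>l x. c l * f l x) = (\<Prod>l\<in>vertices G. c l) * graph_form R t G f"
  unfolding graph_form_eq by (simp add: prod.distrib sum_distrib_left mult_ac)

text \<open>The form is monotone and homogeneous in each function, so it is enough to test powers of
  densities, at a cost of 2 per vertex. The maximum with 1 is due to the constant having to be at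
  least 1.\<close>

lemma bounded_formI:
  assumes p: "\<And>l. l \<in> vertices G \<Longrightarrow> 1 \<le> p l"
    and bound: "\<And>R :: nat ring. \<And>t F. \<lbrakk>circle_graph R t; \<And>l. l \<in> vertices G \<Longrightarrow> codegree_graph.density (plane R) (F l)\<rbrakk>
        \<Longrightarrow> graph_form R t G (\<lambda>l x. F l x powr (inv_exp (p l))) \<le> C"
  shows "bounded_form G p"
  unfolding bounded_form_def
proof (intro exI conjI allI impI ballI)
  let ?K = "2 ^ card (vertices G) * C"
  show "1 \<le> max 1 ?K" by simp
  fix R :: "nat ring" and t
  assume adm: "admissible_field R" and t: "t \<in> carrier R - {\<zero>\<^bsub>R\<^esub>}"
  interpret circle_graph R t
    using admissible_imp_odd_finite_field[OF adm] t by (simp add: circle_graph_def circle_graph_axioms_def)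
  have ne: "carrier R \<noteq> {}" using zero_closed by blast
  have in_bounds: "max 1 ?K \<in> form_bounds R t G p"
    unfolding form_bounds_def
  proof (intro CollectI allI impI)
    fix f :: "nat \<Rightarrow> nat \<times> nat \<Rightarrow> real"
    assume f: "\<forall>l\<in>vertices G. \<forall>x\<in>plane R. 0 \<le> f l x"
    let ?n = "\<lambda>l. Lp_norm R (p l) (f l)"
    have n0: "0 \<le> (\<Prod>l\<in>vertices G. ?n l)"
      by (intro prod_nonneg) (auto intro: Lp_norm_nonneg[OF finite_carrier ne])
    have "\<exists>F. gr.density F \<and> (\<forall>x\<in>plane R. f l x \<le> 2 * ?n l * F x powr (inv_exp (p l)))"
      if "l \<in> vertices G" for l
      using density_majorant[OF p[OF that], of "f l"] f that by metis
    then obtain F where F: "\<And>l. l \<in> vertices G \<Longrightarrow> gr.density (F l)"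
      "\<And>l x. \<lbrakk>l \<in> vertices G; x \<in> plane R\<rbrakk> \<Longrightarrow> f l x \<le> 2 * ?n l * F l x powr (inv_exp (p l))"
      by metis
    have "graph_form R t G f \<le> graph_form R t G (\<lambda>l x. (2 * ?n l) * F l x powr (inv_exp (p l)))"
      using f F(2) by (intro graph_form_mono) auto
    also have "\<dots> = (2 ^ card (vertices G) * (\<Prod>l\<in>vertices G. ?n l))
        * graph_form R t G (\<lambda>l x. F l x powr (inv_exp (p l)))"
      unfolding graph_form_scale by (simp add: prod.distrib)
    also have "\<dots> \<le> (2 ^ card (vertices G) * (\<Prod>l\<in>vertices G. ?n l)) * C"
      using n0 by (intro mult_left_mono bound circle_graph_axioms F) auto
    also have "\<dots> = ?K * (\<Prod>l\<in>vertices G. ?n l)" by simp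
    also have "\<dots> \<le> max 1 ?K * (\<Prod>l\<in>vertices G. ?n l)" using n0 by (intro mult_right_mono) auto
    finally show "graph_form R t G f \<le> max 1 ?K * (\<Prod>l\<in>vertices G. ?n l)" .
  qed
  show "form_const R t G p \<le> max 1 ?K"
    by (rule form_const_least(2)[OF finite_carrier ne p in_bounds])
qed

lemma bounded_formE:
  assumes "bounded_form G p" and p: "\<And>l. l \<in> vertices G \<Longrightarrow> 1 \<le> p l"
  obtains C where "1 \<le> C"
    "\<And>R :: nat ring. \<And>t f. \<lbrakk>admissible_field R; t \<in> carrier R - {\<zero>\<^bsub>R\<^esub>};
        \<And>l x. \<lbrakk>l \<in> vertices G; x \<in> plane R\<rbrakk> \<Longrightarrow> 0 \<le> f l x\<rbrakk>
      \<Longrightarrow> graph_form R t G f \<le> C * (\<Prod>l\<in>vertices G. Lp_norm R (p l) (f l))"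
proof -
  obtain C where C: "1 \<le> C" "\<And>R :: nat ring. \<And>t. \<lbrakk>admissible_field R; t \<in> carrier R - {\<zero>\<^bsub>R\<^esub>}\<rbrakk>
      \<Longrightarrow> form_const R t G p \<le> C"
    using assms(1) unfolding bounded_form_def by blast
  show ?thesis
  proof (rule that[OF C(1)])
    fix R :: "nat ring" and t and f :: "nat \<Rightarrow> nat \<times> nat \<Rightarrow> real"
    assume adm: "admissible_field R" and t: "t \<in> carrier R - {\<zero>\<^bsub>R\<^esub>}"
      and f: "\<And>l x. \<lbrakk>l \<in> vertices G; x \<in> plane R\<rbrakk> \<Longrightarrow> 0 \<le> f l x"
    interpret odd_finite_field R by (rule admissible_imp_odd_finite_field[OF adm])
    have ne: "carrier R \<noteq> {}" using zero_closed by blast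
    have "form_const R t G p \<in> form_bounds R t G p"
      by (rule form_const_least(1)[where p = p, OF finite_carrier ne p])
    then have "graph_form R t G f \<le> form_const R t G p * (\<Prod>l\<in>vertices G. Lp_norm R (p l) (f l))"
      using f unfolding form_bounds_def by blast
    also have "\<dots> \<le> C * (\<Prod>l\<in>vertices G. Lp_norm R (p l) (f l))"
      using C(2)[OF adm t] by (intro mult_right_mono prod_nonneg) (auto intro: Lp_norm_nonneg[OF finite_carrier ne])
    finally show "graph_form R t G f \<le> C * (\<Prod>l\<in>vertices G. Lp_norm R (p l) (f l))" .
  qed
qed

lemma bounded_form_imp_restricted:
  assumes "bounded_form G p" "\<And>l. l \<in> vertices G \<Longrightarrow> 1 \<le> p l"
  shows "restricted_bounded_form G p"
proof -
  obtain C where C: "1 \<le> C"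
    "\<And>R :: nat ring. \<And>t f. \<lbrakk>admissible_field R; t \<in> carrier R - {\<zero>\<^bsub>R\<^esub>};
        \<And>l x. \<lbrakk>l \<in> vertices G; x \<in> plane R\<rbrakk> \<Longrightarrow> 0 \<le> f l x\<rbrakk>
      \<Longrightarrow> graph_form R t G f \<le> C * (\<Prod>l\<in>vertices G. Lp_norm R (p l) (f l))"
    using bounded_formE[OF assms] by blast
  show ?thesis
    unfolding restricted_bounded_form_def using C(1)
    by (intro exI[of _ C] conjI allI impI ballI C(2)) auto
qed

section \<open>Sufficient exponent conditions for the smaller graphs\<close>

lemma bounded_form_P2:
  assumes p: "\<forall>l\<in>{1..3}. 1 \<le> p l"
    and le: "inv_exp (p 2) + gain (inv_exp (p 1)) + gain (inv_exp (p 3)) \<le> 1"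
  shows "bounded_form P2 p"
proof (rule bounded_formI[where C = 25])
  fix R :: "nat ring" and t F
  assume "circle_graph R t" and F: "\<And>l. l \<in> vertices P2 \<Longrightarrow> codegree_graph.density (plane R) (F l)"
  interpret circle_graph R t by fact
  have N: "0 < real (card (plane R))" using card_carrier_ge by (simp add: card_plane)
  show "graph_form R t P2 (\<lambda>l x. F l x powr inv_exp (p l)) \<le> 25"
    unfolding graph_form_P2_eq pos_divide_le_eq[OF N]
    using p F le by (intro gr.path2_bound inv_exp_bounds) (auto simp: vertices_simps)
qed (use p in \<open>auto simp: vertices_def\<close>)

lemma bounded_form_P3:
  assumes p: "\<forall>l\<in>{1..4}. 1 \<le> p l"
    and le: "inv_exp (p 3) + gain (inv_exp (p 4)) \<le> 1"
      "inv_exp (p 2) + gain (inv_exp (p 1)) + gain (inv_exp (p 3) + gain (inv_exp (p 4))) \<le> 1"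
  shows "bounded_form P3 p"
proof (rule bounded_formI[where C = 125])
  fix R :: "nat ring" and t F
  assume "circle_graph R t" and F: "\<And>l. l \<in> vertices P3 \<Longrightarrow> codegree_graph.density (plane R) (F l)"
  interpret circle_graph R t by fact
  have N: "0 < real (card (plane R))" using card_carrier_ge by (simp add: card_plane)
  show "graph_form R t P3 (\<lambda>l x. F l x powr inv_exp (p l)) \<le> 125"
    unfolding graph_form_P3_eq pos_divide_le_eq[OF N]
    using p F le by (intro gr.path3_bound inv_exp_bounds) (auto simp: vertices_simps)
qed (use p in \<open>auto simp: vertices_def\<close>)

lemma bounded_form_Y_shape:
  assumes p: "\<forall>l\<in>{1..4}. 1 \<le> p l"
    and le: "inv_exp (p 3) + gain (inv_exp (p 1)) + gain (inv_exp (p 2)) + gain (inv_exp (p 4)) \<le> 1"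
  shows "bounded_form Y_shape p"
proof (rule bounded_formI[where C = 125])
  fix R :: "nat ring" and t F
  assume "circle_graph R t" and F: "\<And>l. l \<in> vertices Y_shape \<Longrightarrow> codegree_graph.density (plane R) (F l)"
  interpret circle_graph R t by fact
  have N: "0 < real (card (plane R))" using card_carrier_ge by (simp add: card_plane)
  show "graph_form R t Y_shape (\<lambda>l x. F l x powr inv_exp (p l)) \<le> 125"
    unfolding graph_form_Y_shape_eq pos_divide_le_eq[OF N]
    using p F le by (intro gr.star_bound inv_exp_bounds) (auto simp: vertices_simps)
qed (use p in \<open>auto simp: vertices_def\<close>)

lemma bounded_form_K3_tail:
  assumes p: "\<forall>l\<in>{1..4}. 1 \<le> p l"
    and le: "2 * inv_exp (p 1) + inv_exp (p 2) + (inv_exp (p 3) + gain (inv_exp (p 4))) \<le> 2"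
      "inv_exp (p 1) + 2 * inv_exp (p 2) + (inv_exp (p 3) + gain (inv_exp (p 4))) \<le> 2"
      "inv_exp (p 1) + inv_exp (p 2) + 2 * (inv_exp (p 3) + gain (inv_exp (p 4))) \<le> 2"
  shows "bounded_form K3_tail p"
proof (rule bounded_formI[where C = 1155])
  fix R :: "nat ring" and t F
  assume "circle_graph R t" and F: "\<And>l. l \<in> vertices K3_tail \<Longrightarrow> codegree_graph.density (plane R) (F l)"
  interpret circle_graph R t by fact
  have N: "0 < real (card (circle R t)) * real (card (plane R))"
    using card_carrier_ge gr.degree_pos by (simp add: card_plane)
  show "graph_form R t K3_tail (\<lambda>l x. F l x powr inv_exp (p l)) \<le> 1155"
    unfolding graph_form_K3_tail_eq pos_divide_le_eq[OF N] mult.assoc[symmetric, of 1155]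
    using p F le by (intro gr.triangle_tail_bound inv_exp_bounds) (auto simp: vertices_simps)
qed (use p in \<open>auto simp: vertices_def\<close>)

section \<open>Necessary conditions\<close>

lemma Lp_norm_indicator:
  assumes fin: "finite (carrier R)" and A: "A \<subseteq> plane R" "A \<noteq> {}" and p: "1 \<le> p"
  shows "Lp_norm R p (indicator A) = (real (card A) / (real (card (carrier R)))\<^sup>2) powr (inv_exp p)"
proof -
  have finp: "finite (plane R)" using fin by (simp add: plane_def)
  have finA: "finite A" using finp A(1) by (rule finite_subset[rotated])
  obtain a where a: "a \<in> A" using A(2) by blast
  then have "a \<in> plane R" using A(1) by blast
  then have ne: "card (carrier R) \<noteq> 0" using fin by (auto simp: plane_def)
  \<comment> \<open>At p = infinity the exponent is 0, and a nonzero base makes the power 1, the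
    maximum of the indicator.\<close>
  have cA: "card A \<noteq> 0" using finA A(2) by simp
  show ?thesis
  proof (cases "p = \<infinity>")
    case True
    have "Max ((\<lambda>x. \<bar>indicator A x :: real\<bar>) ` plane R) = 1"
      using finp a \<open>a \<in> plane R\<close> by (intro Max_eqI) (auto simp: indicator_def intro!: image_eqI[of _ _ a])
    then show ?thesis using True ne cA by (simp add: Lp_norm_def inv_exp_def)
  next
    case False
    define r where "r = real_of_ereal p"
    have r: "1 \<le> r" using p False unfolding r_def by (cases p) (auto simp: one_ereal_def)
    have "(\<Sum>x\<in>plane R. \<bar>indicator A x\<bar> powr r) = (\<Sum>x\<in>plane R. indicator A x)"
      using r by (intro sum.cong refl) (auto simp: indicator_def)
    also have "\<dots> = real (card A)"
      using finp A(1) by (subst sum.mono_neutral_cong_right[of _ A _ "\<lambda>_. 1"]) auto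
    finally show ?thesis using False by (simp add: Lp_norm_def r_def inv_exp_def)
  qed
qed

text \<open>In the manner of Euclid: a prime divisor r of 3 f^2 - 1 with f = (N + 3)! does not
  divide f and so exceeds N + 3, and (3 f)^2 = 3 * 3 f^2 is congruent to 3 modulo r.\<close>

lemma prime_with_square_root_of_three:
  fixes N :: nat
  obtains r :: nat and a :: int where "Factorial_Ring.prime r" "N < r" "3 < r" "[a * a = 3] (mod int r)"
proof -
  define f :: nat where "f = fact (N + 3)"
  have f: "1 \<le> f" by (simp add: f_def fact_ge_1)
  then have "1 \<le> f\<^sup>2" by simp
  then have "3 * f\<^sup>2 - 1 \<noteq> 1" by linarith
  then obtain r where r: "Factorial_Ring.prime r" "r dvd 3 * f\<^sup>2 - 1" using prime_factor_nat by blast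
  have "\<not> r dvd f"
  proof
    assume "r dvd f"
    then have "r dvd 3 * f\<^sup>2" by (simp add: power2_eq_square)
    then have "r dvd 3 * f\<^sup>2 - (3 * f\<^sup>2 - 1)" using r(2) by (rule dvd_diff_nat)
    moreover have "3 * f\<^sup>2 - (3 * f\<^sup>2 - 1) = 1" using \<open>1 \<le> f\<^sup>2\<close> by linarith
    ultimately show False using r(1) by (simp add: prime_nat_iff)
  qed
  then have big: "N + 3 < r"
    unfolding f_def using r(1) by (metis dvd_fact not_le prime_ge_1_nat)
  have "int r dvd 3 * (int f)\<^sup>2 - 1"
  proof -
    have "int (3 * f\<^sup>2 - 1) = 3 * (int f)\<^sup>2 - 1" using \<open>1 \<le> f\<^sup>2\<close> by (simp add: of_nat_diff)
    then show ?thesis using r(2) by (metis of_nat_dvd_iff)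
  qed
  then have "int r dvd 3 * (3 * (int f)\<^sup>2 - 1)" by (rule dvd_mult)
  also have "3 * (3 * (int f)\<^sup>2 - 1) = (3 * int f) * (3 * int f) - 3"
    by (simp add: power2_eq_square)
  finally have "[(3 * int f) * (3 * int f) = 3] (mod int r)" by (simp add: cong_iff_dvd_diff)
  then show ?thesis using that[of r "3 * int f"] r(1) big by simp
qed

text \<open>Prime fields do the job; they are copied to the natural numbers because
  \<open>bounded_form\<close> ranges over \<open>nat ring\<close>.\<close>

lemma admissible_fields_unbounded:
  obtains R :: "nat ring" where "admissible_field R" "N \<le> card (carrier R)"
proof -
  obtain r :: nat and a :: int where r: "Factorial_Ring.prime r" "N < r" "3 < r"
    and a: "[a * a = 3] (mod int r)"
    using prime_with_square_root_of_three by blast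
  define S where "S = residue_ring (int r)"
  interpret residues_prime r S using r(1) by unfold_locales (simp_all add: S_def)
  have card: "card (carrier S) = r" by (simp add: res_carrier_eq)
  have three: "\<one>\<^bsub>S\<^esub> \<oplus>\<^bsub>S\<^esub> \<one>\<^bsub>S\<^esub> \<oplus>\<^bsub>S\<^esub> \<one>\<^bsub>S\<^esub> = 3"
    using r(3) by (simp add: res_one_eq res_add_eq)
  have root: "(a mod int r) \<otimes>\<^bsub>S\<^esub> (a mod int r) = 3"
    using a r(3) by (simp add: res_mult_eq mod_mult_eq cong_def)
  have "odd r" using r prime_odd_nat by auto
  then have "\<exists>p k :: nat. Factorial_Ring.prime p \<and> odd p \<and> k \<ge> 1 \<and> card (carrier S) = p ^ k"
    using r(1) by (intro exI[of _ r] exI[of _ 1]) (simp add: card)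
  moreover have "\<exists>x\<in>carrier S. x \<otimes>\<^bsub>S\<^esub> x = 3"
    using root by (intro bexI[of _ "a mod int r"]) auto
  moreover have "(3 :: int) \<noteq> \<zero>\<^bsub>S\<^esub>" by (simp add: res_zero_eq)
  ultimately have "admissible_field S"
    unfolding admissible_field_def Let_def three using is_field finite by blast
  then obtain R :: "nat ring" where R: "admissible_field R" "S \<simeq> R"
    using admissible_field_nat_copy by blast
  then have "card (carrier R) = card (carrier S)"
    by (auto simp: is_ring_iso_def ring_iso_def dest!: bij_betw_same_card)
  then show ?thesis using that[OF R(1)] r(2) card by simp
qed

section \<open>Linear inequalities forced by test functions\<close>

text \<open>The assumption says that q^(e - 2) stays below \<open>K\<close> along an unbounded
  sequence of q.\<close>

lemma exponent_le_two:
  fixes e K :: real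
  assumes "\<And>N. \<exists>q::nat. N \<le> q \<and> 1 \<le> q \<and> 1 / (real q)\<^sup>2 \<le> K * real q powr (- e)"
  shows "e \<le> 2"
proof (rule ccontr)
  assume "\<not> e \<le> 2"
  then have e: "0 < e - 2" by simp
  obtain N :: nat where N: "\<bar>K\<bar> powr (1 / (e - 2)) < real N" using reals_Archimedean2 by blast
  obtain q :: nat where q: "N \<le> q" "1 \<le> q" "1 / (real q)\<^sup>2 \<le> K * real q powr (- e)"
    using assms by blast
  have "real q powr (e - 2) = real q powr e * (1 / (real q)\<^sup>2)"
    using q(2) by (simp add: powr_diff)
  also have "\<dots> \<le> real q powr e * (K * real q powr (- e))"
    using q(3) by (intro mult_left_mono) auto
  also have "\<dots> = K" using q(2) by (simp add: powr_minus)
  also have "\<dots> \<le> (\<bar>K\<bar> powr (1 / (e - 2))) powr (e - 2)" using e by (simp add: powr_powr)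
  also have "\<dots> < real q powr (e - 2)" using N q(1) e by (intro powr_less_mono2) auto
  finally show False by simp
qed

text \<open>\<open>T\<close> is a set of copies of \<open>G\<close> with the vertices in
  \<open>Z\<close> at the origin and the others on the unit circle. By its size the form of the
  indicators is at least q^-2, while the norm of the function at vertex l is q^(-2/p_l) for l in
  \<open>Z\<close> and at most 2 q^(-1/p_l) otherwise. Since boundedness is uniform in t, the radius
  t = 1 can be chosen.\<close>

lemma bounded_form_necessary:
  assumes bd: "bounded_form G p" and p: "\<And>l. l \<in> vertices G \<Longrightarrow> 1 \<le> p l"
    and T: "\<And>R :: nat ring. admissible_field R \<Longrightarrow> \<exists>T. T \<subseteq> vertices G \<rightarrow>\<^sub>E plane R
      \<and> card (circle R \<one>\<^bsub>R\<^esub>) ^ circle_exponent G \<le> card T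
      \<and> (\<forall>x\<in>T. (\<forall>(i, j)\<in>edge_pairs G. plane_diff R (x i) (x j) \<in> circle R \<one>\<^bsub>R\<^esub>)
          \<and> (\<forall>l\<in>vertices G. x l \<in> (if l \<in> Z then {(\<zero>\<^bsub>R\<^esub>, \<zero>\<^bsub>R\<^esub>)} else circle R \<one>\<^bsub>R\<^esub>)))"
  shows "(\<Sum>l\<in>vertices G. if l \<in> Z then 2 * inv_exp (p l) else inv_exp (p l)) \<le> 2"
proof -
  let ?V = "vertices G" and ?w = "\<lambda>l. if l \<in> Z then 2 * inv_exp (p l) else inv_exp (p l)"
  have finV: "finite ?V" by (simp add: vertices_def)
  obtain C where C: "1 \<le> C"
    "\<And>R :: nat ring. \<And>t f. \<lbrakk>admissible_field R; t \<in> carrier R - {\<zero>\<^bsub>R\<^esub>};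
        \<And>l x. \<lbrakk>l \<in> ?V; x \<in> plane R\<rbrakk> \<Longrightarrow> 0 \<le> f l x\<rbrakk>
      \<Longrightarrow> graph_form R t G f \<le> C * (\<Prod>l\<in>?V. Lp_norm R (p l) (f l))"
    using bounded_formE[OF bd p] by blast
  show ?thesis
  proof (rule exponent_le_two[where K = "C * 2 ^ card ?V"])
    fix N :: nat
    obtain R :: "nat ring" where adm: "admissible_field R" and N: "N \<le> card (carrier R)"
      using admissible_fields_unbounded by blast
    interpret odd_finite_field R by (rule admissible_imp_odd_finite_field[OF adm])
    let ?q = "real (card (carrier R))" and ?S = "circle R \<one>\<^bsub>R\<^esub>"
    define A where "A l = (if l \<in> Z then {(\<zero>\<^bsub>R\<^esub>, \<zero>\<^bsub>R\<^esub>)} else ?S)" for l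
    define f :: "nat \<Rightarrow> nat \<times> nat \<Rightarrow> real" where "f l = indicator (A l)" for l
    have q: "3 \<le> ?q" using card_carrier_ge by simp
    have A: "A l \<subseteq> plane R" "A l \<noteq> {}" for l
      using circle_subset_plane circle_nonempty[OF one_closed] by (auto simp: A_def plane_def)
    have S: "0 < card ?S" using circle_nonempty[OF one_closed] finite_circle by (simp add: card_gt_0_iff)
    obtain T where T: "T \<subseteq> ?V \<rightarrow>\<^sub>E plane R" "card ?S ^ circle_exponent G \<le> card T"
      "\<And>x i j. \<lbrakk>x \<in> T; (i, j) \<in> edge_pairs G\<rbrakk> \<Longrightarrow> plane_diff R (x i) (x j) \<in> ?S"
      "\<And>x l. \<lbrakk>x \<in> T; l \<in> ?V\<rbrakk> \<Longrightarrow> x l \<in> A l"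
      using assms(3)[OF adm] unfolding A_def by blast
    let ?h = "\<lambda>x. (\<Prod>(i, j) \<in> edge_pairs G. circle_kernel R \<one>\<^bsub>R\<^esub> (x i) (x j)) * (\<Prod>l\<in>?V. f l (x l))"
    have "?h x = 1" if "x \<in> T" for x
    proof -
      have "(\<Prod>(i, j) \<in> edge_pairs G. circle_kernel R \<one>\<^bsub>R\<^esub> (x i) (x j)) = 1"
        using T(3)[OF that] by (intro prod.neutral) (auto simp: circle_kernel_def)
      moreover have "(\<Prod>l\<in>?V. f l (x l)) = 1"
        using T(4)[OF that] by (intro prod.neutral) (auto simp: f_def)
      ultimately show ?thesis by simp
    qed
    then have "real (card T) = sum ?h T" by simp
    also have "\<dots> \<le> sum ?h (?V \<rightarrow>\<^sub>E plane R)"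
      using T(1) finV finite_plane
      by (intro sum_mono2 finite_PiE) (auto intro!: mult_nonneg_nonneg prod_nonneg simp: f_def)
    finally have "real (card ?S ^ circle_exponent G) \<le> sum ?h (?V \<rightarrow>\<^sub>E plane R)"
      using T(2) by linarith
    then have "real (card ?S ^ circle_exponent G) / normalizer R \<one>\<^bsub>R\<^esub> G \<le> graph_form R \<one>\<^bsub>R\<^esub> G f"
      unfolding graph_form_eq by (intro divide_right_mono) (auto simp: normalizer_def)
    then have "1 / ?q\<^sup>2 \<le> graph_form R \<one>\<^bsub>R\<^esub> G f"
      using S by (simp add: normalizer_def)
    also have "\<dots> \<le> C * (\<Prod>l\<in>?V. Lp_norm R (p l) (f l))"
      by (rule C(2)[OF adm]) (auto simp: f_def)
    also have "\<dots> \<le> C * (\<Prod>l\<in>?V. 2 * ?q powr (- ?w l))"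
    proof (intro mult_left_mono prod_mono conjI)
      fix l assume l: "l \<in> ?V"
      note a = inv_exp_bounds[OF p[OF l]]
      show "0 \<le> Lp_norm R (p l) (f l)" using finite_carrier zero_closed by (intro Lp_norm_nonneg) auto
      have "Lp_norm R (p l) (f l) = (real (card (A l)) / ?q\<^sup>2) powr inv_exp (p l)"
        unfolding f_def by (rule Lp_norm_indicator[OF finite_carrier A p[OF l]])
      also have "\<dots> \<le> 2 * ?q powr (- ?w l)"
      proof (cases "l \<in> Z")
        case True
        have "1 / ?q\<^sup>2 = ?q powr (- 2)" using q by (simp add: powr_minus divide_inverse)
        then show ?thesis using True q by (simp add: A_def powr_powr)
      next
        case False
        have "real (card (A l)) / ?q\<^sup>2 \<le> 2 * ?q / ?q\<^sup>2"
          using card_circle_le[OF one_closed] False by (intro divide_right_mono) (auto simp: A_def)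
        also have "\<dots> = 2 * ?q powr (- 1)" using q by (simp add: powr_minus power2_eq_square field_simps)
        finally have "(real (card (A l)) / ?q\<^sup>2) powr inv_exp (p l) \<le> (2 * ?q powr (- 1)) powr inv_exp (p l)"
          using a by (intro powr_mono2) auto
        also have "\<dots> = 2 powr inv_exp (p l) * ?q powr (- inv_exp (p l))"
          by (simp only: powr_mult powr_powr powr_ge_zero zero_le_numeral) simp
        also have "\<dots> \<le> 2 powr 1 * ?q powr (- inv_exp (p l))"
          using a by (intro mult_right_mono powr_mono) auto
        finally show ?thesis using False by simp
      qed
      finally show "Lp_norm R (p l) (f l) \<le> 2 * ?q powr (- ?w l)" .
    qed (use C(1) in auto)
    also have "(\<Prod>l\<in>?V. 2 * ?q powr (- ?w l)) = 2 ^ card ?V * ?q powr (- (\<Sum>l\<in>?V. ?w l))"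
      using finV q by (simp add: prod.distrib powr_sum sum_negf[symmetric])
    finally have "1 / ?q\<^sup>2 \<le> C * 2 ^ card ?V * ?q powr (- (\<Sum>l\<in>?V. ?w l))" by (simp only: mult.assoc)
    then show "\<exists>q::nat. N \<le> q \<and> 1 \<le> q \<and> 1 / (real q)\<^sup>2 \<le> C * 2 ^ card ?V * real q powr (- (\<Sum>l\<in>?V. ?w l))"
      using N q by (intro exI[of _ "card (carrier R)"]) auto
  qed
qed

text \<open>The three colour classes are placed at the vertices of an equilateral triangle.\<close>

lemma bounded_form_necessary_colouring:
  fixes col :: "nat \<Rightarrow> nat"
  assumes bd: "bounded_form G p" and p: "\<And>l. l \<in> vertices G \<Longrightarrow> 1 \<le> p l"
    and proper: "\<And>i j. (i, j) \<in> edge_pairs G \<Longrightarrow> i \<in> vertices G \<and> j \<in> vertices G \<and> col i \<noteq> col j"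
    and col: "\<And>l. l \<in> vertices G \<Longrightarrow> col l \<le> 2" and v: "v \<in> vertices G" "col v = 1"
    and exponent: "circle_exponent G = 1"
  shows "(\<Sum>l\<in>vertices G. if l \<in> {l. col l = 0} then 2 * inv_exp (p l) else inv_exp (p l)) \<le> 2"
proof (rule bounded_form_necessary[OF bd p])
  let ?V = "vertices G"
  fix R :: "nat ring"
  assume adm: "admissible_field R"
  interpret odd_finite_field R by (rule admissible_imp_odd_finite_field[OF adm])
  let ?S = "circle R \<one>\<^bsub>R\<^esub>" and ?o = "(\<zero>\<^bsub>R\<^esub>, \<zero>\<^bsub>R\<^esub>)"
  obtain c where "c \<in> carrier R" "c \<otimes>\<^bsub>R\<^esub> c = \<one>\<^bsub>R\<^esub> \<oplus>\<^bsub>R\<^esub> \<one>\<^bsub>R\<^esub> \<oplus>\<^bsub>R\<^esub> \<one>\<^bsub>R\<^esub>"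
    using adm unfolding admissible_field_def Let_def by auto
  then obtain \<rho> where \<rho>: "\<And>s. s \<in> ?S \<Longrightarrow> \<rho> s \<in> ?S" "\<And>s. s \<in> ?S \<Longrightarrow> plane_diff R s (\<rho> s) \<in> ?S"
    using equilateral_obtain by metis
  define pt where "pt k s = (if k = 0 then ?o else if k = 1 then s else \<rho> s)" for k :: nat and s
  define emb where "emb s = (\<lambda>l\<in>?V. pt (col l) s)" for s
  have pt_plane: "pt k s \<in> plane R" if "s \<in> ?S" for k s
    using that \<rho>(1)[OF that] circle_subset_plane by (auto simp: pt_def plane_def)
  have origin: "plane_diff R s ?o = s" if "s \<in> ?S" for s
    using that by (auto simp: circle_def plane_def plane_diff_def minus_eq)
  have adj: "plane_diff R (pt k s) (pt m s) \<in> ?S"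
    if s: "s \<in> ?S" and km: "k \<le> 2" "m \<le> 2" "k < m" for k m s
  proof -
    have "plane_diff R (pt m s) ?o \<in> ?S" if "0 < m"
      using that s \<rho>(1)[OF s] by (simp add: pt_def origin)
    then have "plane_diff R ?o (pt m s) \<in> ?S" if "0 < m"
      using that plane_diff_circle_sym[OF pt_plane[OF s, of 0] pt_plane[OF s, of m]] by (simp add: pt_def)
    moreover have "k = 0 \<or> k = 1 \<and> m = 2" using km by linarith
    ultimately show ?thesis using km \<rho>(2)[OF s] by (auto simp: pt_def)
  qed
  have adj': "plane_diff R (pt k s) (pt m s) \<in> ?S"
    if s: "s \<in> ?S" and km: "k \<le> 2" "m \<le> 2" "k \<noteq> m" for k m s
    using adj[OF s, of k m] adj[OF s, of m k] km plane_diff_circle_sym[OF pt_plane[OF s, of k] pt_plane[OF s, of m]]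
    by (cases "k < m") auto
  \<comment> \<open>The vertex \<open>v\<close> of colour 1 sits at \<open>s\<close> itself, so
    different \<open>s\<close> give different copies: |S_1| of them, the power required by exponent
    1.\<close>
  have "inj_on emb ?S"
  proof (rule inj_onI)
    fix s s' assume "emb s = emb s'"
    then have "emb s v = emb s' v" by simp
    then show "s = s'" using v by (simp add: emb_def pt_def)
  qed
  then have card: "card ?S ^ circle_exponent G \<le> card (emb ` ?S)"
    by (simp add: card_image exponent)
  have sub: "emb ` ?S \<subseteq> ?V \<rightarrow>\<^sub>E plane R"
    by (auto simp: emb_def pt_plane)
  have edge: "plane_diff R (emb s i) (emb s j) \<in> ?S"
    if s: "s \<in> ?S" and ij: "(i, j) \<in> edge_pairs G" for s i j
    using adj'[OF s, of "col i" "col j"] proper[OF ij] col by (simp add: emb_def)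
  have place: "emb s l \<in> (if l \<in> {l. col l = 0} then {?o} else ?S)"
    if s: "s \<in> ?S" and l: "l \<in> ?V" for s l
    using s l \<rho>(1)[OF s] by (simp add: emb_def pt_def)
  show "\<exists>T. T \<subseteq> ?V \<rightarrow>\<^sub>E plane R \<and> card ?S ^ circle_exponent G \<le> card T
      \<and> (\<forall>x\<in>T. (\<forall>(i, j)\<in>edge_pairs G. plane_diff R (x i) (x j) \<in> ?S)
          \<and> (\<forall>l\<in>?V. x l \<in> (if l \<in> {l. col l = 0} then {?o} else ?S)))"
    using sub card edge place by (intro exI[of _ "emb ` ?S"]) blast
qed

text \<open>Two opposite vertices are both placed at the origin, since the form also counts copies
  with coinciding points; the other two then run freely over the circle, giving |S_1|^2
  copies.\<close>

lemma bounded_form_C4_necessary: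
  assumes bd: "bounded_form C4 p" and p: "\<forall>l\<in>{1..4}. 1 \<le> p l" and Z: "Z = {1, 3} \<or> Z = {2, 4}"
  shows "(\<Sum>l\<in>vertices C4. if l \<in> Z then 2 * inv_exp (p l) else inv_exp (p l)) \<le> 2"
proof (rule bounded_form_necessary[OF bd])
  fix l assume "l \<in> vertices C4"
  then show "1 \<le> p l" using p by (simp add: vertices_def)
next
  fix R :: "nat ring"
  assume adm: "admissible_field R"
  interpret odd_finite_field R by (rule admissible_imp_odd_finite_field[OF adm])
  let ?S = "circle R \<one>\<^bsub>R\<^esub>" and ?o = "(\<zero>\<^bsub>R\<^esub>, \<zero>\<^bsub>R\<^esub>)"
  define A where "A l = (if l \<in> Z then {?o} else ?S)" for l
  have A: "A l \<subseteq> plane R" for l using circle_subset_plane by (auto simp: A_def plane_def)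
  have o: "?o \<in> plane R" by (simp add: plane_def)
  have origin: "plane_diff R s ?o \<in> ?S" "plane_diff R ?o s \<in> ?S" if "s \<in> ?S" for s
  proof -
    show "plane_diff R s ?o \<in> ?S"
      using that by (auto simp: circle_def plane_def plane_diff_def minus_eq)
    then show "plane_diff R ?o s \<in> ?S"
      using that plane_diff_circle_sym[OF o, of s] circle_subset_plane by auto
  qed
  have "card (Pi\<^sub>E (vertices C4) A) = (\<Prod>l\<in>vertices C4. card (A l))"
    by (rule card_PiE) (simp add: vertices_def)
  also have "\<dots> = card ?S ^ circle_exponent C4"
    using Z by (elim disjE) (simp_all add: vertices_simps A_def power2_eq_square)
  finally have card: "card ?S ^ circle_exponent C4 \<le> card (Pi\<^sub>E (vertices C4) A)" by simp
  have edge: "plane_diff R (x i) (x j) \<in> ?S"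
    if x: "x \<in> Pi\<^sub>E (vertices C4) A" and ij: "(i, j) \<in> edge_pairs C4" for x i j
  proof -
    have "x i \<in> A i" "x j \<in> A j" using x ij by (auto simp: edge_pairs_simps vertices_simps PiE_iff)
    moreover have "i \<in> Z \<and> j \<notin> Z \<or> i \<notin> Z \<and> j \<in> Z" using Z ij by (auto simp: edge_pairs_simps)
    ultimately show ?thesis by (auto simp: A_def origin)
  qed
  have "Pi\<^sub>E (vertices C4) A \<subseteq> vertices C4 \<rightarrow>\<^sub>E plane R" using A by (rule PiE_mono)
  then show "\<exists>T. T \<subseteq> vertices C4 \<rightarrow>\<^sub>E plane R \<and> card ?S ^ circle_exponent C4 \<le> card T
      \<and> (\<forall>x\<in>T. (\<forall>(i, j)\<in>edge_pairs C4. plane_diff R (x i) (x j) \<in> ?S)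
          \<and> (\<forall>l\<in>vertices C4. x l \<in> (if l \<in> Z then {?o} else ?S)))"
    using card edge unfolding A_def[symmetric] by (intro exI[of _ "Pi\<^sub>E (vertices C4) A"]) auto
qed

lemma bounded_form_K3_necessary:
  assumes bd: "bounded_form K3 p" and p: "\<forall>l\<in>{1..3}. 1 \<le> p l"
  shows "2 * inv_exp (p 1) + inv_exp (p 2) + inv_exp (p 3) \<le> 2"
    "inv_exp (p 1) + 2 * inv_exp (p 2) + inv_exp (p 3) \<le> 2"
    "inv_exp (p 1) + inv_exp (p 2) + 2 * inv_exp (p 3) \<le> 2"
proof -
  let ?c1 = "\<lambda>l::nat. if l = 1 then 0 else if l = 2 then 1 else 2 :: nat"
  let ?c2 = "\<lambda>l::nat. if l = 2 then 0 else if l = 1 then 1 else 2 :: nat"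
  let ?c3 = "\<lambda>l::nat. if l = 3 then 0 else if l = 1 then 1 else 2 :: nat"
  have "(\<Sum>l\<in>vertices K3. if l \<in> {l. ?c1 l = 0} then 2 * inv_exp (p l) else inv_exp (p l)) \<le> 2"
    by (rule bounded_form_necessary_colouring[OF bd, of _ 2]) (use p in \<open>auto simp: edge_pairs_simps vertices_simps\<close>)
  then show "2 * inv_exp (p 1) + inv_exp (p 2) + inv_exp (p 3) \<le> 2" by (simp add: vertices_simps)
  have "(\<Sum>l\<in>vertices K3. if l \<in> {l. ?c2 l = 0} then 2 * inv_exp (p l) else inv_exp (p l)) \<le> 2"
    by (rule bounded_form_necessary_colouring[OF bd, of _ 1]) (use p in \<open>auto simp: edge_pairs_simps vertices_simps\<close>)
  then show "inv_exp (p 1) + 2 * inv_exp (p 2) + inv_exp (p 3) \<le> 2" by (simp add: vertices_simps)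
  have "(\<Sum>l\<in>vertices K3. if l \<in> {l. ?c3 l = 0} then 2 * inv_exp (p l) else inv_exp (p l)) \<le> 2"
    by (rule bounded_form_necessary_colouring[OF bd, of _ 1]) (use p in \<open>auto simp: edge_pairs_simps vertices_simps\<close>)
  then show "inv_exp (p 1) + inv_exp (p 2) + 2 * inv_exp (p 3) \<le> 2" by (simp add: vertices_simps)
qed

text \<open>A proper 3-colouring gives 2 and 4 the same colour, as both are joined to 1 and 3. The
  three inequalities correspond to the class at the origin: {1}, {2, 4} or {3}.\<close>

lemma bounded_form_C4_diag_necessary:
  assumes bd: "bounded_form C4_diag p" and p: "\<forall>l\<in>{1..4}. 1 \<le> p l"
  shows "2 * inv_exp (p 1) + inv_exp (p 2) + inv_exp (p 3) + inv_exp (p 4) \<le> 2"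
    "inv_exp (p 1) + 2 * inv_exp (p 2) + inv_exp (p 3) + 2 * inv_exp (p 4) \<le> 2"
    "inv_exp (p 1) + inv_exp (p 2) + 2 * inv_exp (p 3) + inv_exp (p 4) \<le> 2"
proof -
  let ?c1 = "\<lambda>l::nat. if l = 1 then 0 else if l = 3 then 1 else 2 :: nat"
  let ?c2 = "\<lambda>l::nat. if l = 1 then 1 else if l = 3 then 2 else 0 :: nat"
  let ?c3 = "\<lambda>l::nat. if l = 3 then 0 else if l = 1 then 1 else 2 :: nat"
  have "(\<Sum>l\<in>vertices C4_diag. if l \<in> {l. ?c1 l = 0} then 2 * inv_exp (p l) else inv_exp (p l)) \<le> 2"
    by (rule bounded_form_necessary_colouring[OF bd, of _ 3]) (use p in \<open>auto simp: edge_pairs_simps vertices_simps\<close>)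
  then show "2 * inv_exp (p 1) + inv_exp (p 2) + inv_exp (p 3) + inv_exp (p 4) \<le> 2" by (simp add: vertices_simps)
  have "(\<Sum>l\<in>vertices C4_diag. if l \<in> {l. ?c2 l = 0} then 2 * inv_exp (p l) else inv_exp (p l)) \<le> 2"
    by (rule bounded_form_necessary_colouring[OF bd, of _ 1]) (use p in \<open>auto simp: edge_pairs_simps vertices_simps\<close>)
  then show "inv_exp (p 1) + 2 * inv_exp (p 2) + inv_exp (p 3) + 2 * inv_exp (p 4) \<le> 2" by (simp add: vertices_simps)
  have "(\<Sum>l\<in>vertices C4_diag. if l \<in> {l. ?c3 l = 0} then 2 * inv_exp (p l) else inv_exp (p l)) \<le> 2"
    by (rule bounded_form_necessary_colouring[OF bd, of _ 1]) (use p in \<open>auto simp: edge_pairs_simps vertices_simps\<close>)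
  then show "inv_exp (p 1) + inv_exp (p 2) + 2 * inv_exp (p 3) + inv_exp (p 4) \<le> 2" by (simp add: vertices_simps)
qed

section \<open>Degrees, exponent arithmetic and the final case distinction\<close>

lemma vertex_degree_eq_sum: "vertex_degree G v = (\<Sum>e\<in>edges G. if v \<in> e then 1 else 0)"
proof -
  have "finite (edges G)" by (cases G) simp_all
  then show ?thesis unfolding vertex_degree_def card_eq_sum by (rule sum.inter_filter)
qed

lemma min_degree_simps:
  "min_degree K3 = 2" "min_degree P2 = 1" "min_degree C4_diag = 2" "min_degree C4 = 2"
  "min_degree P3 = 1" "min_degree K3_tail = 1" "min_degree Y_shape = 1"
  by (simp_all add: min_degree_def vertices_simps vertex_degree_eq_sum doubleton_eq_iff)

text \<open>The disjunction splits the sufficient conditions into finitely many linear ones. For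
  \<open>P2\<close>, for instance, the regime a / 2 at both ends gives half of the second necessary
  inequality.\<close>

lemma gain_cases: "gain a = a / 2 \<or> gain a = 2 * a - 1"
  by (auto simp: gain_def max_def)

lemma exponents_P2:
  assumes "0 \<le> a1" "0 \<le> a2" "0 \<le> a3"
    and "2 * a1 + a2 + a3 \<le> 2" "a1 + 2 * a2 + a3 \<le> 2" "a1 + a2 + 2 * a3 \<le> 2"
  shows "a2 + gain a1 + gain a3 \<le> 1"
  using gain_cases[of a1] gain_cases[of a3] assms by (elim disjE) linarith+

lemma exponents_Y_shape:
  assumes "0 \<le> a1" "0 \<le> a2" "0 \<le> a3" "0 \<le> a4"
    and "2 * a1 + a2 + a3 + a4 \<le> 2" "a1 + 2 * a2 + a3 + 2 * a4 \<le> 2" "a1 + a2 + 2 * a3 + a4 \<le> 2"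
  shows "a3 + gain a1 + gain a2 + gain a4 \<le> 1"
  using gain_cases[of a1] gain_cases[of a2] gain_cases[of a4] assms by (elim disjE) linarith+

lemma exponents_P3:
  assumes "0 \<le> a1" "0 \<le> a2" "0 \<le> a3" "0 \<le> a4"
    and "a1 + a2 + 2 * a3 + a4 \<le> 2" "2 * a1 + a2 + a3 + a4 \<le> 2" "a1 + 2 * a2 + a3 + 2 * a4 \<le> 2"
  shows "a3 + gain a4 \<le> 1" "a2 + gain a1 + gain (a3 + gain a4) \<le> 1"
proof -
  show "a3 + gain a4 \<le> 1" using gain_cases[of a4] assms by (elim disjE) linarith+
  define c where "c = a3 + gain a4"
  have "a2 + gain a1 + gain c \<le> 1"
    using gain_cases[of a1] gain_cases[of c] gain_cases[of a4] c_def assms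
    by (elim disjE) linarith+
  then show "a2 + gain a1 + gain (a3 + gain a4) \<le> 1" by (simp add: c_def)
qed

lemma exponents_K3_tail:
  assumes "0 \<le> a1" "0 \<le> a2" "0 \<le> a3" "0 \<le> a4"
    and "2 * a1 + a2 + a3 + a4 \<le> 2" "a1 + 2 * a2 + a3 + 2 * a4 \<le> 2" "a1 + a2 + 2 * a3 + a4 \<le> 2"
  shows "2 * a1 + a2 + (a3 + gain a4) \<le> 2 \<and> a1 + 2 * a2 + (a3 + gain a4) \<le> 2
    \<and> a1 + a2 + 2 * (a3 + gain a4) \<le> 2"
proof -
  obtain g where g: "gain a4 = g" "g = a4 / 2 \<or> g = 2 * a4 - 1" using gain_cases[of a4] by blast
  show ?thesis unfolding g(1) using g(2) assms by argo
qed

theorem theorem10p8: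
  fixes n :: nat and G G' :: graph and p :: "nat \<Rightarrow> ereal"
  assumes "n \<in> {3, 4}"
    and "nverts G = n" and "nverts G' = n"
    and "edges G' \<subseteq> edges G"
    and "min (min_degree G) 2 > min_degree G'"
    and "\<forall>l\<in>{1..n}. 1 \<le> p l"
    and "bounded_form G p"
  shows "(\<not> (G = C4_diag \<and> G' = K3_tail \<and> p 1 = 2 \<and> p 2 = 2 \<and> p 3 = 2 \<and> p 4 = \<infinity>)
            \<longrightarrow> bounded_form G' p)
         \<and> restricted_bounded_form K3_tail ((\<lambda>_. 2)(4 := \<infinity>))"
proof
  show "restricted_bounded_form K3_tail ((\<lambda>_. 2)(4 := \<infinity>))"
  proof (rule bounded_form_imp_restricted)
    show "bounded_form K3_tail ((\<lambda>_. 2)(4 := \<infinity>))"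
      \<comment> \<open>As \<open>gain 0 = 0\<close>, all three conditions hold with equality: the
        point is the vertex (1/2, 1/2, 1/2) of the triangle polytope.\<close>
      by (rule bounded_form_K3_tail) (auto simp: gain_def inv_exp_def one_ereal_def)
  qed (auto simp: one_ereal_def)
  have a: "0 \<le> inv_exp (p l)" if "l \<in> {1..n}" for l
    using inv_exp_bounds assms(6) that by auto
  \<comment> \<open>The degree condition forces minimum degrees 2 and 1. \<open>C4\<close> lacks the
    edge {1, 3}, so among the subgraphs with a leaf it contains only \<open>P3\<close>.\<close>
  consider "G = K3" "G' = P2" | "G = C4" "G' = P3" | "G = C4_diag" "G' = P3"
    | "G = C4_diag" "G' = K3_tail" | "G = C4_diag" "G' = Y_shape"
    using assms(2-5) by (cases G; cases G'; simp add: min_degree_simps doubleton_eq_iff)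
  then have "bounded_form G' p"
  proof cases
    case 1
    then have n: "n = 3" using assms(2) by simp
    have p: "\<forall>l\<in>{1..3}. 1 \<le> p l" and bd: "bounded_form K3 p" using assms(6,7) 1(1) n by auto
    have "0 \<le> inv_exp (p 1)" "0 \<le> inv_exp (p 2)" "0 \<le> inv_exp (p 3)" using a n by auto
    then show ?thesis
      unfolding 1 using bounded_form_K3_necessary[OF bd p]
      by (intro bounded_form_P2[OF p] exponents_P2)
  next
    case 2
    then have n: "n = 4" using assms(2) by simp
    have p: "\<forall>l\<in>{1..4}. 1 \<le> p l" and bd: "bounded_form C4 p" using assms(6,7) 2(1) n by auto
    have a4: "0 \<le> inv_exp (p 1)" "0 \<le> inv_exp (p 2)" "0 \<le> inv_exp (p 3)" "0 \<le> inv_exp (p 4)"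
      using a n by auto
    have "2 * inv_exp (p 1) + inv_exp (p 2) + 2 * inv_exp (p 3) + inv_exp (p 4) \<le> 2"
      using bounded_form_C4_necessary[OF bd p, of "{1, 3}"] by (simp add: vertices_simps)
    moreover have "inv_exp (p 1) + 2 * inv_exp (p 2) + inv_exp (p 3) + 2 * inv_exp (p 4) \<le> 2"
      using bounded_form_C4_necessary[OF bd p, of "{2, 4}"] by (simp add: vertices_simps)
    \<comment> \<open>The conditions from \<open>C4\<close> imply those from \<open>C4_diag\<close>,
      so \<open>exponents_P3\<close> serves both graphs.\<close>
    ultimately have
      "inv_exp (p 1) + inv_exp (p 2) + 2 * inv_exp (p 3) + inv_exp (p 4) \<le> 2"
      "2 * inv_exp (p 1) + inv_exp (p 2) + inv_exp (p 3) + inv_exp (p 4) \<le> 2"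
      "inv_exp (p 1) + 2 * inv_exp (p 2) + inv_exp (p 3) + 2 * inv_exp (p 4) \<le> 2"
      using a4 by linarith+
    then show ?thesis unfolding 2 using a4 by (intro bounded_form_P3[OF p] exponents_P3)
  next
    case 3
    then have n: "n = 4" using assms(2) by simp
    have p: "\<forall>l\<in>{1..4}. 1 \<le> p l" and bd: "bounded_form C4_diag p" using assms(6,7) 3(1) n by auto
    have "0 \<le> inv_exp (p 1)" "0 \<le> inv_exp (p 2)" "0 \<le> inv_exp (p 3)" "0 \<le> inv_exp (p 4)"
      using a n by auto
    then show ?thesis
      unfolding 3 using bounded_form_C4_diag_necessary[OF bd p]
      by (intro bounded_form_P3[OF p] exponents_P3)
  next
    case 4
    then have n: "n = 4" using assms(2) by simp
    have p: "\<forall>l\<in>{1..4}. 1 \<le> p l" and bd: "bounded_form C4_diag p" using assms(6,7) 4(1) n by auto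
    have "0 \<le> inv_exp (p 1)" "0 \<le> inv_exp (p 2)" "0 \<le> inv_exp (p 3)" "0 \<le> inv_exp (p 4)"
      using a n by auto
    then show ?thesis
      unfolding 4 using exponents_K3_tail bounded_form_C4_diag_necessary[OF bd p]
      by (intro bounded_form_K3_tail[OF p]) blast+
  next
    case 5
    then have n: "n = 4" using assms(2) by simp
    have p: "\<forall>l\<in>{1..4}. 1 \<le> p l" and bd: "bounded_form C4_diag p" using assms(6,7) 5(1) n by auto
    have "0 \<le> inv_exp (p 1)" "0 \<le> inv_exp (p 2)" "0 \<le> inv_exp (p 3)" "0 \<le> inv_exp (p 4)"
      using a n by auto
    then show ?thesis
      unfolding 5 using bounded_form_C4_diag_necessary[OF bd p]
      by (intro bounded_form_Y_shape[OF p] exponents_Y_shape)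
  qed
  then show "\<not> (G = C4_diag \<and> G' = K3_tail \<and> p 1 = 2 \<and> p 2 = 2 \<and> p 3 = 2 \<and> p 4 = \<infinity>)
      \<longrightarrow> bounded_form G' p" by simp
qed

end
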